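(* $\operatorname{Ker}(Z^\diamondsuit)=\mathsf{Drop1}$, where $\mathsf{Drop1}=\operatorname{span}_{\mathbb{Q}}\{w-\mathcal{D}(w)\mid w\in y\mathcal{H}x\}$.
   Context: $[n]=\{1,\dots,n\}$. An index is a tuple of positive integers; admissible = nonempty with last entry $\ge2$. For $N\ge1$ and admissible $\boldsymbol{k}=(k_1,\dots,k_r)$: $[r]^1_{\boldsymbol{k}}=\{i:k_i=1\}$, $S_{r,N}(A)=\{(n_1,\dots,n_r)\in[N-1]^r: n_i\le n_{i+1}\ (i\in A),\ n_i<n_{i+1}\ (i\in[r-1]\setminus A)\}$, $\zeta^\diamondsuit_N(\boldsymbol{k})=\sum_{A\subset[r]^1_{\boldsymbol{k}}}\sum_{S_{r,N}(A)}\prod_{i\in A}(N-n_i)^{-1}\prod_{i\notin A}n_i^{-k_i}$, $\zeta^\diamondsuit(\boldsymbol{k})=(\zeta^\diamondsuit_N(\boldsymbol{k}))_{N\ge1}\in\mathbb{Q}^{\mathbb{N}}$. $\mathcal{H}=\mathbb{Q}\langle x,y\rangle$, $\mathcal{H}^0=\mathbb{Q}+y\mathcal{H}x$, $\mathcal{H}^{\ge2}=\mathbb{Q}+yx\,\mathbb{Q}\langle x,yx\rangle$, $e_k=yx^{k-1}$; $Z^\diamondsuit\colon\mathcal{H}^0\to\mathbb{Q}^{\mathbb{N}}$ is $\mathbb{Q}$-linear with $Z^\diamondsuit(1)=(1)_N$, $Z^\diamondsuit(e_{k_1}\cdots e_{k_r})=\zeta^\diamondsuit(k_1,\dots,k_r)$.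 For an index $\boldsymbol{c}=(c_1,\dots,c_r)$: $[r]^1_{\boldsymbol{c}}=\{i:c_i=1\}$, $[r]^{>1}_{\boldsymbol{c}}=\{i:c_i>1\}$; for $A\subset[r]$ with $[r]\setminus A=\{i_1<\dots<i_t\}$, $\boldsymbol{c}_{(-A)}=(c_{i_1},\dots,c_{i_t})$, $\boldsymbol{c}_{(-A)}-\boldsymbol{\delta}_B=(c_{i_1}-\delta_{i_1\in B},\dots,c_{i_t}-\delta_{i_t\in B})$. $A\subset[2s]$ is even-odd if (even $i\in A\Rightarrow i+1\in A$) and (odd $i\in A\Rightarrow i-1\in A$); odd-even if (odd $i\in A\Rightarrow i+1\in A$) and (even $i\in A\Rightarrow i-1\in A$). $\mathcal{D}\colon\mathcal{H}^0\to\mathcal{H}^{\ge2}$ is $\mathbb{Q}$-linear with $\mathcal{D}(1)=1$ and, with $\mathfrak{D}(\boldsymbol{c})=\mathcal{D}(y^{c_1}x^{c_2}\cdots y^{c_{2s-1}}x^{c_{2s}})$ for even-depth $\boldsymbol{c}$ and $\mathfrak{D}(\varnothing)=1$, \begin{align*} \mathfrak{D}(\boldsymbol{c})&=\sum_{\substack{A\subset[2s]^1_{\boldsymbol{c}}\\ A\text{ even-odd}}}\ \sum_{\substack{B\subset[2s]^{>1}_{\boldsymbol{c}},\ \#A+\#B\ge1\\ \{2r,2r+1\}\not\subset B\ (r\in[s-1])}}(-1)^{\#B-1}\mathfrak{D}(\boldsymbol{c}_{(-A)}-\boldsymbol{\delta}_B)\,x^{\#A+\#B}\\ &\quad+\sum_{\substack{A\subset[2s]^1_{\boldsymbol{c}}\\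 A\text{ even-odd}}}\ \sum_{\substack{B\subset[2s]^{>1}_{\boldsymbol{c}},\ \#A+\#B\ge2\\ \{2r,2r+1\}\not\subset B\ (r\in[s-1])}}(-1)^{\#B-1}\mathfrak{D}(\boldsymbol{c}_{(-A)}-\boldsymbol{\delta}_B)\,yx^{\#A+\#B-1}\\ &\quad+\sum_{\substack{A\subset[2s]^1_{\boldsymbol{c}}\\ A\text{ odd-even}}}\ \sum_{\substack{B\subset[2s]^{>1}_{\boldsymbol{c}},\ \#A+\#B\ge2\\ \{2r-1,2r\}\not\subset B\ (r\in[s])}}(-1)^{\#B}\mathfrak{D}(\boldsymbol{c}_{(-A)}-\boldsymbol{\delta}_B)\,yx^{\#A+\#B-1}. \end{align*} *)

theory Defs
  imports Complex_Main "HOL-Library.Poly_Mapping" "HOL-Library.FuncSet"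
begin

datatype letter = X | Y

type_synonym word = "letter list"
type_synonym hpoly = "word \<Rightarrow>\<^sub>0 rat"

definition hscale :: "rat \<Rightarrow> hpoly \<Rightarrow> hpoly" where
  "hscale a p = Poly_Mapping.map (\<lambda>q. a * q) p"

definition hword :: "word \<Rightarrow> hpoly" where
  "hword w = Poly_Mapping.single w 1"

definition hrmul :: "hpoly \<Rightarrow> word \<Rightarrow> hpoly" where
  "hrmul p u = (\<Sum>w\<in>Poly_Mapping.keys p. Poly_Mapping.single (w @ u) (Poly_Mapping.lookup p w))"

definition in_yHx :: "hpoly \<Rightarrow> bool" where
  "in_yHx p \<longleftrightarrow> (\<forall>w\<in>Poly_Mapping.keys p. w \<noteq> [] \<and> hd w = Y \<and> last w = X)"

definition in_H0 :: "hpoly \<Rightarrow> bool" where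
  "in_H0 p \<longleftrightarrow> (\<forall>w\<in>Poly_Mapping.keys p. w = [] \<or> (hd w = Y \<and> last w = X))"

definition S_set :: "nat \<Rightarrow> nat \<Rightarrow> nat set \<Rightarrow> (nat \<Rightarrow> nat) set" where
  "S_set r N A = {n \<in> PiE {1..r} (\<lambda>_. {1..N-1}).
      (\<forall>i\<in>A. i \<le> r - 1 \<longrightarrow> n i \<le> n (i+1)) \<and>
      (\<forall>i\<in>{1..r-1} - A. n i < n (i+1))}"

text \<open>indices are lists k = [k_1,...,k_r]; position i (1-based) is k!(i-1)\<close>
definition ones :: "nat list \<Rightarrow> nat set" where
  "ones k = {i \<in> {1..length k}. k!(i-1) = 1}"

definition gtones :: "nat list \<Rightarrow> nat set" where
  "gtones k = {i \<in> {1..length k}. k!(i-1) > 1}"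

definition zeta_diamond_N :: "nat list \<Rightarrow> nat \<Rightarrow> rat" where
  "zeta_diamond_N k N =
     (\<Sum>A\<in>Pow (ones k). \<Sum>n\<in>S_set (length k) N A.
        (\<Prod>i\<in>A. 1 / of_nat (N - n i)) *
        (\<Prod>i\<in>{1..length k} - A. 1 / (of_nat (n i)) ^ (k!(i-1))))"

definition ewords :: "nat list \<Rightarrow> word" where
  "ewords ks = concat (map (\<lambda>k. Y # replicate (k - 1) X) ks)"

text \<open>Z^diamond on basis words of H^0 (values are sequences indexed by N; only N \<ge> 1 matters)\<close>
definition Zd_word :: "word \<Rightarrow> nat \<Rightarrow> rat" where
  "Zd_word w = (if w = [] then (\<lambda>N. 1)
      else zeta_diamond_N (THE ks. (\<forall>k\<in>set ks. k \<ge> 1) \<and> ewords ks = w))"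

definition Zd :: "hpoly \<Rightarrow> nat \<Rightarrow> rat" where
  "Zd p N = (\<Sum>w\<in>Poly_Mapping.keys p. Poly_Mapping.lookup p w * Zd_word w N)"

definition remdec :: "nat list \<Rightarrow> nat set \<Rightarrow> nat set \<Rightarrow> nat list" where
  "remdec c A B = map (\<lambda>i. c!(i-1) - (if i \<in> B then 1 else 0))
                      (filter (\<lambda>i. i \<notin> A) [1..<length c + 1])"

definition even_odd :: "nat set \<Rightarrow> bool" where
  "even_odd A \<longleftrightarrow> (\<forall>i\<in>A. (even i \<longrightarrow> i + 1 \<in> A) \<and> (odd i \<longrightarrow> i - 1 \<in> A))"

definition odd_even :: "nat set \<Rightarrow> bool" where
  "odd_even A \<longleftrightarrow> (\<forall>i\<in>A. (odd i \<longrightarrow> i + 1 \<in> A) \<and> (even i \<longrightarrow> i - 1 \<in> A))"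

definition xpow :: "nat \<Rightarrow> word" where "xpow m = replicate m X"

lemma remdec_sum_less:
  assumes "A \<subseteq> ones c" "B \<subseteq> gtones c" "card A + card B \<ge> 1"
  shows "sum_list (remdec c A B) < sum_list c"
proof -
  define I where "I = {1..length c}"
  have fin: "finite I" "finite A" "finite B" using assms(1,2) by (auto simp: I_def ones_def gtones_def intro: finite_subset)
  have AI: "A \<subseteq> I" and BI: "B \<subseteq> I - A" using assms(1,2) by (fastforce simp: I_def ones_def gtones_def)+
  have r: "sum_list (remdec c A B) = (\<Sum>i\<in>I - A. c!(i-1) - (if i \<in> B then 1 else 0))"
    unfolding remdec_def I_def
    by (subst sum_list_distinct_conv_sum_set) (auto intro!: sum.cong)
  have s: "sum_list c = (\<Sum>i\<in>I. c!(i-1))"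
  proof -
    have "sum_list c = (\<Sum>i<length c. c!i)" by (simp add: sum_list_sum_nth atLeast0LessThan)
    also have "\<dots> = (\<Sum>i\<in>I. c!(i-1))" unfolding I_def
      by (rule sum.reindex_bij_witness[where i="\<lambda>i. i-1" and j="\<lambda>i. i+1"]) auto
    finally show ?thesis .
  qed
  have "(\<Sum>i\<in>I - A. c!(i-1) - (if i \<in> B then 1 else 0)) + (\<Sum>i\<in>I - A. (if i \<in> B then 1 else 0))
        = (\<Sum>i\<in>I - A. c!(i-1))"
    unfolding sum.distrib[symmetric]
    using assms(2) BI by (intro sum.cong) (auto simp: gtones_def)
  moreover have "(\<Sum>i\<in>I - A. (if i \<in> B then 1 else 0)::nat) = card B"
    using fin BI by (simp add: sum.If_cases Int_absorb1)
  moreover have "(\<Sum>i\<in>I. c!(i-1)) = (\<Sum>i\<in>I - A. c!(i-1)) + (\<Sum>i\<in>A. c!(i-1))"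
    using fin AI by (metis add.commute sum.subset_diff)
  moreover have "(\<Sum>i\<in>A. c!(i-1)) = (\<Sum>i\<in>A. 1)" using assms(1) by (intro sum.cong) (auto simp: ones_def)
  then have "(\<Sum>i\<in>A. c!(i-1)) = card A" by simp
  ultimately show ?thesis using r s assms(3) by linarith
qed

function Dfrak :: "nat list \<Rightarrow> hpoly" where
  "Dfrak c = (if c = [] then hword [] else
     (let s = length c div 2 in
      (\<Sum>A\<in>{A. A \<subseteq> ones c \<and> even_odd A}.
         \<Sum>B\<in>{B. B \<subseteq> gtones c \<and> card A + card B \<ge> 1 \<and>
                  (\<forall>r\<in>{1..s-1}. \<not> {2*r, 2*r+1} \<subseteq> B)}.
           hscale ((-1) ^ (card B + 1)) (hrmul (Dfrak (remdec c A B)) (xpow (card A + card B))))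
    + (\<Sum>A\<in>{A. A \<subseteq> ones c \<and> even_odd A}.
         \<Sum>B\<in>{B. B \<subseteq> gtones c \<and> card A + card B \<ge> 2 \<and>
                  (\<forall>r\<in>{1..s-1}. \<not> {2*r, 2*r+1} \<subseteq> B)}.
           hscale ((-1) ^ (card B + 1)) (hrmul (Dfrak (remdec c A B)) (Y # xpow (card A + card B - 1))))
    + (\<Sum>A\<in>{A. A \<subseteq> ones c \<and> odd_even A}.
         \<Sum>B\<in>{B. B \<subseteq> gtones c \<and> card A + card B \<ge> 2 \<and>
                  (\<forall>r\<in>{1..s}. \<not> {2*r-1, 2*r} \<subseteq> B)}.
           hscale ((-1) ^ card B) (hrmul (Dfrak (remdec c A B)) (Y # xpow (card A + card B - 1))))))"
  by auto
termination
  apply (relation "measure sum_list")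
  apply (auto intro!: remdec_sum_less)
  done

definition cword :: "nat list \<Rightarrow> word" where
  "cword c = concat (map (\<lambda>i. replicate (c!i) (if even i then Y else X)) [0..<length c])"

definition D_word :: "word \<Rightarrow> hpoly" where
  "D_word w = (if w = [] then hword []
     else Dfrak (THE c. even (length c) \<and> (\<forall>i\<in>set c. i \<ge> 1) \<and> cword c = w))"

definition D :: "hpoly \<Rightarrow> hpoly" where
  "D p = (\<Sum>w\<in>Poly_Mapping.keys p. hscale (Poly_Mapping.lookup p w) (D_word w))"

definition Drop1 :: "hpoly set" where
  "Drop1 = module.span hscale {w - D w | w. in_yHx w}"

end

theory Submission
  imports Defs "HOL-Computational_Algebra.Polynomial_Factorial"
    "HOL-Computational_Algebra.Field_as_Ring"
begin

text \<open>
  A connected sum turns \<open>\<zeta>\<^sub>N(w)\<close> into a sum over one variable per letter, with weight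
  \<open>1/(N-n)\<close> for \<open>y\<close> and \<open>1/n\<close> for \<open>x\<close>, the variables increasing weakly except for a strict step
  from \<open>x\<close> to a following \<open>y\<close>. Partial fractions \<open>1/(n(N-n)) = (1/n + 1/(N-n))/N\<close> trade weak
  for strict steps between neighbouring blocks, at the price of lowering exponents. Summing over
  the odd-even \<open>(A, B)\<close> at level \<open>N\<close>, or over the even-odd \<open>(A, B)\<close> at level \<open>N + 1\<close>, makes all
  steps between blocks strict and gives the same value. This identity is the recursion for \<open>D\<close>
  differenced in \<open>N\<close>, so \<open>w - D(w)\<close> is in the kernel. Conversely, the truncated multiple zeta values
  with all entries at least \<open>2\<close> are linearly independent, even over the polynomials in \<open>N\<close>:
  otherwise a sum of powers \<open>N\<^sup>-\<^sup>k\<close> would be the difference \<open>Q(N+1) - Q(N)\<close> of a rational function.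
\<close>

subsection \<open>Diamond sums as iterated prefix sums\<close>

text \<open>For a nonempty word \<open>u\<close> with all exponents at least 2, appending
  \<open>x^m\<close> multiplies the increment from level N to N+1 by \<open>N^-m\<close>, and
  appending \<open>y x^(m-1)\<close> with m at least 2 gives an increment of \<open>N^-m\<close>
  times the value of \<open>u\<close> at N. This argument breaks down for words with an exponent 1,
  whose weights \<open>1/(N-n)\<close> move with N. The comparison of two levels takes its place:
  since \<open>(N+1)-(n+1) = N-n\<close>, raising the level acts on the y-sums as a shift of the
  argument, which is just what a strict step is, while an x-sum only gains a summand at N.

  In the differenced recursion, the even-odd terms with \<open>y\<close> cancel the level-N half of
  the terms with \<open>x\<close>, and the odd-even terms supply its substitute. Terms with
  \<open>#A + #B = 1\<close> agree for both index sets; hence the sums with \<open>y\<close> can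
  start at 2, and no lone factor \<open>y\<close>, that is, no exponent 1, is ever appended.

  Independence is proved with polynomial coefficients because eliminating a leading coefficient
  combines the relations at N and N+1 with factors that depend on N.\<close>

lemma sum_Pow_insert:
  assumes "finite A" "x \<notin> A"
  shows "sum f (Pow (insert x A)) = (\<Sum>B\<in>Pow A. f B + f (insert x B))"
proof -
  have "sum f (Pow (insert x A)) = sum f (Pow A) + sum f (insert x ` Pow A)"
    unfolding Pow_insert using assms by (subst sum.union_disjoint) auto
  also have "sum f (insert x ` Pow A) = (\<Sum>B\<in>Pow A. f (insert x B))"
  proof -
    have "inj_on (insert x) (Pow A)"
    proof (rule inj_onI)
      fix B C assume "B \<in> Pow A" "C \<in> Pow A" "insert x B = insert x C"
      thus "B = C" using insert_ident[of x B C] assms(2) by blast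
    qed
    thus ?thesis by (simp add: sum.reindex)
  qed
  finally show ?thesis by (simp add: sum.distrib)
qed

text \<open>The index tuple is closed off by a virtual next entry \<open>m\<close>, so that a tuple of length
  \<open>r + 1\<close> is a last entry \<open>v\<close> together with a tuple of length \<open>r\<close> closed off by \<open>v\<close>.\<close>

definition T_set :: "nat \<Rightarrow> nat \<Rightarrow> nat set \<Rightarrow> nat \<Rightarrow> (nat \<Rightarrow> nat) set" where
  "T_set r N A m = {n \<in> PiE {1..r} (\<lambda>_. {1..N-1}). \<forall>i\<in>{1..r}.
     (i \<in> A \<longrightarrow> n i \<le> (if i < r then n (Suc i) else m)) \<and>
     (i \<notin> A \<longrightarrow> n i < (if i < r then n (Suc i) else m))}"

text \<open>Entries are at most \<open>N - 1\<close>, so closing the tuple with \<open>N\<close>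
  makes the condition on the last entry automatic, whether weak or strict.\<close>

lemma S_set_eq_T_set:
  assumes "A \<subseteq> {1..r}"
  shows "S_set r N A = T_set r N A N"
proof -
  have "(\<forall>i\<in>A. i \<le> r - 1 \<longrightarrow> n i \<le> n (i+1)) \<and> (\<forall>i\<in>{1..r-1} - A. n i < n (i+1)) \<longleftrightarrow>
     (\<forall>i\<in>{1..r}. (i \<in> A \<longrightarrow> n i \<le> (if i < r then n (Suc i) else N)) \<and>
       (i \<notin> A \<longrightarrow> n i < (if i < r then n (Suc i) else N)))"
    (is "?L \<longleftrightarrow> ?R") if n: "n \<in> PiE {1..r} (\<lambda>_. {1..N-1})" for n
  proof
    assume L: ?L
    show ?R
    proof
      fix i assume i: "i \<in> {1..r}"
      have "n i \<in> {1..N-1}" using n i by auto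
      hence "n i < N" by auto
      moreover have "i \<in> A \<Longrightarrow> i < r \<Longrightarrow> n i \<le> n (i+1)" using L by auto
      moreover have "i \<notin> A \<Longrightarrow> i < r \<Longrightarrow> n i < n (i+1)" using L i by auto
      ultimately show "(i \<in> A \<longrightarrow> n i \<le> (if i < r then n (Suc i) else N)) \<and>
          (i \<notin> A \<longrightarrow> n i < (if i < r then n (Suc i) else N))" by auto
    qed
  next
    assume R: ?R
    have "n i \<le> n (i+1)" if "i \<in> A" "i \<le> r - 1" for i
    proof -
      have "i \<in> {1..r}" "i < r" using that assms by (auto simp: subset_iff)
      thus ?thesis using R[rule_format, of i] that by simp
    qed
    moreover have "n i < n (i+1)" if "i \<in> {1..r-1} - A" for i
    proof -
      have "i \<in> {1..r}" "i < r" using that by auto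
      thus ?thesis using R[rule_format, of i] that by simp
    qed
    ultimately show ?L by blast
  qed
  thus ?thesis unfolding S_set_def T_set_def by blast
qed

lemma finite_T_set [simp]: "finite (T_set r N A m)"
  unfolding T_set_def by (rule finite_subset[OF _ finite_PiE[of "{1..r}" "\<lambda>_. {1..N-1}"]]) auto

lemma T_set_insert [simp]: "T_set r N (insert (Suc r) A) m = T_set r N A m"
  unfolding T_set_def by auto

lemma T_set_Suc_decompose:
  assumes n: "n \<in> T_set (Suc r) N A m"
  shows "n (Suc r) \<in> {1..N-1}" "if Suc r \<in> A then n (Suc r) \<le> m else n (Suc r) < m"
    "restrict n {1..r} \<in> T_set r N A (n (Suc r))" "(restrict n {1..r})(Suc r := n (Suc r)) = n"
proof -
  have P: "n \<in> PiE {1..Suc r} (\<lambda>_. {1..N-1})" and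
    Q: "\<And>i. i \<in> {1..Suc r} \<Longrightarrow> (i \<in> A \<longrightarrow> n i \<le> (if i < Suc r then n (Suc i) else m)) \<and>
     (i \<notin> A \<longrightarrow> n i < (if i < Suc r then n (Suc i) else m))"
    using n by (auto simp: T_set_def)
  show "n (Suc r) \<in> {1..N-1}" using P by auto
  show "if Suc r \<in> A then n (Suc r) \<le> m else n (Suc r) < m" using Q[of "Suc r"] by auto
  show "(restrict n {1..r})(Suc r := n (Suc r)) = n"
    using P by (auto simp: fun_eq_iff restrict_def PiE_def extensional_def)
  have "(i \<in> A \<longrightarrow> restrict n {1..r} i \<le> (if i < r then restrict n {1..r} (Suc i) else n (Suc r))) \<and>
     (i \<notin> A \<longrightarrow> restrict n {1..r} i < (if i < r then restrict n {1..r} (Suc i) else n (Suc r)))"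
    if "i \<in> {1..r}" for i
    using Q[of i] that by (cases "i = r") auto
  moreover have "restrict n {1..r} \<in> PiE {1..r} (\<lambda>_. {1..N-1})" using P by auto
  ultimately show "restrict n {1..r} \<in> T_set r N A (n (Suc r))"
    unfolding T_set_def by blast
qed

lemma T_set_Suc_compose:
  assumes g: "g \<in> T_set r N A v"
  shows "v \<in> {1..N-1} \<Longrightarrow> (if Suc r \<in> A then v \<le> m else v < m) \<Longrightarrow> g(Suc r := v) \<in> T_set (Suc r) N A m"
    "restrict (g(Suc r := v)) {1..r} = g"
proof -
  have P: "g \<in> PiE {1..r} (\<lambda>_. {1..N-1})" and
    Q: "\<And>i. i \<in> {1..r} \<Longrightarrow> (i \<in> A \<longrightarrow> g i \<le> (if i < r then g (Suc i) else v)) \<and>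
     (i \<notin> A \<longrightarrow> g i < (if i < r then g (Suc i) else v))"
    using g by (auto simp: T_set_def)
  show "restrict (g(Suc r := v)) {1..r} = g"
    using P by (auto simp: fun_eq_iff restrict_def PiE_def extensional_def)
  assume v: "v \<in> {1..N-1}" "if Suc r \<in> A then v \<le> m else v < m"
  have "(i \<in> A \<longrightarrow> (g(Suc r := v)) i \<le> (if i < Suc r then (g(Suc r := v)) (Suc i) else m)) \<and>
     (i \<notin> A \<longrightarrow> (g(Suc r := v)) i < (if i < Suc r then (g(Suc r := v)) (Suc i) else m))"
    if "i \<in> {1..Suc r}" for i
    using Q[of i] that v(2) by (cases "i = Suc r"; cases "i = r") auto
  moreover have "g(Suc r := v) \<in> PiE {1..Suc r} (\<lambda>_. {1..N-1})"
    using P v(1) by (auto simp: PiE_def extensional_def Pi_def)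
  ultimately show "g(Suc r := v) \<in> T_set (Suc r) N A m" unfolding T_set_def by blast
qed

lemma sum_T_set_Suc:
  "(\<Sum>n\<in>T_set (Suc r) N A m. F n) =
   (\<Sum>v\<in>{v\<in>{1..N-1}. if Suc r \<in> A then v \<le> m else v < m}. \<Sum>g\<in>T_set r N A v. F (g(Suc r := v)))"
proof -
  define I where "I = {v\<in>{1..N-1}. if Suc r \<in> A then v \<le> m else v < m}"
  have "(\<Sum>v\<in>I. \<Sum>g\<in>T_set r N A v. F (g(Suc r := v))) =
        (\<Sum>(v,g)\<in>Sigma I (T_set r N A). F (g(Suc r := v)))"
    by (rule sum.Sigma) (auto simp: I_def)
  also have "\<dots> = (\<Sum>n\<in>T_set (Suc r) N A m. F n)"
  proof (rule sum.reindex_bij_witness[where j = "\<lambda>(v,g). g(Suc r := v)"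
        and i = "\<lambda>n. (n (Suc r), restrict n {1..r})"], goal_cases)
    case (1 a)
    then obtain v g where a: "a = (v, g)" "g \<in> T_set r N A v" by auto
    show ?case unfolding a prod.case using T_set_Suc_compose(2)[OF a(2)] by simp
  next
    case (2 a)
    then obtain v g where a: "a = (v, g)" "g \<in> T_set r N A v" "v \<in> I" by auto
    show ?case unfolding a prod.case
      by (rule T_set_Suc_compose(1)) (use a in \<open>auto simp: I_def\<close>)
  next
    case (3 b) thus ?case unfolding prod.case by (rule T_set_Suc_decompose(4))
  next
    case (4 b) thus ?case using T_set_Suc_decompose[OF 4] by (auto simp: I_def)
  next
    case (5 a) thus ?case by auto
  qed
  finally show ?thesis unfolding I_def by simp
qed

definition zweight :: "nat \<Rightarrow> nat list \<Rightarrow> nat set \<Rightarrow> (nat \<Rightarrow> nat) \<Rightarrow> rat" where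
  "zweight N k A n = (\<Prod>i\<in>A. 1 / of_nat (N - n i)) *
     (\<Prod>i\<in>{1..length k} - A. 1 / (of_nat (n i)) ^ (k!(i-1)))"

lemma zweight_snoc:
  assumes "A \<subseteq> {1..length ks}"
  shows "zweight N (ks @ [k]) A (g(Suc (length ks) := v)) = zweight N ks A g * (1 / of_nat v ^ k)"
    "zweight N (ks @ [k]) (insert (Suc (length ks)) A) (g(Suc (length ks) := v)) =
       zweight N ks A g * (1 / of_nat (N - v))"
proof -
  let ?r = "Suc (length ks)"
  have fin: "finite A" and nin: "?r \<notin> A" using assms finite_subset by auto
  have a: "(\<Prod>i\<in>A. 1 / of_nat (N - (g(?r := v)) i)) = (\<Prod>i\<in>A. 1 / (of_nat (N - g i) :: rat))"
    using nin by (intro prod.cong) auto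
  have b: "(\<Prod>i\<in>{1..length ks} - A. 1 / (of_nat ((g(?r := v)) i)) ^ ((ks @ [k])!(i-1))) =
     (\<Prod>i\<in>{1..length ks} - A. 1 / (of_nat (g i) :: rat) ^ (ks!(i-1)))"
    by (intro prod.cong) (auto simp: nth_append)
  have c: "{1..length (ks @ [k])} - A = insert ?r ({1..length ks} - A)" using nin by auto
  have d: "{1..length (ks @ [k])} - insert ?r A = {1..length ks} - A" by auto
  show "zweight N (ks @ [k]) A (g(?r := v)) = zweight N ks A g * (1 / of_nat v ^ k)"
    unfolding zweight_def c using a b by (subst prod.insert) (auto simp: nth_append)
  show "zweight N (ks @ [k]) (insert ?r A) (g(?r := v)) = zweight N ks A g * (1 / of_nat (N - v))"
    unfolding zweight_def d using a b fin nin by (subst prod.insert) auto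
qed

text \<open>The index is stored in reverse order: its head is the entry \<open>k\<^sub>r\<close> attached to the largest
  summation variable.\<close>

fun diam :: "nat \<Rightarrow> nat list \<Rightarrow> nat \<Rightarrow> rat" where
  "diam N [] m = 1"
| "diam N (k # ks) m = (\<Sum>v\<in>{v\<in>{1..N-1}. v < m}. diam N ks v / of_nat v ^ k) +
     (if k = 1 then \<Sum>v\<in>{v\<in>{1..N-1}. v \<le> m}. diam N ks v / of_nat (N - v) else 0)"

lemma ones_snoc: "ones (ks @ [k]) = (if k = 1 then insert (Suc (length ks)) (ones ks) else ones ks)"
proof (rule set_eqI)
  fix i
  show "(i \<in> ones (ks @ [k])) = (i \<in> (if k = 1 then insert (Suc (length ks)) (ones ks) else ones ks))"
    by (cases "i = Suc (length ks)") (auto simp: ones_def nth_append)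
qed

text \<open>The last position either stays outside \<open>A\<close>, giving the strict sum with
  \<open>1/v^k\<close>, or, for an entry 1, joins \<open>A\<close>, giving the weak sum with
  \<open>1/(N-v)\<close>.\<close>

lemma diam_rev:
  "(\<Sum>A\<in>Pow (ones ks). \<Sum>n\<in>T_set (length ks) N A m. zweight N ks A n) = diam N (rev ks) m"
proof (induction ks arbitrary: m rule: rev_induct)
  case Nil
  show ?case by (simp add: ones_def T_set_def zweight_def)
next
  case (snoc k ks)
  let ?r = "Suc (length ks)"
  have sub: "A \<subseteq> {1..length ks}" if "A \<in> Pow (ones ks)" for A using that by (auto simp: ones_def)
  have nin: "?r \<notin> ones ks" and fin: "finite (ones ks)" by (auto simp: ones_def)
  have ninA: "?r \<notin> A" if "A \<in> Pow (ones ks)" for A using that nin by auto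
  let ?f = "\<lambda>A. \<Sum>n\<in>T_set ?r N A m. zweight N (ks @ [k]) A n"
  have 1: "(\<Sum>A\<in>Pow (ones ks). ?f A) = (\<Sum>v\<in>{v\<in>{1..N-1}. v < m}. diam N (rev ks) v / of_nat v ^ k)"
  proof -
    have "(\<Sum>A\<in>Pow (ones ks). ?f A) = (\<Sum>A\<in>Pow (ones ks). \<Sum>v\<in>{v\<in>{1..N-1}. v < m}.
        \<Sum>g\<in>T_set (length ks) N A v. zweight N ks A g * (1 / of_nat v ^ k))"
      using sub ninA by (intro sum.cong refl) (simp add: sum_T_set_Suc zweight_snoc)
    also have "\<dots> = (\<Sum>v\<in>{v\<in>{1..N-1}. v < m}. (\<Sum>A\<in>Pow (ones ks).
        \<Sum>g\<in>T_set (length ks) N A v. zweight N ks A g) * (1 / of_nat v ^ k))"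
      unfolding sum_distrib_right by (rule sum.swap)
    finally show ?thesis by (simp add: snoc.IH)
  qed
  have 2: "(\<Sum>A\<in>Pow (ones ks). ?f (insert ?r A)) = (\<Sum>v\<in>{v\<in>{1..N-1}. v \<le> m}. diam N (rev ks) v / of_nat (N - v))"
  proof -
    have "(\<Sum>A\<in>Pow (ones ks). ?f (insert ?r A)) = (\<Sum>A\<in>Pow (ones ks). \<Sum>v\<in>{v\<in>{1..N-1}. v \<le> m}.
        \<Sum>g\<in>T_set (length ks) N A v. zweight N ks A g * (1 / of_nat (N - v)))"
      using sub ninA by (intro sum.cong refl) (simp add: sum_T_set_Suc zweight_snoc)
    also have "\<dots> = (\<Sum>v\<in>{v\<in>{1..N-1}. v \<le> m}. (\<Sum>A\<in>Pow (ones ks).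
        \<Sum>g\<in>T_set (length ks) N A v. zweight N ks A g) * (1 / of_nat (N - v)))"
      unfolding sum_distrib_right by (rule sum.swap)
    finally show ?thesis by (simp add: snoc.IH)
  qed
  show ?case
  proof (cases "k = 1")
    case True
    have "(\<Sum>A\<in>Pow (ones (ks @ [k])). ?f A) = (\<Sum>A\<in>Pow (ones ks). ?f A) + (\<Sum>A\<in>Pow (ones ks). ?f (insert ?r A))"
      unfolding ones_snoc if_P[OF True] by (simp only: sum_Pow_insert[OF fin nin] sum.distrib)
    also have "\<dots> = diam N (rev (ks @ [k])) m" unfolding 1 2 using True by simp
    finally show ?thesis by simp
  next
    case False
    thus ?thesis using 1 by (simp add: ones_snoc)
  qed
qed

lemma zeta_diamond_N_eq_diam: "zeta_diamond_N ks N = diam N (rev ks) N"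
proof -
  have "zeta_diamond_N ks N = (\<Sum>A\<in>Pow (ones ks). \<Sum>n\<in>T_set (length ks) N A N. zweight N ks A n)"
    unfolding zeta_diamond_N_def zweight_def
    by (intro sum.cong refl S_set_eq_T_set) (auto simp: ones_def)
  thus ?thesis by (simp add: diam_rev)
qed

subsection \<open>The self-dual form of the diamond sums\<close>

definition cum :: "(nat \<Rightarrow> rat) \<Rightarrow> (nat \<Rightarrow> rat) \<Rightarrow> nat \<Rightarrow> rat" where
  "cum w f j = (\<Sum>i\<le>j. w i * f i)"

text \<open>Both weights are cut off outside \<open>0 < i < N\<close>, so that the partial-fraction
  relation between them holds at every \<open>i\<close>.\<close>

definition xw :: "nat \<Rightarrow> nat \<Rightarrow> rat" where
  "xw N i = (if 0 < i \<and> i < N then 1 / of_nat i else 0)"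

definition yw :: "nat \<Rightarrow> nat \<Rightarrow> rat" where
  "yw N i = (if 0 < i \<and> i < N then 1 / of_nat (N - i) else 0)"

text \<open>The value at \<open>0\<close> is kept, so that the constant function \<open>1\<close> is fixed by the shift.\<close>

definition sh :: "(nat \<Rightarrow> rat) \<Rightarrow> nat \<Rightarrow> rat" where
  "sh f j = f (j - 1)"

lemma cum_0 [simp]: "cum w f 0 = w 0 * f 0"
  and cum_Suc [simp]: "cum w f (Suc j) = cum w f j + w (Suc j) * f (Suc j)"
  by (simp_all add: cum_def)

lemma sh_0 [simp]: "sh f 0 = f 0" and sh_Suc [simp]: "sh f (Suc j) = f j"
  by (simp_all add: sh_def)

lemma xw_0 [simp]: "xw N 0 = 0" and yw_0 [simp]: "yw N 0 = 0"
  by (simp_all add: xw_def yw_def)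

lemma cum_cong: "(\<And>i. i \<le> j \<Longrightarrow> w i * f i = w' i * g i) \<Longrightarrow> cum w f j = cum w' g j"
  unfolding cum_def by (intro sum.cong) auto

text \<open>The connector of the connected-sum method: \<open>Trans\<close> intertwines the summations defining the
  diamond sums with the summations weighted by \<open>1/m\<close> and \<open>1/(N-m)\<close>.\<close>

definition conn :: "nat \<Rightarrow> nat \<Rightarrow> nat \<Rightarrow> rat" where
  "conn N n m = of_nat (m choose n) / of_nat ((N - 1) choose n)"

definition Trans :: "nat \<Rightarrow> (nat \<Rightarrow> rat) \<Rightarrow> nat \<Rightarrow> rat" where
  "Trans N a m = (\<Sum>n<N. a n * conn N n m)"

text \<open>A difference in \<open>m\<close> is one Pascal step, leaving
  \<open>m choose (n - 1)\<close>, and absorption trades the factor \<open>n\<close> for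
  \<open>m + 1\<close>.\<close>

lemma conn_diff_x:
  assumes "0 < n"
  shows "(conn N n (Suc m) - conn N n m) / of_nat n = conn N n (Suc m) / of_nat (Suc m)"
proof -
  obtain k where n: "n = Suc k" using assms by (cases n) auto
  have "of_nat (Suc k) * (of_nat (Suc m choose Suc k) :: rat) = of_nat (Suc m) * of_nat (m choose k)"
    by (metis Suc_times_binomial_eq mult.commute of_nat_mult)
  moreover have "(of_nat (Suc m choose Suc k) :: rat) - of_nat (m choose Suc k) = of_nat (m choose k)"
    by simp
  ultimately have "(of_nat (Suc m choose Suc k) - of_nat (m choose Suc k)) / of_nat (Suc k) =
      (of_nat (Suc m choose Suc k) :: rat) / of_nat (Suc m)"
    by (simp add: field_simps del: of_nat_Suc binomial_Suc_Suc)
  thus ?thesis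
    unfolding conn_def n by (metis (no_types, opaque_lifting) diff_divide_distrib divide_divide_eq_left' mult.commute divide_divide_eq_left)
qed

lemma choose_Suc_absorb: "(m - k) * (m choose k) = Suc k * (m choose Suc k)"
proof (cases m)
  case (Suc m')
  have "(m - k) * (m choose k) = m * ((m - 1) choose k)" by (rule binomial_absorb_comp)
  thus ?thesis unfolding Suc diff_Suc_1 using Suc_times_binomial_eq[of m' k] by (simp only: mult.commute)
qed simp

lemma choose_pred:
  assumes "0 < n" "n < N"
  shows "of_nat (N - n) * (of_nat ((N - 1) choose (n - 1)) :: rat) = of_nat n * of_nat ((N - 1) choose n)"
proof -
  obtain k where n: "n = Suc k" using assms by (cases n) auto
  obtain M where N: "N = Suc M" using assms by (cases N) auto
  show ?thesis using choose_Suc_absorb[of M k] n N by (metis diff_Suc_1 diff_Suc_Suc of_nat_mult)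
qed

text \<open>The same quotient is also a difference in \<open>n\<close>, ready to telescope over
  tails. With \<open>n = k + 1\<close> and \<open>m choose k\<close> divided out, the claim is
  \<open>(N - n) - (m - k) = N - (m + 1)\<close>.\<close>

lemma conn_diff_y:
  assumes "0 < n" "n < N" "Suc m < N"
  shows "conn N n (Suc m) / of_nat (Suc m) = (conn N (n - 1) m - conn N n m) / of_nat (N - Suc m)"
proof -
  obtain k where n: "n = Suc k" using assms by (cases n) auto
  have p: "(0::rat) < of_nat ((N - 1) choose n)" "(0::rat) < of_nat ((N - 1) choose (n - 1))"
    using assms by (simp_all add: zero_less_binomial_iff)
  define c where "c = (of_nat ((N - 1) choose n) :: rat)"
  have c': "of_nat ((N - 1) choose (n - 1)) = of_nat n * c / of_nat (N - n)"
    using choose_pred[OF assms(1,2)] assms(2) unfolding c_def by (simp add: field_simps)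
  have c0: "c > 0" using p c_def by simp
  have 1: "of_nat (Suc k) * (of_nat (Suc m choose Suc k) :: rat) = of_nat (Suc m) * of_nat (m choose k)"
    by (metis Suc_times_binomial_eq mult.commute of_nat_mult)
  have 2: "(of_nat (Suc k) :: rat) * of_nat (m choose Suc k) = (of_nat m - of_nat k) * of_nat (m choose k)"
  proof (cases "k \<le> m")
    case True
    thus ?thesis using choose_Suc_absorb[of m k] by (metis of_nat_diff of_nat_mult)
  qed (simp add: binomial_eq_0)
  have e1: "of_nat (Suc m choose Suc k) = of_nat (Suc m) * (of_nat (m choose k) :: rat) / of_nat (Suc k)"
    using 1 by (simp add: field_simps del: of_nat_Suc binomial_Suc_Suc)
  have e2: "(of_nat (m choose Suc k) :: rat) = (of_nat m - of_nat k) * of_nat (m choose k) / of_nat (Suc k)"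
    using 2 by (simp add: field_simps del: of_nat_Suc binomial_Suc_Suc)
  define b where "b = (of_nat (m choose k) :: rat)"
  define K where "K = (of_nat (Suc k) :: rat)"
  define D where "D = (of_nat (N - Suc m) :: rat)"
  have D0: "D > 0" and K0: "K > 0" using assms by (auto simp: D_def K_def)
  have Nn: "(of_nat (N - n) :: rat) = D + of_nat m - of_nat k" "(of_nat (N - n) :: rat) > 0"
    using assms n by (auto simp: D_def of_nat_diff)
  have "conn N n (Suc m) / of_nat (Suc m) = b / (K * c)"
    unfolding conn_def n e1 c_def b_def K_def by (simp del: of_nat_Suc)
  moreover have "conn N (n - 1) m = b * (D + of_nat m - of_nat k) / (K * c)"
    unfolding conn_def c' using Nn by (simp add: n b_def K_def del: of_nat_Suc)
  moreover have "conn N n m = (of_nat m - of_nat k) * b / (K * c)"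
    unfolding conn_def n e2 c_def b_def K_def by (simp del: of_nat_Suc)
  moreover have "b * (D + of_nat m - of_nat k) / (K * c) - (of_nat m - of_nat k) * b / (K * c) = D * (b / (K * c))"
    using K0 c0 by (simp add: field_simps)
  ultimately show ?thesis using D0 unfolding D_def[symmetric] by simp
qed

text \<open>Telescoping of \<open>conn_diff_y\<close>; the far end \<open>conn N (N - 1) m\<close>
  vanishes because \<open>m < N - 1\<close>.\<close>

lemma conn_tail_sum:
  assumes "Suc m < N" "k < N"
  shows "(\<Sum>n\<in>{k<..<N}. conn N n (Suc m) / of_nat (Suc m)) = conn N k m / of_nat (N - Suc m)"
proof -
  have "(\<Sum>n\<in>{k<..<N}. conn N n (Suc m) / of_nat (Suc m)) =
        (\<Sum>n\<in>{Suc k..<N}. (conn N (n - 1) m - conn N n m) / of_nat (N - Suc m))"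
    using assms by (intro sum.cong conn_diff_y) auto
  also have "\<dots> = (\<Sum>n\<in>{k..<N - 1}. (conn N n m - conn N (Suc n) m) / of_nat (N - Suc m))"
    using assms by (intro sum.reindex_bij_witness[of _ Suc "\<lambda>n. n - 1"]) auto
  also have "\<dots> = (conn N k m - conn N (N - 1) m) / of_nat (N - Suc m)"
    using assms sum_Suc_diff'[of k "N - 1" "\<lambda>n. - conn N n m"]
    by (simp add: sum_divide_distrib[symmetric])
  also have "conn N (N - 1) m = 0"
    using assms by (simp add: conn_def binomial_eq_0)
  finally show ?thesis by simp
qed

lemma conn_0: "0 < n \<Longrightarrow> conn N n 0 = 0"
  by (simp add: conn_def binomial_eq_0)

text \<open>Both sides vanish at 0, so only increments in \<open>m\<close> matter; there
  \<open>conn_diff_x\<close> exchanges the factor \<open>1/n\<close> for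
  \<open>1/(m+1)\<close>.\<close>

lemma Trans_eqI:
  assumes "m < N"
    and "\<And>m. Suc m < N \<Longrightarrow> (\<Sum>n\<in>{0<..<N}. f n * (conn N n (Suc m) / of_nat (Suc m))) = w (Suc m) * h (Suc m)"
    and "w 0 = 0"
  shows "Trans N (\<lambda>n. if 0 < n \<and> n < N then f n / of_nat n else 0) m = cum w h m"
  using assms(1)
proof (induction m)
  case 0
  show ?case using assms(3) by (auto simp: Trans_def conn_0 intro!: sum.neutral)
next
  case (Suc m)
  let ?a = "\<lambda>n. if 0 < n \<and> n < N then f n / of_nat n else 0"
  have "Trans N ?a (Suc m) - Trans N ?a m = (\<Sum>n<N. ?a n * (conn N n (Suc m) - conn N n m))"
    unfolding Trans_def by (simp add: sum_subtractf algebra_simps)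
  also have "\<dots> = (\<Sum>n\<in>{0<..<N}. ?a n * (conn N n (Suc m) - conn N n m))"
    by (rule sum.mono_neutral_right) auto
  also have "\<dots> = (\<Sum>n\<in>{0<..<N}. f n * (conn N n (Suc m) / of_nat (Suc m)))"
    by (intro sum.cong refl) (simp add: conn_diff_x[symmetric] del: of_nat_Suc)
  also have "\<dots> = w (Suc m) * h (Suc m)" by (rule assms(2)[OF Suc.prems])
  finally show ?case using Suc by simp
qed

lemma Trans_x:
  assumes "a 0 = 0" "m < N"
  shows "Trans N (\<lambda>n. if 0 < n \<and> n < N then a n / of_nat n else 0) m = cum (xw N) (Trans N a) m"
proof (rule Trans_eqI[OF assms(2)])
  fix m assume m: "Suc m < N"
  have "Trans N a (Suc m) = (\<Sum>n\<in>{0<..<N}. a n * conn N n (Suc m))"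
    unfolding Trans_def using assms(1)
    by (intro sum.mono_neutral_right) auto
  thus "(\<Sum>n\<in>{0<..<N}. a n * (conn N n (Suc m) / of_nat (Suc m))) = xw N (Suc m) * Trans N a (Suc m)"
    using m by (simp add: xw_def sum_divide_distrib)
qed simp

lemma Trans_strict_sum:
  assumes "Suc m < N"
  shows "(\<Sum>n\<in>{0<..<N}. (\<Sum>k<n. a k) * (conn N n (Suc m) / of_nat (Suc m))) = Trans N a m / of_nat (N - Suc m)"
proof -
  have "(\<Sum>n\<in>{0<..<N}. (\<Sum>k<n. a k) * (conn N n (Suc m) / of_nat (Suc m))) =
        (\<Sum>n\<in>{0<..<N}. \<Sum>k | k \<in> {..<N} \<and> k < n. a k * (conn N n (Suc m) / of_nat (Suc m)))"
    unfolding sum_distrib_right by (intro sum.cong) auto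
  also have "\<dots> = (\<Sum>k<N. \<Sum>n | n \<in> {0<..<N} \<and> k < n. a k * (conn N n (Suc m) / of_nat (Suc m)))"
    by (rule sum.swap_restrict) auto
  also have "\<dots> = (\<Sum>k<N. a k * (conn N k m / of_nat (N - Suc m)))"
  proof (intro sum.cong refl)
    fix k assume k: "k \<in> {..<N}"
    have "{n. n \<in> {0<..<N} \<and> k < n} = {k<..<N}" by auto
    thus "(\<Sum>n | n \<in> {0<..<N} \<and> k < n. a k * (conn N n (Suc m) / of_nat (Suc m))) = a k * (conn N k m / of_nat (N - Suc m))"
      using conn_tail_sum[OF assms, of k] k by (simp only: sum_distrib_left[symmetric] lessThan_iff)
  qed
  finally show ?thesis by (simp add: Trans_def sum_divide_distrib)
qed

lemma Trans_y_strict: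
  assumes "m < N"
  shows "Trans N (\<lambda>n. if 0 < n \<and> n < N then (\<Sum>k<n. a k) / of_nat n else 0) m = cum (yw N) (sh (Trans N a)) m"
proof (rule Trans_eqI[OF assms])
  fix m assume "Suc m < N"
  thus "(\<Sum>n\<in>{0<..<N}. (\<Sum>k<n. a k) * (conn N n (Suc m) / of_nat (Suc m))) = yw N (Suc m) * sh (Trans N a) (Suc m)"
    by (simp only: Trans_strict_sum) (simp add: yw_def)
qed simp

text \<open>Pascal's rule; the factor \<open>k/(N-k)\<close> adjusts the denominator from
  \<open>(N-1) choose (k-1)\<close> to \<open>(N-1) choose k\<close>.\<close>

lemma conn_pascal:
  assumes "0 < k" "k < N"
  shows "conn N k m + of_nat k / of_nat (N - k) * conn N (k - 1) m = conn N k (Suc m)"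
proof -
  have p: "(0::rat) < of_nat ((N - 1) choose k)" "(0::rat) < of_nat ((N - 1) choose (k - 1))"
    using assms by (simp_all add: zero_less_binomial_iff)
  have "of_nat k / of_nat (N - k) * conn N (k - 1) m = of_nat (m choose (k - 1)) / of_nat ((N - 1) choose k)"
    unfolding conn_def using choose_pred[OF assms] assms p by (simp add: field_simps)
  moreover have "Suc m choose k = (m choose (k - 1)) + (m choose k)" using assms(1) by (cases k) auto
  ultimately show ?thesis by (simp add: conn_def add_divide_distrib)
qed

text \<open>The second inner sum is a strict prefix sum of coefficients moved down by one index.
  Adding it to the first moves the transform from \<open>m\<close> to \<open>m + 1\<close> by
  \<open>conn_pascal\<close>, which undoes the shift seen in \<open>Trans_y_strict\<close>.\<close>

lemma Trans_y_weak:
  assumes "a 0 = 0" "m < N"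
  shows "Trans N (\<lambda>n. if 0 < n \<and> n < N then
       ((\<Sum>k<n. a k) + (\<Sum>k\<le>n. a k * of_nat k / of_nat (N - k))) / of_nat n else 0) m
     = cum (yw N) (Trans N a) m"
proof (rule Trans_eqI[OF assms(2)])
  fix m assume m: "Suc m < N"
  define b where "b k = a (Suc k) * of_nat (Suc k) / of_nat (N - Suc k)" for k
  have *: "(\<Sum>k\<le>n. a k * of_nat k / of_nat (N - k)) = (\<Sum>k<n. b k)" for n
    by (simp add: b_def sum.atMost_shift)
  have "Trans N b m = (\<Sum>k\<in>{0<..<N}. a k * of_nat k / of_nat (N - k) * conn N (k - 1) m)"
  proof -
    \<comment> \<open>The top term drops out: \<open>b (N - 1)\<close> has denominator 0, and
      division by 0 gives 0.\<close>
    have "Trans N b m = (\<Sum>k<N - 1. b k * conn N k m)"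
      unfolding Trans_def b_def using m by (intro sum.mono_neutral_right) (auto simp: not_less)
    also have "\<dots> = (\<Sum>k\<in>{0<..<N}. a k * of_nat k / of_nat (N - k) * conn N (k - 1) m)"
      by (rule sum.reindex_bij_witness[of _ "\<lambda>k. k - 1" Suc]) (auto simp: b_def)
    finally show ?thesis .
  qed
  moreover have "Trans N a m' = (\<Sum>k\<in>{0<..<N}. a k * conn N k m')" for m'
    unfolding Trans_def using assms(1) by (intro sum.mono_neutral_right) auto
  ultimately have "Trans N a m + Trans N b m = (\<Sum>k\<in>{0<..<N}. a k * (conn N k m + of_nat k / of_nat (N - k) * conn N (k - 1) m))"
    by (simp add: sum.distrib[symmetric] algebra_simps)
  also have "\<dots> = Trans N a (Suc m)"
    unfolding \<open>Trans N a (Suc m) = _\<close> by (intro sum.cong refl) (metis conn_pascal greaterThanLessThan_iff)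
  finally have T: "Trans N a m + Trans N b m = Trans N a (Suc m)" .
  have "(\<Sum>n\<in>{0<..<N}. ((\<Sum>k<n. a k) + (\<Sum>k\<le>n. a k * of_nat k / of_nat (N - k))) * (conn N n (Suc m) / of_nat (Suc m)))
      = (Trans N a m + Trans N b m) / of_nat (N - Suc m)"
    unfolding * distrib_right sum.distrib by (simp only: Trans_strict_sum[OF m] add_divide_distrib)
  thus "(\<Sum>n\<in>{0<..<N}. ((\<Sum>k<n. a k) + (\<Sum>k\<le>n. a k * of_nat k / of_nat (N - k))) * (conn N n (Suc m) / of_nat (Suc m)))
      = yw N (Suc m) * Trans N a (Suc m)"
    unfolding T using m by (simp add: yw_def)
qed simp

text \<open>\<open>diam_last N ks n\<close> is the part of the diamond sum in which the last factor is \<open>1/n\<^sup>k\<close>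
  with largest summation variable equal to \<open>n\<close>.\<close>

fun diam_last :: "nat \<Rightarrow> nat list \<Rightarrow> nat \<Rightarrow> rat" where
  "diam_last N [] n = (if n = 0 then 1 else 0)"
| "diam_last N (k # ks) n = (if 0 < n \<and> n < N then diam N ks n / of_nat n ^ k else 0)"

text \<open>\<open>hd ks = 1\<close> says that the letter before this \<open>y\<close> is again a
  \<open>y\<close>. Otherwise it is an \<open>x\<close> or absent, and the shift is the strict step
  (it fixes the constant 1).\<close>

fun hform :: "nat \<Rightarrow> nat list \<Rightarrow> nat \<Rightarrow> rat" where
  "hform N [] = (\<lambda>_. 1)"
| "hform N (k # ks) = (cum (xw N) ^^ (k - 1))
     (cum (yw N) (if ks \<noteq> [] \<and> hd ks = 1 then hform N ks else sh (hform N ks)))"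

text \<open>The factor \<open>n/(N-n)\<close> swaps the weight \<open>1/n\<close> for
  \<open>1/(N-n)\<close>, so both alternatives for an entry 1 are expressed by
  \<open>diam_last\<close>.\<close>

lemma diam_eq_sum_diam_last:
  assumes "0 < m" "m \<le> N"
  shows "diam N ks m = (\<Sum>n<m. diam_last N ks n) +
    (if ks \<noteq> [] \<and> hd ks = 1 then \<Sum>n\<in>{..m}. diam_last N ks n * of_nat n / of_nat (N - n) else 0)"
proof (cases ks)
  case Nil
  thus ?thesis using assms by (simp add: sum.If_cases lessThan_def Collect_conv_if)
next
  case (Cons k ks')
  have "(\<Sum>v\<in>{v\<in>{1..N-1}. v < m}. diam N ks' v / of_nat v ^ k) = (\<Sum>n<m. diam_last N ks n)"
    unfolding Cons by (rule sum.mono_neutral_cong_left) auto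
  moreover have "(\<Sum>v\<in>{v\<in>{1..N-1}. v \<le> m}. diam N ks' v / of_nat (N - v)) =
      (\<Sum>n\<in>{..m}. diam_last N ks n * of_nat n / of_nat (N - n))" if "k = 1"
    unfolding Cons using that by (intro sum.mono_neutral_cong_left) auto
  ultimately show ?thesis by (simp add: Cons)
qed

text \<open>An entry \<open>k\<close> contributes \<open>k\<close> factors \<open>1/n\<close>: the
  first becomes a y-sum, shifted or not according to the preceding entry, and each of the others an
  x-sum.\<close>

lemma Trans_diam_last:
  assumes "\<forall>k\<in>set ks. 1 \<le> k" "m < N"
  shows "Trans N (diam_last N ks) m = hform N ks m"
  using assms
proof (induction ks arbitrary: m)
  case Nil
  have "Trans N (diam_last N []) m = (\<Sum>n\<in>{0}. diam_last N [] n * conn N n m)"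
    unfolding Trans_def using Nil by (intro sum.mono_neutral_right) auto
  also have "\<dots> = 1" by (simp add: conn_def)
  finally show ?case by (simp only: hform.simps)
next
  case (Cons k ks)
  have IH: "Trans N (diam_last N ks) m = hform N ks m" if "m < N" for m
    using Cons that by auto
  let ?d = "\<lambda>j n. if 0 < n \<and> n < N then diam N ks n / of_nat n ^ j else 0"
  have base: "Trans N (?d 1) m = cum (yw N) (if ks \<noteq> [] \<and> hd ks = 1 then hform N ks else sh (hform N ks)) m"
    if m: "m < N" for m
  proof (cases "ks \<noteq> [] \<and> hd ks = 1")
    case True
    have a0: "diam_last N ks 0 = 0" using True by (cases ks) auto
    have "?d 1 = (\<lambda>n. if 0 < n \<and> n < N then ((\<Sum>k<n. diam_last N ks k) +
        (\<Sum>k\<le>n. diam_last N ks k * of_nat k / of_nat (N - k))) / of_nat n else 0)"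
      using True by (auto simp: fun_eq_iff diam_eq_sum_diam_last)
    hence "Trans N (?d 1) m = cum (yw N) (Trans N (diam_last N ks)) m"
      using Trans_y_weak[where a = "diam_last N ks", OF a0 m] by simp
    also have "\<dots> = cum (yw N) (hform N ks) m"
      using m by (intro cum_cong) (simp add: IH)
    finally show ?thesis using True by simp
  next
    case False
    have "?d 1 = (\<lambda>n. if 0 < n \<and> n < N then (\<Sum>k<n. diam_last N ks k) / of_nat n else 0)"
      using False by (auto simp: fun_eq_iff diam_eq_sum_diam_last)
    hence "Trans N (?d 1) m = cum (yw N) (sh (Trans N (diam_last N ks))) m"
      using Trans_y_strict[where a = "diam_last N ks", OF m] by simp
    also have "\<dots> = cum (yw N) (sh (hform N ks)) m"
      using m by (intro cum_cong) (simp add: IH sh_def)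
    finally show ?thesis unfolding if_not_P[OF False] .
  qed
  have main: "Trans N (?d (Suc j)) m = (cum (xw N) ^^ j)
     (cum (yw N) (if ks \<noteq> [] \<and> hd ks = 1 then hform N ks else sh (hform N ks))) m" if "m < N" for j m
    using that
  proof (induction j arbitrary: m)
    case 0
    show ?case using base[OF 0] by (simp only: funpow.simps id_apply One_nat_def)
  next
    case (Suc j)
    have "?d (Suc (Suc j)) = (\<lambda>n. if 0 < n \<and> n < N then ?d (Suc j) n / of_nat n else 0)"
      by (auto simp: fun_eq_iff field_simps)
    then have "Trans N (?d (Suc (Suc j))) m = cum (xw N) (Trans N (?d (Suc j))) m"
      using Trans_x[of "?d (Suc j)" m N] Suc.prems by simp
    also have "\<dots> = cum (xw N) ((cum (xw N) ^^ j)
        (cum (yw N) (if ks \<noteq> [] \<and> hd ks = 1 then hform N ks else sh (hform N ks)))) m"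
      using Suc.prems by (intro cum_cong arg_cong2[of _ _ _ _ "(*)"] refl Suc.IH) auto
    finally show ?case by (simp only: funpow.simps o_apply)
  qed
  have "Suc (k - 1) = k" using Cons.prems by simp
  hence "?d (Suc (k - 1)) = diam_last N (k # ks)" by (simp add: fun_eq_iff)
  thus ?case using main[OF Cons.prems(2), of "k - 1"] by (simp only: hform.simps)
qed

lemma diam_eq_hform:
  assumes "\<forall>k\<in>set ks. 1 \<le> k" "ks \<noteq> []" "hd ks \<noteq> 1" "1 \<le> N"
  shows "diam N ks N = hform N ks (N - 1)"
proof -
  have "diam N ks N = (\<Sum>n<N. diam_last N ks n)"
    using diam_eq_sum_diam_last[of N N ks] assms by simp
  \<comment> \<open>At \<open>m = N - 1\<close> the connector is 1 for every \<open>n < N\<close>,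
    so the transform is the plain total.\<close>
  also have "\<dots> = Trans N (diam_last N ks) (N - 1)"
    unfolding Trans_def by (intro sum.cong) (auto simp: conn_def)
  finally show ?thesis using Trans_diam_last[of ks "N - 1" N] assms by simp
qed

subsection \<open>Words and their encodings by indices and by block lengths\<close>

text \<open>The state records the last letter read, since only the step from \<open>x\<close> to
  \<open>y\<close> is strict. Reading starts in state \<open>X\<close>, which is harmless: the shift
  fixes the constant 1.\<close>

definition lstep :: "nat \<Rightarrow> letter \<times> (nat \<Rightarrow> rat) \<Rightarrow> letter \<Rightarrow> letter \<times> (nat \<Rightarrow> rat)" where
  "lstep N s l = (l, case l of X \<Rightarrow> cum (xw N) (snd s)
     | Y \<Rightarrow> cum (yw N) (if fst s = X then sh (snd s) else snd s))"

lemma lstep_simps [simp]: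
  "lstep N s X = (X, cum (xw N) (snd s))"
  "lstep N s Y = (Y, cum (yw N) (if fst s = X then sh (snd s) else snd s))"
  by (simp_all add: lstep_def)

lemma foldl_lstep_X:
  "foldl (lstep N) s (replicate k X) = (if k = 0 then s else (X, (cum (xw N) ^^ k) (snd s)))"
  by (induction k arbitrary: s) (auto simp: funpow_swap1)

lemma foldl_lstep_Y:
  "foldl (lstep N) (Y, f) (replicate k Y) = (Y, (cum (yw N) ^^ k) f)"
  by (induction k arbitrary: f) (auto simp: funpow_swap1)

lemma ewords_snoc: "ewords (ks @ [k]) = ewords ks @ Y # replicate (k - 1) X"
  and ewords_Cons: "ewords (k # ks) = Y # replicate (k - 1) X @ ewords ks"
  and ewords_Nil [simp]: "ewords [] = []"
  by (simp_all add: ewords_def)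

lemma foldl_lstep_ewords:
  "\<forall>k\<in>set ks. 1 \<le> k \<Longrightarrow> foldl (lstep N) (X, \<lambda>_. 1) (ewords ks) =
     (if ks \<noteq> [] \<and> last ks = 1 then Y else X, hform N (rev ks))"
proof (induction ks rule: rev_induct)
  case (snoc k ks)
  hence "foldl (lstep N) (X, \<lambda>_. 1) (ewords ks) = (if ks \<noteq> [] \<and> last ks = 1 then Y else X, hform N (rev ks))"
    by auto
  moreover have "hd (rev ks) = last ks" if "ks \<noteq> []" using that by (simp add: hd_rev)
  moreover have "1 \<le> k" using snoc.prems by simp
  ultimately show ?case
    by (auto simp: ewords_snoc foldl_lstep_X)
qed simp

lemma ewords_exists: "w = [] \<or> hd w = Y \<Longrightarrow> \<exists>ks. (\<forall>k\<in>set ks. 1 \<le> k) \<and> ewords ks = w"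
proof (induction w rule: rev_induct)
  case Nil
  show ?case by (rule exI[of _ "[]"]) simp
next
  case (snoc l w)
  hence "w = [] \<or> hd w = Y" by (cases w) auto
  then obtain ks where ks: "\<forall>k\<in>set ks. 1 \<le> k" "ewords ks = w" using snoc.IH by auto
  show ?case
  proof (cases l)
    case Y
    thus ?thesis using ks by (intro exI[of _ "ks @ [1]"]) (auto simp: ewords_snoc)
  next
    case X
    hence "ks \<noteq> []" using snoc.prems ks by auto
    then obtain k ks' where k: "ks = ks' @ [k]" by (metis rev_exhaust)
    then obtain k1 where "k = Suc k1" using ks by (cases k) auto
    hence "replicate (Suc k - 1) X = replicate (k - 1) X @ [X]"
      by (simp add: replicate_append_same)
    hence "ewords (ks' @ [Suc k]) = w @ [l]" using ks k X by (simp add: ewords_snoc)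
    thus ?thesis using ks k by (intro exI[of _ "ks' @ [Suc k]"]) auto
  qed
qed

lemma replicate_append_eqD:
  assumes "replicate m a @ u = replicate n a @ v" "u = [] \<or> hd u \<noteq> a" "v = [] \<or> hd v \<noteq> a"
  shows "m = n \<and> u = v"
  using assms
proof (induction m arbitrary: n)
  case 0
  thus ?case by (cases n) auto
next
  case (Suc m)
  thus ?case by (cases n) auto
qed

lemma ewords_hd: "ewords ks = [] \<or> hd (ewords ks) = Y"
  by (cases ks) (auto simp: ewords_Cons)

lemma ewords_inject:
  assumes "\<forall>k\<in>set ks. 1 \<le> k" "\<forall>k\<in>set ls. 1 \<le> k" "ewords ks = ewords ls"
  shows "ks = ls"
  using assms
proof (induction ks arbitrary: ls)
  case Nil
  thus ?case by (cases ls) (auto simp: ewords_Cons)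
next
  case (Cons k ks)
  then obtain l ls' where l: "ls = l # ls'" by (cases ls) (auto simp: ewords_Cons)
  have "replicate (k - 1) X @ ewords ks = replicate (l - 1) X @ ewords ls'"
    using Cons.prems(3) l by (simp add: ewords_Cons)
  moreover have "ewords ks = [] \<or> hd (ewords ks) \<noteq> X" "ewords ls' = [] \<or> hd (ewords ls') \<noteq> X"
    using ewords_hd[of ks] ewords_hd[of ls'] by auto
  ultimately have "k - 1 = l - 1 \<and> ewords ks = ewords ls'" by (rule replicate_append_eqD)
  moreover from this have "ks = ls'" using Cons.IH[of ls'] Cons.prems l by simp
  moreover have "1 \<le> k" "1 \<le> l" using Cons.prems l by simp_all
  ultimately show ?case using l by simp
qed

lemma Zd_word_Nil [simp]: "Zd_word [] N = 1"
  by (simp add: Zd_word_def)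

lemma Zd_word_ewords:
  assumes "\<forall>k\<in>set ks. 1 \<le> k"
  shows "Zd_word (ewords ks) N = diam N (rev ks) N"
proof (cases "ks = []")
  case False
  have "(THE ls. (\<forall>k\<in>set ls. k \<ge> 1) \<and> ewords ls = ewords ks) = ks"
    by (rule the_equality) (use assms ewords_inject in auto)
  moreover have "ewords ks \<noteq> []" using False by (cases ks) (auto simp: ewords_Cons)
  ultimately show ?thesis by (simp add: Zd_word_def zeta_diamond_N_eq_diam)
qed simp

lemma Zd_word_eq_foldl:
  assumes "w \<noteq> []" "hd w = Y" "last w = X" "1 \<le> N"
  shows "Zd_word w N = snd (foldl (lstep N) (X, \<lambda>_. 1) w) (N - 1)"
proof -
  obtain ks where ks: "\<forall>k\<in>set ks. 1 \<le> k" "ewords ks = w" using ewords_exists[of w] assms by auto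
  then have ne: "ks \<noteq> []" using assms by auto
  have "last ks \<noteq> 1"
  proof
    assume "last ks = 1"
    hence "last (ewords (butlast ks @ [last ks])) = Y" by (simp add: ewords_snoc)
    hence "last (ewords ks) = Y" using ne by simp
    thus False using ks assms by simp
  qed
  thus ?thesis using ks ne foldl_lstep_ewords[OF ks(1), of N] assms(4) Zd_word_ewords[OF ks(1), of N]
      diam_eq_hform[of "rev ks" N] by (simp add: hd_rev)
qed

section \<open>Words as alternating blocks of y and x\<close>

fun bval :: "nat \<Rightarrow> nat list \<Rightarrow> (nat \<Rightarrow> rat) \<Rightarrow> nat \<Rightarrow> rat" where
  "bval N (a # b # c) f = bval N c ((cum (xw N) ^^ b) ((cum (yw N) ^^ a) (sh f)))"
| "bval N _ f = f"

lemma cword_Nil [simp]: "cword [] = []"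
  by (simp add: cword_def)

lemma cword_Cons2 [simp]: "cword (a # b # c) = replicate a Y @ replicate b X @ cword c"
proof -
  have "map (\<lambda>i. i + 2) [0..<length c] = map Suc (map Suc [0..<length c])" by simp
  also have "\<dots> = [Suc (Suc 0)..<Suc (Suc (length c))]" by (simp only: map_Suc_upt)
  finally have "[0..<length (a # b # c)] = 0 # 1 # map (\<lambda>i. i + 2) [0..<length c]"
    by (simp add: upt_conv_Cons del: upt_Suc)
  thus ?thesis by (simp add: cword_def o_def)
qed

definition blocks :: "nat list \<Rightarrow> bool" where
  "blocks c \<longleftrightarrow> even (length c) \<and> (\<forall>i\<in>set c. i \<ge> 1)"

lemma blocks_Nil [simp]: "blocks []" and blocks_single [simp]: "\<not> blocks [a]"
  and blocks_Cons2 [simp]: "blocks (a # b # c) \<longleftrightarrow> 1 \<le> a \<and> 1 \<le> b \<and> blocks c"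
  by (auto simp: blocks_def)

lemma blocks_induct [consumes 1, case_names Nil Cons2]:
  assumes "blocks c" "P []" "\<And>a b c. 1 \<le> a \<Longrightarrow> 1 \<le> b \<Longrightarrow> blocks c \<Longrightarrow> P c \<Longrightarrow> P (a # b # c)"
  shows "P c"
  using assms(1) by (induction c rule: induct_list012) (auto intro: assms)

lemma foldl_lstep_cword:
  assumes "blocks c"
  shows "foldl (lstep N) (X, f) (cword c) = (X, bval N c f)"
  using assms
proof (induction c arbitrary: f rule: blocks_induct)
  case (Cons2 a b c)
  obtain a' where a: "a = Suc a'" using Cons2 by (cases a) auto
  have "foldl (lstep N) (X, f) (replicate a Y) = (Y, (cum (yw N) ^^ a) (sh f))"
    using foldl_lstep_Y[of N "cum (yw N) (sh f)" a'] by (simp add: a funpow_swap1)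
  thus ?case using Cons2 by (simp add: foldl_lstep_X)
qed simp

lemma cword_hd_last:
  assumes "blocks c" "c \<noteq> []"
  shows "cword c \<noteq> [] \<and> hd (cword c) = Y \<and> last (cword c) = X"
  using assms
proof (induction c rule: blocks_induct)
  case (Cons2 a b c)
  thus ?case by (cases "c = []") (auto simp: hd_append last_append)
qed simp

lemma cword_hd: "blocks c \<Longrightarrow> cword c = [] \<or> hd (cword c) \<noteq> X"
  using cword_hd_last[of c] by (cases "c = []") auto

lemma cword_exists:
  "w = [] \<or> (hd w = Y \<and> last w = X) \<Longrightarrow> \<exists>c. blocks c \<and> cword c = w"
proof (induction w rule: length_induct)
  case (1 w)
  show ?case
  proof (cases "w = []")
    case True thus ?thesis by (intro exI[of _ "[]"]) auto
  next
    case False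
    define u where "u = takeWhile (\<lambda>l. l = Y) w"
    define w1 where "w1 = dropWhile (\<lambda>l. l = Y) w"
    define v where "v = takeWhile (\<lambda>l. l = X) w1"
    define w2 where "w2 = dropWhile (\<lambda>l. l = X) w1"
    have w: "w = u @ v @ w2" by (simp add: u_def v_def w1_def w2_def)
    have u: "u = replicate (length u) Y" unfolding u_def
      by (metis (full_types) replicate_length_same set_takeWhileD)
    have v: "v = replicate (length v) X" unfolding v_def
      by (metis (full_types) replicate_length_same set_takeWhileD)
    have hd: "hd w = Y" and last: "last w = X" using 1 False by auto
    have lu: "1 \<le> length u" using False hd unfolding u_def by (cases w) auto
    have w1: "w1 \<noteq> []"
    proof
      assume "w1 = []"
      hence "w = replicate (length u) Y" using w u by (simp add: v_def w2_def)
      thus False using last lu by (metis last_replicate letter.distinct(1) not_one_le_zero)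
    qed
    hence "hd w1 \<noteq> Y" unfolding w1_def by (rule hd_dropWhile)
    hence lv: "1 \<le> length v" using w1 unfolding v_def by (cases w1) (auto intro: letter.exhaust)
    have "w2 \<noteq> [] \<Longrightarrow> hd w2 \<noteq> X" unfolding w2_def by (rule hd_dropWhile)
    moreover have "last w2 = X" if "w2 \<noteq> []" using last w that by simp
    ultimately have "w2 = [] \<or> (hd w2 = Y \<and> last w2 = X)"
      by (cases "hd w2") auto
    moreover have "length w2 < length w" using lu by (subst w) auto
    ultimately obtain c where "blocks c" "cword c = w2" using 1 by blast
    thus ?thesis using u v w lu lv by (intro exI[of _ "length u # length v # c"]) simp
  qed
qed

lemma cword_inject:
  assumes "blocks c" "blocks d" "cword c = cword d"
  shows "c = d"
  using assms
proof (induction c arbitrary: d rule: blocks_induct)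
  case Nil
  thus ?case using cword_hd_last[of d] by auto
next
  case (Cons2 a b c)
  have "d \<noteq> []" using Cons2 by auto
  then obtain x d' where x: "d = x # d'" by (cases d) auto
  have "d' \<noteq> []" using Cons2.prems x by auto
  then obtain y e where d: "d = x # y # e" using x by (cases d') auto
  have "blocks e" using Cons2.prems(1) d by simp
  hence hdc: "cword c = [] \<or> hd (cword c) \<noteq> X" "cword e = [] \<or> hd (cword e) \<noteq> X"
    using cword_hd Cons2.hyps(3) by blast+
  have hdX: "hd (replicate n X @ u) \<noteq> Y" if "1 \<le> n" for n u
    using that by (cases n) auto
  have "replicate a Y @ (replicate b X @ cword c) = replicate x Y @ (replicate y X @ cword e)"
    using Cons2 d by simp
  hence 1: "a = x \<and> replicate b X @ cword c = replicate y X @ cword e"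
    by (rule replicate_append_eqD) (use hdX Cons2.hyps Cons2.prems(1) d in auto)
  hence "b = y \<and> cword c = cword e"
    using replicate_append_eqD[OF _ hdc] by blast
  hence "b = y" "c = e" using Cons2.IH[of e] Cons2.prems(1) d by simp_all
  thus ?case using 1 d by simp
qed

lemma D_word_cword:
  assumes "blocks c" "c \<noteq> []"
  shows "D_word (cword c) = Dfrak c"
proof -
  have "(THE d. even (length d) \<and> (\<forall>i\<in>set d. i \<ge> 1) \<and> cword d = cword c) = c"
    using assms cword_inject unfolding blocks_def by (intro the_equality) blast+
  thus ?thesis using cword_hd_last[OF assms] by (simp add: D_word_def)
qed

definition Zblock :: "nat \<Rightarrow> nat list \<Rightarrow> rat" where
  "Zblock N c = bval N c (\<lambda>_. 1) (N - 1)"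

lemma Zd_word_cword:
  assumes "blocks c" "1 \<le> N"
  shows "Zd_word (cword c) N = Zblock N c"
proof (cases "c = []")
  case False
  thus ?thesis using cword_hd_last[OF assms(1) False] assms
    by (simp add: Zd_word_eq_foldl foldl_lstep_cword Zblock_def)
qed (simp add: Zblock_def)

subsection \<open>Sums over the index sets of the recursion\<close>

definition oe_ok :: "nat list \<Rightarrow> nat set \<Rightarrow> nat set \<Rightarrow> bool" where
  "oe_ok c A B \<longleftrightarrow> A \<subseteq> ones c \<and> odd_even A \<and> B \<subseteq> gtones c \<and>
     (\<forall>r\<in>{1..length c div 2}. \<not> {2*r-1, 2*r} \<subseteq> B)"

definition eo_ok :: "nat list \<Rightarrow> nat set \<Rightarrow> nat set \<Rightarrow> bool" where
  "eo_ok c A B \<longleftrightarrow> A \<subseteq> ones c \<and> even_odd A \<and> B \<subseteq> gtones c \<and>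
     (\<forall>r\<in>{1..length c div 2 - 1}. \<not> {2*r, 2*r+1} \<subseteq> B)"

text \<open>The summand sees \<open>(A, B)\<close> only through cardinalities and the reduced list,
  which permits a recursion along the list. The target is any commutative monoid because rational
  values, polynomials and counts of failures are all summed this way.\<close>

definition rsum :: "(nat list \<Rightarrow> nat set \<Rightarrow> nat set \<Rightarrow> bool) \<Rightarrow> nat list \<Rightarrow>
    (nat \<Rightarrow> nat \<Rightarrow> nat list \<Rightarrow> 'a) \<Rightarrow> 'a::comm_monoid_add" where
  "rsum ok c F = (\<Sum>A\<in>Pow {1..length c}. \<Sum>B\<in>Pow {1..length c}.
     if ok c A B then F (card A) (card B) (remdec c A B) else 0)"

lemma sum_Pow_Suc:
  "(\<Sum>A\<in>Pow {1..Suc n}. f A) = (\<Sum>A\<in>Pow {1..n}. f (Suc ` A) + f (insert 1 (Suc ` A)))"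
proof -
  have s: "{1..Suc n} = insert 1 (Suc ` {1..n})"
    by (simp add: image_Suc_atLeastAtMost atLeastAtMost_insertL)
  have P: "Pow (Suc ` {1..n}) = (`) Suc ` Pow {1..n}"
    by (rule image_Pow_surj[symmetric]) simp
  have inj: "inj_on ((`) Suc) (Pow {1..n})"
    by (rule inj_onI) (simp add: inj_image_eq_iff)
  have "(\<Sum>A\<in>Pow {1..Suc n}. f A) = (\<Sum>A\<in>Pow (Suc ` {1..n}). f A + f (insert 1 (Suc ` {1..n} \<inter> A)))"
    unfolding s by (subst sum_Pow_insert) (auto intro!: sum.cong arg_cong2[of _ _ _ _ "(+)"] arg_cong[of _ _ f])
  also have "\<dots> = (\<Sum>A\<in>Pow (Suc ` {1..n}). f A + f (insert 1 A))"
    by (intro sum.cong refl arg_cong2[of _ _ _ _ "(+)"] arg_cong[of _ _ f]) auto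
  also have "\<dots> = (\<Sum>A\<in>Pow {1..n}. f (Suc ` A) + f (insert 1 (Suc ` A)))"
    unfolding P sum.reindex[OF inj] o_def ..
  finally show ?thesis .
qed

lemma upt_1_Suc: "[1..<length (a # c) + 1] = 1 # map Suc [1..<length c + 1]"
  by (simp add: upt_conv_Cons map_Suc_upt del: upt_Suc)

lemma remdec_insert_0 [simp]: "remdec c (insert 0 A) B = remdec c A B" "remdec c A (insert 0 B) = remdec c A B"
  unfolding remdec_def by (intro map_cong filter_cong refl; auto)+

lemma remdec_Cons_eq:
  "remdec (a # c) A B = (if 1 \<in> A then [] else [a - (if 1 \<in> B then 1 else 0)]) @
     remdec c {i. Suc i \<in> A} {i. Suc i \<in> B}"
proof -
  have "map (\<lambda>i. (a # c) ! i - (if Suc i \<in> B then 1 else 0)) (filter (\<lambda>i. Suc i \<notin> A) [1..<length c + 1]) =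
    map (\<lambda>i. c ! (i - 1) - (if Suc i \<in> B then 1 else 0)) (filter (\<lambda>i. Suc i \<notin> A) [1..<length c + 1])"
    by (intro map_cong refl) (auto simp: nth_Cons' simp del: upt_Suc)
  thus ?thesis unfolding remdec_def upt_1_Suc by (simp add: filter_map o_def del: upt_Suc)
qed

lemma remdec_Cons [simp]:
  assumes "0 \<notin> A" "0 \<notin> B"
  shows "remdec (a # c) (Suc ` A) (Suc ` B) = a # remdec c A B"
    "remdec (a # c) (insert (Suc 0) (Suc ` A)) (Suc ` B) = remdec c A B"
    "remdec (a # c) (Suc ` A) (insert (Suc 0) (Suc ` B)) = (a - 1) # remdec c A B"
proof -
  have 1: "{i. Suc i \<in> Suc ` A} = A" for A by auto
  have 2: "{i. Suc i \<in> insert (Suc 0) (Suc ` A)} = insert 0 A" for A by auto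
  show "remdec (a # c) (Suc ` A) (Suc ` B) = a # remdec c A B"
    "remdec (a # c) (insert (Suc 0) (Suc ` A)) (Suc ` B) = remdec c A B"
    "remdec (a # c) (Suc ` A) (insert (Suc 0) (Suc ` B)) = (a - 1) # remdec c A B"
    unfolding remdec_Cons_eq 1 2 using assms by auto
qed

lemma remdec_snoc [simp]:
  assumes "A \<subseteq> {1..length c}" "B \<subseteq> {1..length c}"
  shows "remdec (c @ [z]) A B = remdec c A B @ [z]"
    "remdec (c @ [z]) A (insert (Suc (length c)) B) = remdec c A B @ [z - 1]"
proof -
  have u: "[1..<length (c @ [z]) + 1] = [1..<length c + 1] @ [Suc (length c)]" by simp
  have "Suc (length c) \<notin> A" "Suc (length c) \<notin> B" using assms by auto
  thus "remdec (c @ [z]) A B = remdec c A B @ [z]"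
    "remdec (c @ [z]) A (insert (Suc (length c)) B) = remdec c A B @ [z - 1]"
    unfolding remdec_def u by (auto simp: nth_append simp del: upt_Suc)
qed

lemma ones_Cons_subset [simp]:
  "Suc ` A \<subseteq> ones (a # c) \<longleftrightarrow> A \<subseteq> ones c"
  "insert (Suc 0) (Suc ` A) \<subseteq> ones (a # c) \<longleftrightarrow> a = 1 \<and> A \<subseteq> ones c"
  if "0 \<notin> A"
proof -
  have "Suc i \<in> ones (a # c) \<longleftrightarrow> i \<in> ones c" if "i \<noteq> 0" for i
    using that by (cases i) (auto simp: ones_def)
  moreover have "Suc 0 \<in> ones (a # c) \<longleftrightarrow> a = 1" by (auto simp: ones_def)
  moreover have "i \<noteq> 0" if "i \<in> A" for i using that \<open>0 \<notin> A\<close> by metis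
  ultimately show "Suc ` A \<subseteq> ones (a # c) \<longleftrightarrow> A \<subseteq> ones c"
    "insert (Suc 0) (Suc ` A) \<subseteq> ones (a # c) \<longleftrightarrow> a = 1 \<and> A \<subseteq> ones c"
    by (auto simp: subset_iff)
qed

lemma gtones_Cons_subset [simp]:
  "Suc ` A \<subseteq> gtones (a # c) \<longleftrightarrow> A \<subseteq> gtones c"
  "insert (Suc 0) (Suc ` A) \<subseteq> gtones (a # c) \<longleftrightarrow> 1 < a \<and> A \<subseteq> gtones c"
  if "0 \<notin> A"
proof -
  have "Suc i \<in> gtones (a # c) \<longleftrightarrow> i \<in> gtones c" if "i \<noteq> 0" for i
    using that by (cases i) (auto simp: gtones_def)
  moreover have "Suc 0 \<in> gtones (a # c) \<longleftrightarrow> 1 < a" by (auto simp: gtones_def)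
  moreover have "i \<noteq> 0" if "i \<in> A" for i using that \<open>0 \<notin> A\<close> by metis
  ultimately show "Suc ` A \<subseteq> gtones (a # c) \<longleftrightarrow> A \<subseteq> gtones c"
    "insert (Suc 0) (Suc ` A) \<subseteq> gtones (a # c) \<longleftrightarrow> 1 < a \<and> A \<subseteq> gtones c"
    by (auto simp: subset_iff)
qed

lemma odd_even_shift [simp]:
  assumes "0 \<notin> A"
  shows "odd_even (Suc ` Suc ` A) \<longleftrightarrow> odd_even A"
    "\<not> odd_even (Suc ` insert (Suc 0) (Suc ` A))"
    "\<not> odd_even (insert (Suc 0) (Suc ` Suc ` A))"
    "odd_even (insert (Suc 0) (Suc ` insert (Suc 0) (Suc ` A))) \<longleftrightarrow> odd_even A"
proof -
  have r: "i \<in> Suc ` Suc ` A \<longleftrightarrow> 2 \<le> i \<and> i - 2 \<in> A" for i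
    by (cases i; cases "i - 1") auto
  have nz: "i \<noteq> 0" if "i \<in> A" for i using that assms by metis
  have s: "even i \<Longrightarrow> i \<in> A \<Longrightarrow> Suc i \<in> Suc ` Suc ` A \<longleftrightarrow> i - 1 \<in> A" for i
    using nz by (auto simp: r Suc_le_eq)
  have t: "Suc (Suc (Suc i)) \<in> Suc ` Suc ` A \<longleftrightarrow> Suc i \<in> A" for i
    by (auto simp: r)
  show 1: "odd_even (Suc ` Suc ` A) \<longleftrightarrow> odd_even A"
    unfolding odd_even_def ball_simps using s t by auto
  show "\<not> odd_even (Suc ` insert (Suc 0) (Suc ` A))"
    using assms by (auto simp: odd_even_def image_iff)
  show "\<not> odd_even (insert (Suc 0) (Suc ` Suc ` A))"
    using assms by (auto simp: odd_even_def image_iff)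
  have "odd_even (insert (Suc 0) (Suc ` insert (Suc 0) (Suc ` A))) \<longleftrightarrow>
     (\<forall>i\<in>A. (odd i \<longrightarrow> Suc i \<in> A) \<and> (even i \<longrightarrow> Suc i \<in> {Suc 0, Suc (Suc 0)} \<or> Suc i \<in> Suc ` Suc ` A))"
    unfolding odd_even_def using nz by (auto simp: t)
  also have "\<dots> \<longleftrightarrow> odd_even A" unfolding odd_even_def using s nz by auto
  finally show "odd_even (insert (Suc 0) (Suc ` insert (Suc 0) (Suc ` A))) \<longleftrightarrow> odd_even A" .
qed

text \<open>Moving all positions by one exchanges the two kinds of pairing; position 1 is excluded
  because its even-odd partner would be 0.\<close>

lemma even_odd_shift:
  assumes "0 \<notin> A"
  shows "even_odd (Suc ` A) \<longleftrightarrow> odd_even A" "\<not> even_odd (insert (Suc 0) (Suc ` A))"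
proof -
  have nz: "i \<noteq> 0" if "i \<in> A" for i using that assms by metis
  have "i \<in> Suc ` A \<longleftrightarrow> i - 1 \<in> A" if "i \<in> A" for i using nz[OF that] by (cases i) auto
  thus "even_odd (Suc ` A) \<longleftrightarrow> odd_even A" unfolding odd_even_def even_odd_def by auto
  show "\<not> even_odd (insert (Suc 0) (Suc ` A))" using assms by (auto simp: even_odd_def)
qed

definition nopair :: "nat \<Rightarrow> nat set \<Rightarrow> bool" where
  "nopair m B \<longleftrightarrow> (\<forall>r\<in>{1..m}. \<not> {2*r-1, 2*r} \<subseteq> B)"

lemma nopair_shift [simp]:
  assumes "0 \<notin> B"
  shows "nopair (Suc m) (Suc ` Suc ` B) \<longleftrightarrow> nopair m B"
    "nopair (Suc m) (Suc ` insert (Suc 0) (Suc ` B)) \<longleftrightarrow> nopair m B"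
    "nopair (Suc m) (insert (Suc 0) (Suc ` Suc ` B)) \<longleftrightarrow> nopair m B"
    "\<not> nopair (Suc m) (insert (Suc 0) (Suc ` insert (Suc 0) (Suc ` B)))"
proof -
  have e: "nopair (Suc m) B' \<longleftrightarrow> \<not> {1, 2} \<subseteq> B' \<and> (\<forall>r\<in>{1..m}. \<not> {2*r+1, 2*r+2} \<subseteq> B')" for B'
  proof -
    have s: "{1..Suc m} = insert 1 (Suc ` {1..m})"
      by (simp add: image_Suc_atLeastAtMost atLeastAtMost_insertL)
    have "nopair (Suc m) B' \<longleftrightarrow> \<not> {2*1-1, 2*1} \<subseteq> B' \<and> (\<forall>r\<in>{1..m}. \<not> {2 * Suc r - 1, 2 * Suc r} \<subseteq> B')"
      unfolding nopair_def s by blast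
    moreover have "2 * Suc r - 1 = 2 * r + 1" "2 * Suc r = 2 * r + 2" for r by simp_all
    ultimately show ?thesis by simp
  qed
  have f: "{2*r+1, 2*r+2} \<subseteq> Suc ` Suc ` B \<longleftrightarrow> {2*r-1, 2*r} \<subseteq> B" if "1 \<le> r" for r
  proof -
    have "{2*r+1, 2*r+2} = Suc ` Suc ` {2*r-1, 2*r}" using that by auto
    thus ?thesis by (simp only: inj_image_subset_iff[OF inj_Suc])
  qed
  show "nopair (Suc m) (Suc ` Suc ` B) \<longleftrightarrow> nopair m B"
    "nopair (Suc m) (Suc ` insert (Suc 0) (Suc ` B)) \<longleftrightarrow> nopair m B"
    "nopair (Suc m) (insert (Suc 0) (Suc ` Suc ` B)) \<longleftrightarrow> nopair m B"
    "\<not> nopair (Suc m) (insert (Suc 0) (Suc ` insert (Suc 0) (Suc ` B)))"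
    using f assms unfolding e by (auto simp: nopair_def)
qed

lemma card_insert_Suc_image [simp]:
  "0 \<notin> A \<Longrightarrow> finite A \<Longrightarrow> card (insert (Suc 0) (Suc ` A)) = Suc (card A)"
  by (subst card_insert_disjoint) (auto simp: card_image)

lemma oe_ok_nopair: "oe_ok c A B \<longleftrightarrow> A \<subseteq> ones c \<and> odd_even A \<and> B \<subseteq> gtones c \<and> nopair (length c div 2) B"
  by (simp add: oe_ok_def nopair_def)

lemma rsum_oe_Nil [simp]: "rsum oe_ok [] F = F 0 0 []"
  by (simp add: rsum_def oe_ok_def odd_even_def remdec_def)

text \<open>On the first pair, \<open>A\<close> takes both positions or none, \<open>B\<close> at
  most one, and an entry cannot be both 1 and larger. Of the sixteen distributions, four
  survive.\<close>

lemma rsum_oe_Cons2: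
  fixes F :: "nat \<Rightarrow> nat \<Rightarrow> nat list \<Rightarrow> 'a::comm_monoid_add"
  shows "rsum oe_ok (a # b # c) F =
    rsum oe_ok c (\<lambda>i j l. F i j (a # b # l)) +
    (if 1 < b then rsum oe_ok c (\<lambda>i j l. F i (Suc j) (a # (b - 1) # l)) else 0) +
    (if 1 < a then rsum oe_ok c (\<lambda>i j l. F i (Suc j) ((a - 1) # b # l)) else 0) +
    (if a = 1 \<and> b = 1 then rsum oe_ok c (\<lambda>i j l. F (Suc (Suc i)) j l) else 0)"
proof -
  let ?P = "Pow {1..length c}"
  let ?G = "\<lambda>A B. if oe_ok (a # b # c) A B then F (card A) (card B) (remdec (a # b # c) A B) else 0"
  let ?S1 = "\<lambda>A. Suc ` Suc ` A" and ?S2 = "\<lambda>A. Suc ` insert 1 (Suc ` A)"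
    and ?S3 = "\<lambda>A. insert 1 (Suc ` Suc ` A)" and ?S4 = "\<lambda>A. insert 1 (Suc ` insert 1 (Suc ` A))"
  have fin: "finite A" "0 \<notin> A" if "A \<in> ?P" for A using that finite_subset by auto
  have "rsum oe_ok (a # b # c) F = (\<Sum>A\<in>?P. \<Sum>B\<in>?P.
      (?G (?S1 A) (?S1 B) + ?G (?S1 A) (?S3 B) + (?G (?S1 A) (?S2 B) + ?G (?S1 A) (?S4 B))) +
      (?G (?S3 A) (?S1 B) + ?G (?S3 A) (?S3 B) + (?G (?S3 A) (?S2 B) + ?G (?S3 A) (?S4 B))) +
      ((?G (?S2 A) (?S1 B) + ?G (?S2 A) (?S3 B) + (?G (?S2 A) (?S2 B) + ?G (?S2 A) (?S4 B))) +
      (?G (?S4 A) (?S1 B) + ?G (?S4 A) (?S3 B) + (?G (?S4 A) (?S2 B) + ?G (?S4 A) (?S4 B)))))"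
    unfolding rsum_def list.size(4) add_0_right add_Suc_right sum_Pow_Suc
    by (simp only: sum.distrib)
  also have "\<dots> = (\<Sum>A\<in>?P. \<Sum>B\<in>?P.
     (if oe_ok c A B then F (card A) (card B) (a # b # remdec c A B) else 0) +
     (if 1 < b then if oe_ok c A B then F (card A) (Suc (card B)) (a # (b - 1) # remdec c A B) else 0 else 0) +
     (if 1 < a then if oe_ok c A B then F (card A) (Suc (card B)) ((a - 1) # b # remdec c A B) else 0 else 0) +
     (if a = 1 \<and> b = 1 then if oe_ok c A B then F (Suc (Suc (card A))) (card B) (remdec c A B) else 0 else 0))"
  proof (intro sum.cong refl, goal_cases)
    case (1 A B)
    note f = fin[OF 1(1)] fin[OF 1(2)]
    have g: "0 \<notin> Suc ` A" "0 \<notin> Suc ` B" "0 \<notin> insert (Suc 0) (Suc ` A)" "0 \<notin> insert (Suc 0) (Suc ` B)"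
      "finite (Suc ` A)" "finite (Suc ` B)" "finite (insert (Suc 0) (Suc ` A))" "finite (insert (Suc 0) (Suc ` B))"
      using f by auto
    have c: "card (Suc ` A) = card A" for A :: "nat set" by (simp add: card_image)
    show ?case using f g by (simp add: oe_ok_nopair c ac_simps del: image_insert insert_subset)
  qed
  also have "\<dots> = rsum oe_ok c (\<lambda>i j l. F i j (a # b # l)) +
    (if 1 < b then rsum oe_ok c (\<lambda>i j l. F i (Suc j) (a # (b - 1) # l)) else 0) +
    (if 1 < a then rsum oe_ok c (\<lambda>i j l. F i (Suc j) ((a - 1) # b # l)) else 0) +
    (if a = 1 \<and> b = 1 then rsum oe_ok c (\<lambda>i j l. F (Suc (Suc i)) j l) else 0)"
    unfolding sum.distrib rsum_def
    by (cases "1 < b"; cases "1 < a"; cases "a = 1"; cases "b = 1") simp_all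
  finally show ?thesis .
qed

lemma rsum_cong:
  "(\<And>A B. ok c A B \<Longrightarrow> finite A \<Longrightarrow> finite B \<Longrightarrow>
     F (card A) (card B) (remdec c A B) = G (card A) (card B) (remdec c A B)) \<Longrightarrow> rsum ok c F = rsum ok c G"
  unfolding rsum_def by (intro sum.cong refl if_cong) (auto intro: finite_subset)

lemma rsum_scale: "rsum ok c (\<lambda>i j l. (x::'a::semiring_0) * F i j l) = x * rsum ok c F"
  unfolding rsum_def sum_distrib_left by (intro sum.cong refl) auto

text \<open>Summing the indicator function of failure reduces this to the recursion for \<open>rsum\<close>.\<close>

lemma oe_ok_remdec:
  assumes c: "blocks c" and ok: "oe_ok c A B"
  shows "blocks (remdec c A B)" "even (card A)"
proof -
  \<comment> \<open>The prefix \<open>d\<close> holds the entries already processed, so the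
    induction hypothesis covers every list that the recursion forms.\<close>
  have "rsum oe_ok c (\<lambda>(i::nat) (j::nat) l. if even i \<and> blocks (d @ l) then 0 else (1::nat)) = 0" if "blocks d" for d
    using c that
  proof (induction c arbitrary: d rule: blocks_induct)
    case (Cons2 a b c)
    have I: "rsum oe_ok c (\<lambda>(i::nat) (j::nat) l. if even i \<and> blocks (d @ x # y # l) then 0 else (1::nat)) = 0"
      if "1 \<le> x" "1 \<le> y" for x y
      using Cons2.IH[of "d @ [x, y]"] Cons2.prems that by (auto simp: blocks_def)
    show ?case
      using I[of a b] I[of a "b - 1"] I[of "a - 1" b] Cons2.IH[OF Cons2.prems] Cons2.hyps
      unfolding rsum_oe_Cons2 even_Suc not_not by (auto simp del: One_nat_def)
  qed simp
  from this[of "[]"] have "rsum oe_ok c (\<lambda>(i::nat) (j::nat) l. if even i \<and> blocks l then 0 else (1::nat)) = 0"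
    by simp
  moreover have "A \<in> Pow {1..length c}" "B \<in> Pow {1..length c}"
    using ok by (auto simp: oe_ok_def ones_def gtones_def)
  ultimately show "blocks (remdec c A B)" "even (card A)"
    unfolding rsum_def using ok by (auto split: if_splits)
qed

text \<open>Even-odd pairs of \<open>a # c @ [z]\<close> are odd-even pairs of \<open>c\<close>; both end blocks are unpaired.\<close>

lemma rsum_eo:
  fixes F :: "nat \<Rightarrow> nat \<Rightarrow> nat list \<Rightarrow> 'a::comm_monoid_add"
  assumes "even (length c)"
  shows "rsum eo_ok (a # c @ [z]) F =
    rsum oe_ok c (\<lambda>i j l. F i j (a # l @ [z])) +
    (if 1 < z then rsum oe_ok c (\<lambda>i j l. F i (Suc j) (a # l @ [z - 1])) else 0) +
    (if 1 < a then rsum oe_ok c (\<lambda>i j l. F i (Suc j) ((a - 1) # l @ [z])) else 0) +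
    (if 1 < a \<and> 1 < z then rsum oe_ok c (\<lambda>i j l. F i (Suc (Suc j)) ((a - 1) # l @ [z - 1])) else 0)"
proof -
  let ?n = "length c"
  let ?P = "Pow {1..?n}"
  let ?G = "\<lambda>A B. if eo_ok (a # c @ [z]) A B then F (card A) (card B) (remdec (a # c @ [z]) A B) else 0"
  let ?S1 = "\<lambda>A. Suc ` A" and ?S2 = "\<lambda>A. Suc ` insert (Suc ?n) A"
    and ?S3 = "\<lambda>A. insert 1 (Suc ` A)" and ?S4 = "\<lambda>A. insert 1 (Suc ` insert (Suc ?n) A)"
  have s: "{1..Suc ?n} = insert (Suc ?n) {1..?n}" by auto
  have fin: "finite A" "0 \<notin> A" "Suc ?n \<notin> A" "Suc (Suc ?n) \<notin> A" if "A \<in> ?P" for A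
    using that finite_subset by auto
  have len: "length (a # c @ [z]) = Suc (Suc ?n)" by simp
  have split: "(\<Sum>A\<in>Pow {1..Suc (Suc ?n)}. f A) = (\<Sum>A\<in>?P. f (?S1 A) + f (?S3 A) + (f (?S2 A) + f (?S4 A)))"
    for f :: "nat set \<Rightarrow> 'a"
    unfolding sum_Pow_Suc s by (subst sum_Pow_insert) auto
  \<comment> \<open>The two end positions have their even-odd partners outside the list, so
    \<open>A\<close> must avoid both.\<close>
  have 0: "?G A B = 0" if "A \<in> ?S2 ` ?P \<union> ?S3 ` ?P \<union> ?S4 ` ?P" for A B
  proof -
    have "\<not> even_odd A"
    proof -
      from that have "(\<exists>A'\<in>?P. A = ?S2 A') \<or> (\<exists>A'. 0 \<notin> A' \<and> A = insert (Suc 0) (Suc ` A'))"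
      proof (elim UnE imageE)
        fix A' assume "A = ?S3 A'" "A' \<in> ?P"
        thus ?thesis by (intro disjI2 exI[of _ A']) auto
      next
        fix A' assume "A = ?S4 A'" "A' \<in> ?P"
        thus ?thesis by (intro disjI2 exI[of _ "insert (Suc ?n) A'"]) auto
      qed blast
      then consider A' where "A' \<in> ?P" "A = ?S2 A'" | A' where "0 \<notin> A'" "A = insert (Suc 0) (Suc ` A')"
        by blast
      thus ?thesis
      proof cases
        case 1
        thus ?thesis using assms fin[OF 1(1)] by (auto simp: even_odd_def)
      next
        case 2
        thus ?thesis by (simp add: even_odd_shift)
      qed
    qed
    thus ?thesis by (simp add: eo_ok_def)
  qed
  have z: "?G (?S2 A) B = 0" "?G (?S3 A) B = 0" "?G (?S4 A) B = 0" if "A \<in> ?P" for A B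
    by (rule 0, use that in blast)+
  have gt: "insert (Suc ?n) B \<subseteq> gtones (c @ [z]) \<longleftrightarrow> 1 < z \<and> B \<subseteq> gtones c"
    "B \<subseteq> gtones (c @ [z]) \<longleftrightarrow> B \<subseteq> gtones c" if "B \<in> ?P" for B
  proof -
    have "\<forall>i\<in>B. i \<in> gtones (c @ [z]) \<longleftrightarrow> i \<in> gtones c"
      using that by (auto simp: gtones_def nth_append)
    moreover have "Suc ?n \<in> gtones (c @ [z]) \<longleftrightarrow> 1 < z" by (auto simp: gtones_def nth_append)
    ultimately show "insert (Suc ?n) B \<subseteq> gtones (c @ [z]) \<longleftrightarrow> 1 < z \<and> B \<subseteq> gtones c"
      "B \<subseteq> gtones (c @ [z]) \<longleftrightarrow> B \<subseteq> gtones c" by blast+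
  qed
  have on: "A \<subseteq> ones (c @ [z]) \<longleftrightarrow> A \<subseteq> ones c" if "A \<in> ?P" for A
  proof -
    have "\<forall>i\<in>A. i \<in> ones (c @ [z]) \<longleftrightarrow> i \<in> ones c"
      using that by (auto simp: ones_def nth_append)
    thus ?thesis by blast
  qed
  have np: "(\<forall>r\<in>{1..length (a # c @ [z]) div 2 - 1}. \<not> {2*r, 2*r+1} \<subseteq> B') \<longleftrightarrow> nopair (?n div 2) B"
    if B: "B \<in> ?P" "B' \<in> {?S1 B, ?S2 B, ?S3 B, ?S4 B}" for B B'
  proof -
    have "{2*r, 2*r+1} \<subseteq> B' \<longleftrightarrow> {2*r-1, 2*r} \<subseteq> B" if r: "r \<in> {1..?n div 2}" for r
    proof -
      have m: "x \<in> B' \<longleftrightarrow> x \<in> Suc ` B" if "x \<noteq> 1" "x \<noteq> Suc (Suc ?n)" for x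
        using B(2) that by auto
      have "2 * r \<in> B' \<longleftrightarrow> 2 * r \<in> Suc ` B" "2 * r + 1 \<in> B' \<longleftrightarrow> 2 * r + 1 \<in> Suc ` B"
        using r by (intro m; auto)+
      hence "{2*r, 2*r+1} \<subseteq> B' \<longleftrightarrow> {2*r, 2*r+1} \<subseteq> Suc ` B" by blast
      moreover have "{2*r, 2*r+1} = Suc ` {2*r-1, 2*r}" using r by auto
      ultimately show ?thesis by (simp only: inj_image_subset_iff[OF inj_Suc])
    qed
    thus ?thesis by (simp add: nopair_def)
  qed
  have "rsum eo_ok (a # c @ [z]) F = (\<Sum>A\<in>?P. (\<Sum>B\<in>Pow {1..Suc (Suc ?n)}. ?G (?S1 A) B))"
    unfolding rsum_def len split[of "\<lambda>A. \<Sum>B\<in>Pow {1..Suc (Suc ?n)}. ?G A B"]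
    by (intro sum.cong refl) (simp only: z sum.neutral_const add_0_left add_0_right)
  also have "\<dots> = (\<Sum>A\<in>?P. \<Sum>B\<in>?P.
     (if oe_ok c A B then F (card A) (card B) (a # remdec c A B @ [z]) else 0) +
     (if 1 < z then if oe_ok c A B then F (card A) (Suc (card B)) (a # remdec c A B @ [z - 1]) else 0 else 0) +
     (if 1 < a then if oe_ok c A B then F (card A) (Suc (card B)) ((a - 1) # remdec c A B @ [z]) else 0 else 0) +
     (if 1 < a \<and> 1 < z then if oe_ok c A B then F (card A) (Suc (Suc (card B))) ((a - 1) # remdec c A B @ [z - 1]) else 0 else 0))"
    unfolding split
  proof (intro sum.cong refl, goal_cases)
    case (1 A B)
    note f = fin[OF 1(1)] fin[OF 1(2)]
    have g: "0 \<notin> insert (Suc ?n) B" "finite (insert (Suc ?n) B)" using f by auto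
    have c: "card (Suc ` A) = card A" for A :: "nat set" by (simp add: card_image)
    have sub: "A \<subseteq> {1..?n}" "B \<subseteq> {1..?n}" using 1 by auto
    have ok: "eo_ok (a # c @ [z]) (?S1 A) (?S1 B) \<longleftrightarrow> oe_ok c A B"
      "eo_ok (a # c @ [z]) (?S1 A) (?S2 B) \<longleftrightarrow> 1 < z \<and> oe_ok c A B"
      "eo_ok (a # c @ [z]) (?S1 A) (?S3 B) \<longleftrightarrow> 1 < a \<and> oe_ok c A B"
      "eo_ok (a # c @ [z]) (?S1 A) (?S4 B) \<longleftrightarrow> 1 < a \<and> 1 < z \<and> oe_ok c A B"
      unfolding eo_ok_def oe_ok_nopair using f g np[OF 1(2)] 
      by (simp_all add: even_odd_shift gt[OF 1(2)] on[OF 1(1)] del: image_insert insert_subset) blast+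
    show ?case unfolding ok
      using f g remdec_snoc[OF sub] by (auto simp: c ac_simps simp del: image_insert)
  qed
  also have "\<dots> = rsum oe_ok c (\<lambda>i j l. F i j (a # l @ [z])) +
    (if 1 < z then rsum oe_ok c (\<lambda>i j l. F i (Suc j) (a # l @ [z - 1])) else 0) +
    (if 1 < a then rsum oe_ok c (\<lambda>i j l. F i (Suc j) ((a - 1) # l @ [z])) else 0) +
    (if 1 < a \<and> 1 < z then rsum oe_ok c (\<lambda>i j l. F i (Suc (Suc j)) ((a - 1) # l @ [z - 1])) else 0)"
    unfolding sum.distrib rsum_def by simp
  finally show ?thesis .
qed

subsection \<open>Operator identities\<close>

definition lin :: "((nat \<Rightarrow> rat) \<Rightarrow> (nat \<Rightarrow> rat)) \<Rightarrow> bool" where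
  "lin F \<longleftrightarrow> (\<forall>f g x y. F (\<lambda>j. x * f j + y * g j) = (\<lambda>j. x * F f j + y * F g j))"

definition linf :: "((nat \<Rightarrow> rat) \<Rightarrow> rat) \<Rightarrow> bool" where
  "linf F \<longleftrightarrow> (\<forall>f g x y. F (\<lambda>j. x * f j + y * g j) = x * F f + y * F g)"

lemma lin_cum: "lin (cum w)"
  unfolding lin_def cum_def by (simp add: fun_eq_iff sum_distrib_left sum.distrib algebra_simps)

lemma lin_sh: "lin sh"
  unfolding lin_def sh_def by simp

lemma lin_id: "lin (\<lambda>f. f)"
  unfolding lin_def by simp

lemma lin_comp: "lin F \<Longrightarrow> lin G \<Longrightarrow> lin (\<lambda>f. F (G f))"
  unfolding lin_def by simp

lemma lin_funpow: "lin F \<Longrightarrow> lin (F ^^ n)"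
  by (induction n) (simp_all add: lin_def)

lemma lin_add: "lin F \<Longrightarrow> lin G \<Longrightarrow> lin (\<lambda>f j. F f j + x * G f j)"
  unfolding lin_def by (simp add: fun_eq_iff algebra_simps)

lemma linf_comp: "linf L \<Longrightarrow> lin G \<Longrightarrow> linf (\<lambda>f. L (G f))"
  unfolding lin_def linf_def by simp

lemma linf_eval: "linf (\<lambda>f. f k)"
  unfolding linf_def by simp

lemma lin_D:
  assumes "lin F"
  shows "F (\<lambda>j. f j + x * g j) = (\<lambda>j. F f j + x * F g j)"
    "F (\<lambda>j. f j - x * g j - x * h j) = (\<lambda>j. F f j - x * F g j - x * F h j)"
proof -
  have *: "F (\<lambda>j. x * f j + y * g j) = (\<lambda>j. x * F f j + y * F g j)" for f g x y
    using assms unfolding lin_def by blast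
  show "F (\<lambda>j. f j + x * g j) = (\<lambda>j. F f j + x * F g j)" using *[of 1 f x g] by simp
  have "F (\<lambda>j. f j - x * g j - x * h j) = F (\<lambda>j. 1 * f j + (-x) * (1 * g j + 1 * h j))"
    by (simp add: algebra_simps)
  also have "\<dots> = (\<lambda>j. F f j - x * F g j - x * F h j)" unfolding * by (simp add: fun_eq_iff algebra_simps)
  finally show "F (\<lambda>j. f j - x * g j - x * h j) = (\<lambda>j. F f j - x * F g j - x * F h j)" .
qed

lemma linf_D:
  assumes "linf F"
  shows "F (\<lambda>j. f j - x * g j - y * h j + z * k j) = F f - x * F g - y * F h + z * F k"
proof -
  have *: "F (\<lambda>j. x * f j + y * g j) = x * F f + y * F g" for f g x y
    using assms unfolding linf_def by blast
  have "F (\<lambda>j. f j - x * g j - y * h j + z * k j) = F (\<lambda>j. 1 * (1 * f j + (-x) * g j) + 1 * ((-y) * h j + z * k j))"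
    by (simp add: algebra_simps)
  also have "\<dots> = F f - x * F g - y * F h + z * F k" unfolding * by (simp add: algebra_simps)
  finally show ?thesis .
qed

text \<open>In a block of length one the partial-fraction relation \<open>p q = t (p + q)\<close> produces an extra
  term in which the whole block is dropped; \<open>shr\<close> and \<open>shl\<close> incorporate it, with the strict step
  between neighbouring blocks placed before and after the block, respectively.\<close>

definition shr :: "rat \<Rightarrow> (nat \<Rightarrow> rat) \<Rightarrow> nat \<Rightarrow> (nat \<Rightarrow> rat) \<Rightarrow> nat \<Rightarrow> rat" where
  "shr t w a f j = (cum w ^^ a) (sh f) j + (if a = 1 then t else 0) * f j"

definition shl :: "rat \<Rightarrow> (nat \<Rightarrow> rat) \<Rightarrow> nat \<Rightarrow> (nat \<Rightarrow> rat) \<Rightarrow> nat \<Rightarrow> rat" where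
  "shl t w a f j = sh ((cum w ^^ a) f) j + (if a = 1 then t else 0) * f j"

lemma lin_shr: "lin (shr t w a)"
  unfolding shr_def by (intro lin_add lin_comp[of "cum w ^^ a" sh] lin_funpow lin_cum lin_sh lin_id)

lemma lin_shl: "lin (shl t w a)"
  unfolding shl_def by (intro lin_add lin_comp[of sh "cum w ^^ a"] lin_funpow lin_cum lin_sh lin_id)

lemma sh_shr: "sh (shr t w a f) = shl t w a (sh f)"
  by (simp add: fun_eq_iff sh_def shr_def shl_def)

context
  fixes p q :: "nat \<Rightarrow> rat" and t :: rat
  assumes pq: "\<And>i. p i * q i = t * (p i + q i)" and p0: "p 0 = 0" and q0: "q 0 = 0"
begin

text \<open>Weak and strict nested sums differ by the diagonal terms \<open>p i * q i * f i\<close>,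
  which the relation between \<open>p\<close> and \<open>q\<close> splits into two single
  sums.\<close>

lemma cum_sh_cum: "cum p (sh (cum q f)) = (\<lambda>j. cum p (cum q f) j - t * f' j - t * g' j)"
  if "f' = cum p f" "g' = cum q f"
proof
  fix j show "cum p (sh (cum q f)) j = cum p (cum q f) j - t * f' j - t * g' j"
  proof (induction j)
    case (Suc j)
    have "p (Suc j) * (q (Suc j) * f (Suc j)) = t * (p (Suc j) + q (Suc j)) * f (Suc j)"
      unfolding pq[of "Suc j", symmetric] by (simp only: mult.assoc)
    thus ?case using Suc that by (simp add: algebra_simps)
  qed (simp add: p0 q0 that)
qed

lemma funpow_cum_sh:
  "(cum p ^^ Suc b) (sh ((cum q ^^ Suc a) g)) = (\<lambda>j. (cum p ^^ Suc b) ((cum q ^^ Suc a) g) j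
     - t * (cum p ^^ Suc b) ((cum q ^^ a) g) j - t * (cum p ^^ b) ((cum q ^^ Suc a) g) j)"
proof -
  have "(cum p ^^ Suc b) (sh ((cum q ^^ Suc a) g)) = (cum p ^^ b) (cum p (sh (cum q ((cum q ^^ a) g))))"
    by (simp add: funpow_swap1)
  also have "\<dots> = (cum p ^^ b) (\<lambda>j. cum p (cum q ((cum q ^^ a) g)) j - t * cum p ((cum q ^^ a) g) j
       - t * cum q ((cum q ^^ a) g) j)"
    by (subst cum_sh_cum[OF refl refl]) simp
  also have "\<dots> = (\<lambda>j. (cum p ^^ b) (cum p (cum q ((cum q ^^ a) g))) j - t * (cum p ^^ b) (cum p ((cum q ^^ a) g)) j
       - t * (cum p ^^ b) (cum q ((cum q ^^ a) g)) j)"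
    by (rule lin_D(2)) (intro lin_funpow lin_cum)
  finally show ?thesis by (simp add: funpow_swap1)
qed

text \<open>By \<open>funpow_cum_sh\<close>, a strict step costs the two terms with a lowered
  exponent. If a block has length one, its lowered term is cancelled by the extra term of
  \<open>shr\<close>, and two such blocks leave \<open>t\<^sup>2 * f j\<close>. The four cases are
  those of \<open>rsum_oe_Cons2\<close>.\<close>

lemma shr_shr:
  assumes "1 \<le> a" "1 \<le> b"
  defines "M \<equiv> \<lambda>a b f. (cum p ^^ b) ((cum q ^^ a) (sh f))"
  shows "shr t p b (shr t q a f) = (\<lambda>j. M a b f j
      - (if 1 < b then t else 0) * M a (b - 1) f j - (if 1 < a then t else 0) * M (a - 1) b f j
      + (if a = 1 \<and> b = 1 then t\<^sup>2 else 0) * f j)"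
proof
  fix j
  obtain a' b' where ab: "a = Suc a'" "b = Suc b'" using assms(1,2) by (cases a; cases b) auto
  define x where "x = (if a = 1 then t else 0)"
  define y where "y = (if b = 1 then t else 0)"
  have e: "shr t q a f = (\<lambda>j. (cum q ^^ a) (sh f) j + x * f j)"
    by (simp add: fun_eq_iff shr_def x_def)
  have "shr t p b (shr t q a f) j = (cum p ^^ b) (sh (\<lambda>j. (cum q ^^ a) (sh f) j + x * f j)) j
      + y * ((cum q ^^ a) (sh f) j + x * f j)"
    unfolding shr_def[of t p] e y_def ..
  also have "sh (\<lambda>j. (cum q ^^ a) (sh f) j + x * f j) = (\<lambda>j. sh ((cum q ^^ a) (sh f)) j + x * sh f j)"
    by (simp add: fun_eq_iff sh_def)
  also have "(cum p ^^ b) \<dots> = (\<lambda>j. (cum p ^^ b) (sh ((cum q ^^ a) (sh f))) j + x * (cum p ^^ b) (sh f) j)"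
    by (rule lin_D(1)) (intro lin_funpow lin_cum)
  finally have *: "shr t p b (shr t q a f) j = M a b f j - t * M a' b f j - t * M a b' f j
      + x * (cum p ^^ b) (sh f) j + y * (cum q ^^ a) (sh f) j + x * y * f j"
    unfolding M_def ab funpow_cum_sh by (simp add: algebra_simps)
  have xM: "x * (cum p ^^ b) (sh f) j = x * M a' b f j" by (auto simp: x_def M_def ab)
  have yM: "y * (cum q ^^ a) (sh f) j = y * M a b' f j" by (auto simp: y_def M_def ab)
  show "shr t p b (shr t q a f) j = M a b f j
      - (if 1 < b then t else 0) * M a (b - 1) f j - (if 1 < a then t else 0) * M (a - 1) b f j
      + (if a = 1 \<and> b = 1 then t\<^sup>2 else 0) * f j"
    unfolding * xM yM by (auto simp: x_def y_def ab power2_eq_square)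
qed

lemma shl_shl:
  assumes "1 \<le> a" "1 \<le> b"
  defines "M \<equiv> \<lambda>a b f. sh ((cum p ^^ b) ((cum q ^^ a) f))"
  shows "shl t p b (shl t q a f) = (\<lambda>j. M a b f j
      - (if 1 < b then t else 0) * M a (b - 1) f j - (if 1 < a then t else 0) * M (a - 1) b f j
      + (if a = 1 \<and> b = 1 then t\<^sup>2 else 0) * f j)"
proof
  fix j
  obtain a' b' where ab: "a = Suc a'" "b = Suc b'" using assms(1,2) by (cases a; cases b) auto
  define x where "x = (if a = 1 then t else 0)"
  define y where "y = (if b = 1 then t else 0)"
  have e: "shl t q a f = (\<lambda>j. sh ((cum q ^^ a) f) j + x * f j)"
    by (simp add: fun_eq_iff shl_def x_def)
  have "shl t p b (shl t q a f) j = sh ((cum p ^^ b) (\<lambda>j. sh ((cum q ^^ a) f) j + x * f j)) j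
      + y * (sh ((cum q ^^ a) f) j + x * f j)"
    unfolding shl_def[of t p] e y_def ..
  also have "(cum p ^^ b) (\<lambda>j. sh ((cum q ^^ a) f) j + x * f j) =
      (\<lambda>j. (cum p ^^ b) (sh ((cum q ^^ a) f)) j + x * (cum p ^^ b) f j)"
    by (rule lin_D(1)) (intro lin_funpow lin_cum)
  finally have *: "shl t p b (shl t q a f) j = M a b f j - t * M a' b f j - t * M a b' f j
      + x * sh ((cum p ^^ b) f) j + y * sh ((cum q ^^ a) f) j + x * y * f j"
    unfolding M_def ab funpow_cum_sh by (simp add: algebra_simps sh_def)
  have xM: "x * sh ((cum p ^^ b) f) j = x * M a' b f j" by (auto simp: x_def M_def ab)
  have yM: "y * sh ((cum q ^^ a) f) j = y * M a b' f j" by (auto simp: y_def M_def ab)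
  show "shl t p b (shl t q a f) j = M a b f j
      - (if 1 < b then t else 0) * M a (b - 1) f j - (if 1 < a then t else 0) * M (a - 1) b f j
      + (if a = 1 \<and> b = 1 then t\<^sup>2 else 0) * f j"
    unfolding * xM yM by (auto simp: x_def y_def ab power2_eq_square)
qed

end

text \<open>The pair operator is a parameter because the same fold serves pairs
  \<open>y^a x^b\<close> and, once the two outer blocks are split off, pairs
  \<open>x^b y^a\<close>.\<close>

fun pfold :: "(nat \<Rightarrow> nat \<Rightarrow> (nat \<Rightarrow> rat) \<Rightarrow> nat \<Rightarrow> rat) \<Rightarrow> nat list \<Rightarrow> (nat \<Rightarrow> rat) \<Rightarrow> nat \<Rightarrow> rat" where
  "pfold M (a # b # c) f = pfold M c (M a b f)"
| "pfold M _ f = f"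

lemma lin_pfold: "(\<And>a b. lin (M a b)) \<Longrightarrow> lin (pfold M c)"
proof (induction c rule: induct_list012)
  case (3 a b c)
  thus ?case using lin_comp[of "pfold M c" "M a b"] by simp
qed (simp_all add: lin_def)

text \<open>The sum over \<open>(A, B)\<close> factors over the pairs \<open>{2r-1, 2r}\<close>.\<close>

lemma rsum_oe_pfold:
  fixes t :: rat
  assumes "blocks c" "linf L" "\<And>a b. lin (M' a b)"
    and M: "\<And>a b f. 1 \<le> a \<Longrightarrow> 1 \<le> b \<Longrightarrow> M' a b f = (\<lambda>j. M a b f j
      - (if 1 < b then t else 0) * M a (b - 1) f j - (if 1 < a then t else 0) * M (a - 1) b f j
      + (if a = 1 \<and> b = 1 then t\<^sup>2 else 0) * f j)"
  shows "rsum oe_ok c (\<lambda>i j l. (-1) ^ j * t ^ (i + j) * L (pfold M l f)) = L (pfold M' c f)"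
  using assms(1)
proof (induction c arbitrary: f rule: blocks_induct)
  case (Cons2 a b c)
  let ?R = "\<lambda>f. rsum oe_ok c (\<lambda>i j l. (-1) ^ j * t ^ (i + j) * L (pfold M l f))"
  have 1: "rsum oe_ok c (\<lambda>i j l. (-1) ^ Suc j * t ^ (i + Suc j) * L (pfold M (x # y # l) f)) =
      - t * ?R (M x y f)" for x y
    unfolding rsum_scale[symmetric] by (simp add: algebra_simps)
  have 2: "rsum oe_ok c (\<lambda>i j l. (-1) ^ j * t ^ (Suc (Suc i) + j) * L (pfold M l f)) = t\<^sup>2 * ?R f"
    unfolding rsum_scale[symmetric] by (simp add: algebra_simps power2_eq_square)
  have "rsum oe_ok (a # b # c) (\<lambda>i j l. (-1) ^ j * t ^ (i + j) * L (pfold M l f)) =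
     ?R (M a b f) - (if 1 < b then t else 0) * ?R (M a (b - 1) f) - (if 1 < a then t else 0) * ?R (M (a - 1) b f)
     + (if a = 1 \<and> b = 1 then t\<^sup>2 else 0) * ?R f"
    unfolding rsum_oe_Cons2 1 2 by simp
  also have "\<dots> = L (pfold M' c (M' a b f))"
    unfolding Cons2.IH M[OF Cons2.hyps(1,2)]
    by (rule linf_D[symmetric, OF linf_comp[OF assms(2) lin_pfold[OF assms(3)]]])
  finally show ?case by simp
qed simp

subsection \<open>Transport from \<open>N\<close> to \<open>N + 1\<close>\<close>

lemma xw_yw: "xw N i * yw N i = 1 / of_nat N * (xw N i + yw N i)"
proof (cases "0 < i \<and> i < N")
  case True
  hence "(of_nat (N - i) :: rat) = of_nat N - of_nat i" "(of_nat i :: rat) < of_nat N" "(0::rat) < of_nat i"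
    by (simp_all add: of_nat_diff)
  thus ?thesis using True by (simp add: xw_def yw_def field_simps)
qed (auto simp: xw_def yw_def)

lemma yw_xw: "yw N i * xw N i = 1 / of_nat N * (yw N i + xw N i)"
  using xw_yw[of N i] by (simp add: mult.commute add.commute)

lemma bval_eq_pfold: "bval N c f = pfold (\<lambda>a b f. (cum (xw N) ^^ b) ((cum (yw N) ^^ a) (sh f))) c f"
  by (induction c arbitrary: f rule: induct_list012) simp_all

abbreviation oe_op :: "nat \<Rightarrow> nat list \<Rightarrow> (nat \<Rightarrow> rat) \<Rightarrow> nat \<Rightarrow> rat" where
  "oe_op N \<equiv> pfold (\<lambda>a b f. shr (1 / of_nat N) (xw N) b (shr (1 / of_nat N) (yw N) a f))"

abbreviation eo_op :: "nat \<Rightarrow> nat list \<Rightarrow> (nat \<Rightarrow> rat) \<Rightarrow> nat \<Rightarrow> rat" where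
  "eo_op N \<equiv> pfold (\<lambda>b a f. shl (1 / of_nat N) (yw N) a (shl (1 / of_nat N) (xw N) b f))"

lemma rsum_oe_Zblock:
  assumes "blocks c"
  shows "rsum oe_ok c (\<lambda>i j l. (-1) ^ j * (1 / of_nat N) ^ (i + j) * Zblock N l) = oe_op N c (\<lambda>_. 1) (N - 1)"
  unfolding Zblock_def bval_eq_pfold
proof (rule rsum_oe_pfold[OF assms linf_eval])
  show "lin (\<lambda>f. shr (1 / of_nat N) (xw N) b (shr (1 / of_nat N) (yw N) a f))" for a b
    by (rule lin_comp[OF lin_shr lin_shr])
qed (rule shr_shr; simp add: xw_yw[simplified])

text \<open>For \<open>i > 0\<close>, \<open>yw (Suc N) (Suc i) = yw N i\<close>: raising the level
  moves the y-weights up by one place. The leftover summand at 1 carries the factor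
  \<open>g 0\<close>.\<close>

lemma cum_yw_Suc_sh:
  assumes "g 0 = 0"
  shows "cum (yw (Suc N)) (sh g) = sh (cum (yw N) g)"
proof
  fix j
  have y: "yw (Suc N) (Suc (Suc i)) = yw N (Suc i)" for i by (simp add: yw_def)
  show "cum (yw (Suc N)) (sh g) j = sh (cum (yw N) g) j"
  proof (cases j)
    case (Suc i)
    have "cum (yw (Suc N)) (sh g) (Suc i) = cum (yw N) g i"
      by (induction i) (simp_all add: assms y)
    thus ?thesis using Suc by simp
  qed (simp add: assms)
qed

lemma funpow_cum_yw_Suc_sh:
  "g 0 = 0 \<Longrightarrow> (cum (yw (Suc N)) ^^ n) (sh g) = sh ((cum (yw N) ^^ n) g)"
proof (induction n)
  case (Suc n)
  have "((cum (yw N) ^^ n) g) 0 = 0" using Suc.prems by (cases n) simp_all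
  thus ?case using Suc by (simp add: cum_yw_Suc_sh)
qed simp

lemma funpow_cum_xw_Suc: "i < N \<Longrightarrow> (cum (xw (Suc N)) ^^ n) f i = (cum (xw N) ^^ n) f i"
proof (induction n arbitrary: i)
  case (Suc n)
  have "cum (xw (Suc N)) ((cum (xw (Suc N)) ^^ n) f) i = cum (xw N) ((cum (xw N) ^^ n) f) i"
  proof (rule cum_cong)
    fix k assume "k \<le> i"
    hence k: "k < N" using Suc.prems by simp
    thus "xw (Suc N) k * (cum (xw (Suc N)) ^^ n) f k = xw N k * (cum (xw N) ^^ n) f k"
      by (simp add: Suc.IH xw_def[of _ k])
  qed
  thus ?case by simp
qed simp

text \<open>Raising the level absorbs the strict step in front of the y-block and leaves one behind
  it. The x-sums of the two levels differ only from index \<open>N\<close> on, where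
  \<open>yw N\<close> vanishes.\<close>

lemma eo_pair:
  assumes "1 \<le> a" "1 \<le> b"
  shows "(cum (yw (Suc N)) ^^ a) (sh ((cum (xw (Suc N)) ^^ b) f)) = sh ((cum (yw N) ^^ a) ((cum (xw N) ^^ b) f))"
proof -
  obtain a' b' where ab: "a = Suc a'" "b = Suc b'" using assms by (cases a; cases b) auto
  have "(cum (yw (Suc N)) ^^ a) (sh ((cum (xw (Suc N)) ^^ b) f)) = sh ((cum (yw N) ^^ a) ((cum (xw (Suc N)) ^^ b) f))"
    by (rule funpow_cum_yw_Suc_sh) (simp add: ab)
  also have "cum (yw N) ((cum (xw (Suc N)) ^^ b) f) = cum (yw N) ((cum (xw N) ^^ b) f)"
  proof
    fix j show "cum (yw N) ((cum (xw (Suc N)) ^^ b) f) j = cum (yw N) ((cum (xw N) ^^ b) f) j"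
      by (rule cum_cong) (auto simp: yw_def funpow_cum_xw_Suc)
  qed
  hence "(cum (yw N) ^^ a) ((cum (xw (Suc N)) ^^ b) f) = (cum (yw N) ^^ a) ((cum (xw N) ^^ b) f)"
    unfolding ab(1) funpow_Suc_right o_def by (simp only:)
  finally show ?thesis .
qed

text \<open>Regrouping \<open>(y\<^sup>a x\<^sup>b)(y\<^sup>a x\<^sup>b)\<dots>\<close> as \<open>y\<^sup>a (x\<^sup>b y\<^sup>a) \<dots> x\<^sup>b\<close>.\<close>

lemma bval_regroup:
  assumes "even (length c)"
  shows "bval N (a # c @ [z]) f = (cum (xw N) ^^ z)
     (pfold (\<lambda>b a f. (cum (yw N) ^^ a) (sh ((cum (xw N) ^^ b) f))) c ((cum (yw N) ^^ a) (sh f)))"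
  using assms by (induction c arbitrary: a f rule: induct_list012) simp_all

text \<open>The outer shift travels inwards by \<open>sh_shr\<close>, turning each
  \<open>shr\<close> into \<open>shl\<close>; the factors are then regrouped around the two end
  blocks.\<close>

lemma sh_oe_op:
  assumes "even (length c)"
  shows "sh (oe_op N (a # c @ [z]) f) = shl (1 / of_nat N) (xw N) z (eo_op N c (shl (1 / of_nat N) (yw N) a (sh f)))"
  using assms by (induction c arbitrary: a f rule: induct_list012) (simp_all add: sh_shr)

text \<open>Agreement at positive arguments suffices because the weights vanish at 0;
  \<open>eo_first\<close> gives no more than that.\<close>

lemma cum_cong_pos: "w 0 = 0 \<Longrightarrow> (\<And>j. 0 < j \<Longrightarrow> f j = g j) \<Longrightarrow> cum w f = cum w g"
  by (auto simp: fun_eq_iff intro!: cum_cong) (metis mult_zero_left neq0_conv)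

lemma shl_cong_pos:
  assumes "w 0 = 0" "1 \<le> a" "\<And>j. 0 < j \<Longrightarrow> f j = g j" "0 < j"
  shows "shl t w a f j = shl t w a g j"
proof -
  obtain a' where a: "a = Suc a'" using assms by (cases a) auto
  have "(cum w ^^ a) f = (cum w ^^ a) g"
    unfolding a funpow_Suc_right o_def using cum_cong_pos[of w f g] assms by simp
  thus ?thesis using assms by (simp add: shl_def)
qed

lemma eo_op_cong_pos:
  assumes "blocks c" "\<And>j. 0 < j \<Longrightarrow> f j = g j" "0 < j"
  shows "eo_op N c f j = eo_op N c g j"
  using assms
proof (induction c arbitrary: f g j rule: blocks_induct)
  case (Cons2 b a c)
  show ?case unfolding pfold.simps
    by (intro Cons2.IH shl_cong_pos Cons2.prems) (use Cons2.hyps in simp_all)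
qed simp

text \<open>The counterpart of \<open>cum_yw_Suc_sh\<close> for a function that is 1 at 0: the
  leftover summand is \<open>1/N\<close>.\<close>

lemma cum_yw_Suc_1: "cum (yw (Suc N)) (\<lambda>_. 1) j = (if j = 0 then 0 else cum (yw N) (\<lambda>_. 1) (j - 1) + 1 / of_nat N)"
proof (cases "N = 0")
  case True
  thus ?thesis by (auto simp: cum_def yw_def intro!: sum.neutral)
next
  case False
  have y: "yw (Suc N) (Suc (Suc i)) = yw N (Suc i)" "yw (Suc N) (Suc 0) = 1 / of_nat N" for i
    using False by (simp_all add: yw_def)
  show ?thesis
  proof (cases j)
    case (Suc i)
    have "cum (yw (Suc N)) (\<lambda>_. 1) (Suc i) = cum (yw N) (\<lambda>_. 1) i + 1 / of_nat N"
      by (induction i) (simp_all add: y)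
    thus ?thesis using Suc by simp
  qed simp
qed

text \<open>The leftover \<open>1/N\<close> of \<open>cum_yw_Suc_1\<close> is the extra term of
  \<open>shl\<close> if \<open>a = 1\<close>, and is cancelled by the lowered block if
  \<open>a > 1\<close>.\<close>

lemma eo_first:
  assumes "1 \<le> a" "0 < j"
  shows "(cum (yw (Suc N)) ^^ a) (\<lambda>_. 1) j - (if 1 < a then 1 / of_nat N else 0) * (cum (yw (Suc N)) ^^ (a - 1)) (\<lambda>_. 1) j
     = shl (1 / of_nat N) (yw N) a (\<lambda>_. 1) j"
proof (cases "a = 1")
  case True
  thus ?thesis using assms by (simp add: cum_yw_Suc_1 shl_def sh_def)
next
  case False
  then obtain a' where a: "a = Suc (Suc a')" using assms by (metis One_nat_def not0_implies_Suc not_one_le_zero)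
  have f: "cum (yw (Suc N)) (\<lambda>j. cum (yw (Suc N)) (\<lambda>_. 1) j + - (1 / of_nat N) * 1) =
     cum (yw (Suc N)) (sh (cum (yw N) (\<lambda>_. 1)))"
    by (rule cum_cong_pos) (auto simp: cum_yw_Suc_1 sh_def)
  have "(cum (yw (Suc N)) ^^ Suc a') (\<lambda>j. cum (yw (Suc N)) (\<lambda>_. 1) j + - (1 / of_nat N) * 1) =
     (\<lambda>j. (cum (yw (Suc N)) ^^ Suc a') (cum (yw (Suc N)) (\<lambda>_. 1)) j
        + - (1 / of_nat N) * (cum (yw (Suc N)) ^^ Suc a') (\<lambda>_. 1) j)"
    by (rule lin_D(1)[OF lin_funpow[OF lin_cum]])
  moreover have "(cum (yw (Suc N)) ^^ a) (\<lambda>_. 1) = (cum (yw (Suc N)) ^^ Suc a') (cum (yw (Suc N)) (\<lambda>_. 1))"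
    unfolding a by (simp only: funpow_Suc_right o_apply)
  ultimately have "(cum (yw (Suc N)) ^^ a) (\<lambda>_. 1) j - 1 / of_nat N * (cum (yw (Suc N)) ^^ (a - 1)) (\<lambda>_. 1) j =
     (cum (yw (Suc N)) ^^ Suc a') (\<lambda>j. cum (yw (Suc N)) (\<lambda>_. 1) j + - (1 / of_nat N) * 1) j"
    by (simp add: a)
  also have "\<dots> = (cum (yw (Suc N)) ^^ Suc a') (sh (cum (yw N) (\<lambda>_. 1))) j"
    unfolding funpow_Suc_right o_def f ..
  also have "\<dots> = sh ((cum (yw N) ^^ Suc a') (cum (yw N) (\<lambda>_. 1))) j"
    by (subst funpow_cum_yw_Suc_sh) simp_all
  finally show ?thesis using False a by (simp add: shl_def funpow_swap1)
qed

text \<open>At level \<open>N + 1\<close> the outermost x-sum has one more summand, at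
  \<open>N\<close>, of weight \<open>1/N\<close>. It is the extra term of \<open>shl\<close> if
  \<open>z = 1\<close>, and is cancelled by the lowered block otherwise.\<close>

lemma eo_last:
  assumes "1 \<le> z" "1 \<le> N"
  shows "(cum (xw (Suc N)) ^^ z) g N - (if 1 < z then 1 / of_nat N else 0) * (cum (xw (Suc N)) ^^ (z - 1)) g N
     = shl (1 / of_nat N) (xw N) z g N"
proof -
  obtain z' where z: "z = Suc z'" using assms by (cases z) auto
  obtain M where N: "N = Suc M" using assms by (cases N) auto
  have "(cum (xw (Suc N)) ^^ z) g N = (cum (xw (Suc N)) ^^ z) g M + 1 / of_nat N * (cum (xw (Suc N)) ^^ z') g N"
    using N by (simp add: z xw_def)
  also have "(cum (xw (Suc N)) ^^ z) g M = (cum (xw N) ^^ z) g M"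
    by (rule funpow_cum_xw_Suc) (simp add: N)
  finally show ?thesis using z N by (auto simp: shl_def sh_def)
qed

text \<open>Inner pairs are handled by \<open>rsum_oe_pfold\<close>. The unpaired end blocks are
  kept or lowered independently, so their four combinations factor into the differences treated by
  \<open>eo_first\<close> and \<open>eo_last\<close>.\<close>

lemma rsum_eo_Zblock:
  assumes c: "blocks c" and a: "1 \<le> a" and z: "1 \<le> z" and N: "1 \<le> N"
  shows "rsum eo_ok (a # c @ [z]) (\<lambda>i j l. (-1) ^ j * (1 / of_nat N) ^ (i + j) * Zblock (Suc N) l)
     = shl (1 / of_nat N) (xw N) z (eo_op N c (shl (1 / of_nat N) (yw N) a (\<lambda>_. 1))) N"
proof -
  let ?t = "1 / of_nat N :: rat"
  define M where "M = (\<lambda>b a f. (cum (yw (Suc N)) ^^ a) (sh ((cum (xw (Suc N)) ^^ b) f)))"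
  define h where "h = (\<lambda>a. (cum (yw (Suc N)) ^^ a) (\<lambda>_. 1 :: rat))"
  define L where "L = (\<lambda>z f. (cum (xw (Suc N)) ^^ z) f N)"
  define R where "R = (\<lambda>a z. L z (eo_op N c (h a)))"
  have L: "linf (L z)" for z
    unfolding L_def by (rule linf_comp[OF linf_eval[of N] lin_funpow[OF lin_cum]])
  have lin: "lin (\<lambda>f. shl ?t (yw N) a (shl ?t (xw N) b f))" for a b
    by (rule lin_comp[OF lin_shl lin_shl])
  have Mlaw: "shl ?t (yw N) a (shl ?t (xw N) b f) = (\<lambda>j. M b a f j
      - (if 1 < a then ?t else 0) * M b (a - 1) f j - (if 1 < b then ?t else 0) * M (b - 1) a f j
      + (if b = 1 \<and> a = 1 then ?t\<^sup>2 else 0) * f j)" if "1 \<le> b" "1 \<le> a" for a b f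
  proof -
    have "M b a f = sh ((cum (yw N) ^^ a) ((cum (xw N) ^^ b) f))"
      unfolding M_def using that by (rule_tac eo_pair)
    moreover have "M b (a - 1) f = sh ((cum (yw N) ^^ (a - 1)) ((cum (xw N) ^^ b) f))" if "1 < a"
      unfolding M_def using that \<open>1 \<le> b\<close> by (intro eo_pair) auto
    moreover have "M (b - 1) a f = sh ((cum (yw N) ^^ a) ((cum (xw N) ^^ (b - 1)) f))" if "1 < b"
      unfolding M_def using that \<open>1 \<le> a\<close> by (intro eo_pair) auto
    ultimately show ?thesis
      by (subst shl_shl) (use that yw_xw[of N] in \<open>auto simp: fun_eq_iff\<close>)
  qed
  have Zb: "Zblock (Suc N) (a # l @ [z]) = L z (pfold M l (h a))" if "even (length l)" for a z l
  proof -
    have "sh (\<lambda>_. 1) = (\<lambda>_. 1)" by (simp add: fun_eq_iff sh_def)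
    thus ?thesis unfolding Zblock_def bval_regroup[OF that] L_def M_def h_def by simp
  qed
  have Q: "rsum oe_ok c (\<lambda>i j l. (-1) ^ j * ?t ^ (i + j) * Zblock (Suc N) (a # l @ [z])) = R a z" for a z
  proof -
    have "rsum oe_ok c (\<lambda>i j l. (-1) ^ j * ?t ^ (i + j) * Zblock (Suc N) (a # l @ [z])) =
       rsum oe_ok c (\<lambda>i j l. (-1) ^ j * ?t ^ (i + j) * L z (pfold M l (h a)))"
      by (rule rsum_cong) (use oe_ok_remdec[OF c] in \<open>simp add: Zb blocks_def\<close>)
    also have "\<dots> = R a z"
      unfolding R_def by (rule rsum_oe_pfold[OF c L lin Mlaw])
    finally show ?thesis .
  qed
  have Q1: "rsum oe_ok c (\<lambda>i j l. (-1) ^ Suc j * ?t ^ (i + Suc j) * Zblock (Suc N) (a # l @ [z])) = - ?t * R a z" for a z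
    unfolding Q[symmetric] rsum_scale[symmetric] by (simp add: algebra_simps)
  have Q2: "rsum oe_ok c (\<lambda>i j l. (-1) ^ Suc (Suc j) * ?t ^ (i + Suc (Suc j)) * Zblock (Suc N) (a # l @ [z])) = ?t\<^sup>2 * R a z" for a z
    unfolding Q[symmetric] rsum_scale[symmetric] by (simp add: algebra_simps power2_eq_square)
  define ta where "ta = (if 1 < a then ?t else 0)"
  define tz where "tz = (if 1 < z then ?t else 0)"
  have ev: "even (length c)" using c by (simp add: blocks_def)
  define g where "g = (\<lambda>j. h a j + (- ta) * h (a - 1) j)"
  have S: "R a y - ta * R (a - 1) y = L y (eo_op N c g)" for y
  proof -
    have "linf (\<lambda>f. L y (eo_op N c f))" by (rule linf_comp[OF L lin_pfold[OF lin]])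
    hence "L y (eo_op N c (\<lambda>j. 1 * h a j + (- ta) * h (a - 1) j)) =
        1 * L y (eo_op N c (h a)) + (- ta) * L y (eo_op N c (h (a - 1)))"
      unfolding linf_def by blast
    thus ?thesis unfolding R_def g_def by simp
  qed
  have "rsum eo_ok (a # c @ [z]) (\<lambda>i j l. (-1) ^ j * ?t ^ (i + j) * Zblock (Suc N) l)
     = R a z - tz * R a (z - 1) - ta * R (a - 1) z + ta * tz * R (a - 1) (z - 1)"
    unfolding rsum_eo[OF ev] Q Q1 Q2 ta_def tz_def by (auto simp: power2_eq_square)
  also have "\<dots> = (R a z - ta * R (a - 1) z) - tz * (R a (z - 1) - ta * R (a - 1) (z - 1))"
    by (simp add: algebra_simps)
  also have "\<dots> = shl ?t (xw N) z (eo_op N c g) N"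
    unfolding S L_def tz_def by (rule eo_last[OF z N])
  also have "\<dots> = shl ?t (xw N) z (eo_op N c (shl ?t (yw N) a (\<lambda>_. 1))) N"
  proof (intro shl_cong_pos eo_op_cong_pos c z)
    fix j :: nat assume "0 < j"
    thus "g j = shl ?t (yw N) a (\<lambda>_. 1) j"
      unfolding g_def h_def ta_def using eo_first[OF a, of j N] by simp
  qed (use N in simp_all)
  finally show ?thesis .
qed

text \<open>The bridge between the two levels. The odd-even side is a value at \<open>N - 1\<close>,
  hence its shift at \<open>N\<close>, and pushing that shift inwards gives the expression found for
  the even-odd side.\<close>

lemma rsum_eo_eq_oe:
  assumes c: "blocks c" "c \<noteq> []" and N: "1 \<le> N"
  shows "rsum eo_ok c (\<lambda>i j l. (-1) ^ j * (1 / of_nat N) ^ (i + j) * Zblock (Suc N) l)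
     = rsum oe_ok c (\<lambda>i j l. (-1) ^ j * (1 / of_nat N) ^ (i + j) * Zblock N l)"
proof -
  obtain a d where ad: "c = a # d" using c by (cases c) auto
  hence "d \<noteq> []" using c by auto
  then obtain d' z where d: "d = d' @ [z]" by (metis rev_exhaust)
  have b: "blocks d'" "1 \<le> a" "1 \<le> z" using c unfolding ad d by (auto simp: blocks_def)
  have ev: "even (length d')" using b by (simp add: blocks_def)
  have sh1: "sh (\<lambda>_. 1) = (\<lambda>_. 1)" by (simp add: fun_eq_iff sh_def)
  have "rsum oe_ok c (\<lambda>i j l. (-1) ^ j * (1 / of_nat N) ^ (i + j) * Zblock N l) = sh (oe_op N c (\<lambda>_. 1)) N"
    unfolding rsum_oe_Zblock[OF c(1)] sh_def ..
  also have "\<dots> = shl (1 / of_nat N) (xw N) z (eo_op N d' (shl (1 / of_nat N) (yw N) a (\<lambda>_. 1))) N"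
    unfolding ad d sh_oe_op[OF ev] sh1 ..
  also have "\<dots> = rsum eo_ok c (\<lambda>i j l. (-1) ^ j * (1 / of_nat N) ^ (i + j) * Zblock (Suc N) l)"
    unfolding ad d by (rule rsum_eo_Zblock[symmetric, OF b N])
  finally show ?thesis ..
qed

subsection \<open>Linear maps on noncommutative polynomials\<close>

declare Dfrak.simps [simp del]

lemma lookup_hscale [simp]: "Poly_Mapping.lookup (hscale a p) w = a * Poly_Mapping.lookup p w"
  unfolding hscale_def by (simp add: Poly_Mapping.map.rep_eq when_def)

lemma hscale_module: "module hscale"
  by unfold_locales (auto intro!: poly_mapping_eqI simp: lookup_add algebra_simps)

lemma keys_hscale: "Poly_Mapping.keys (hscale a p) \<subseteq> Poly_Mapping.keys p"
  by (auto simp: in_keys_iff)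

lemma Zd_superset:
  assumes "finite S" "Poly_Mapping.keys p \<subseteq> S"
  shows "Zd p N = (\<Sum>w\<in>S. Poly_Mapping.lookup p w * Zd_word w N)"
  unfolding Zd_def using assms by (intro sum.mono_neutral_left) (auto simp: in_keys_iff)

lemma Zd_0 [simp]: "Zd 0 N = 0"
  by (simp add: Zd_def)

lemma Zd_add [simp]: "Zd (p + q) N = Zd p N + Zd q N"
proof -
  let ?S = "Poly_Mapping.keys p \<union> Poly_Mapping.keys q"
  have "Poly_Mapping.keys (p + q) \<subseteq> ?S" by (rule keys_add)
  thus ?thesis
    by (simp add: Zd_superset[of ?S p] Zd_superset[of ?S q] Zd_superset[of ?S "p + q"]
        lookup_add algebra_simps sum.distrib)
qed

lemma Zd_hscale [simp]: "Zd (hscale a p) N = a * Zd p N"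
  unfolding Zd_superset[OF finite_keys keys_hscale] by (simp add: Zd_def sum_distrib_left mult.assoc)

lemma Zd_diff [simp]: "Zd (p - q) N = Zd p N - Zd q N"
  using Zd_add[of "p - q" q N] by simp

lemma Zd_sum: "Zd (sum f A) N = (\<Sum>x\<in>A. Zd (f x) N)"
  by (induction A rule: infinite_finite_induct) simp_all

lemma Zd_single [simp]: "Zd (Poly_Mapping.single w a) N = a * Zd_word w N"
  by (simp add: Zd_def)

lemma Zd_hrmul: "Zd (hrmul p u) N = (\<Sum>w\<in>Poly_Mapping.keys p. Poly_Mapping.lookup p w * Zd_word (w @ u) N)"
  by (simp add: hrmul_def Zd_sum)

lemma keys_hrmul: "Poly_Mapping.keys (hrmul p u) \<subseteq> (\<lambda>w. w @ u) ` Poly_Mapping.keys p"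
proof -
  have "Poly_Mapping.keys (hrmul p u) \<subseteq> (\<Union>w\<in>Poly_Mapping.keys p.
      Poly_Mapping.keys (Poly_Mapping.single (w @ u) (Poly_Mapping.lookup p w)))"
    unfolding hrmul_def by (rule keys_sum)
  also have "\<dots> \<subseteq> (\<lambda>w. w @ u) ` Poly_Mapping.keys p" by auto
  finally show ?thesis .
qed

subsection \<open>Truncated multiple zeta values without ones\<close>

text \<open>As for \<open>diam\<close>, the index is stored in reverse order; the summand at \<open>v = 0\<close> is \<open>1/0 = 0\<close>.\<close>

fun tz :: "nat list \<Rightarrow> nat \<Rightarrow> rat" where
  "tz [] m = 1"
| "tz (k # ks) m = (\<Sum>v<m. tz ks v / of_nat v ^ k)"

lemma diam_eq_tz:
  assumes "\<forall>k\<in>set ks. 2 \<le> k" "m \<le> N"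
  shows "diam N ks m = tz ks m"
  using assms
proof (induction ks arbitrary: m)
  case (Cons k ks)
  have "(\<Sum>v\<in>{v\<in>{1..N-1}. v < m}. diam N ks v / of_nat v ^ k) = (\<Sum>v<m. tz ks v / of_nat v ^ k)"
  proof (rule sum.mono_neutral_cong_left)
    show "\<forall>i\<in>{..<m} - {v \<in> {1..N - 1}. v < m}. tz ks i / of_nat i ^ k = 0"
      using Cons.prems by auto
    show "diam N ks x / of_nat x ^ k = tz ks x / of_nat x ^ k" if "x \<in> {v \<in> {1..N - 1}. v < m}" for x
      using Cons.IH[of x] Cons.prems that by auto
  qed (use Cons.prems in auto)
  thus ?case using Cons.prems by auto
qed simp

lemma Zd_word_ewords_tz: "\<forall>k\<in>set ks. 2 \<le> k \<Longrightarrow> Zd_word (ewords ks) N = tz (rev ks) N"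
  using Zd_word_ewords[of ks N] diam_eq_tz[of "rev ks" N N] by (force dest: bspec)

text \<open>The empty word is left out: appending a power of \<open>x\<close> to it would produce a
  word outside the admissible ones.\<close>

definition words2 :: "word set" where
  "words2 = {ewords ks | ks. ks \<noteq> [] \<and> (\<forall>k\<in>set ks. 2 \<le> k)}"

text \<open>The last exponent grows by \<open>m\<close>, so the one new summand, at
  \<open>v = N\<close>, is divided by \<open>N^m\<close>.\<close>

lemma words2_append_x:
  assumes "w \<in> words2"
  shows "w @ xpow m \<in> words2"
    "Zd_word (w @ xpow m) (Suc N) - Zd_word (w @ xpow m) N = (1 / of_nat N) ^ m * (Zd_word w (Suc N) - Zd_word w N)"
proof -
  obtain ks where ks: "ks \<noteq> []" "\<forall>k\<in>set ks. 2 \<le> k" "w = ewords ks" using assms by (auto simp: words2_def)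
  then obtain k ks' where k: "ks = ks' @ [k]" by (metis rev_exhaust)
  have 2: "\<forall>j\<in>set ks'. 2 \<le> j" "2 \<le> k" using ks k by auto
  have "k + m - 1 = (k - 1) + m" using 2 by simp
  hence w: "w @ xpow m = ewords (ks' @ [k + m])"
    by (simp only: ks(3) k ewords_snoc xpow_def replicate_add append_assoc append_Cons)
  show "w @ xpow m \<in> words2" unfolding w words2_def using 2
    by (intro CollectI exI[of _ "ks' @ [k + m]"]) auto
  have "Zd_word (w @ xpow m) M = tz ((k + m) # rev ks') M" for M
    unfolding w using 2 Zd_word_ewords_tz[of "ks' @ [k + m]" M] by simp
  moreover have "Zd_word w M = tz (k # rev ks') M" for M
    using ks(2) Zd_word_ewords_tz[of ks M] unfolding ks(3) k by simp
  ultimately show "Zd_word (w @ xpow m) (Suc N) - Zd_word (w @ xpow m) N = (1 / of_nat N) ^ m * (Zd_word w (Suc N) - Zd_word w N)"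
    by (simp add: power_add power_one_over)
qed

lemma words2_append_y:
  assumes "w = [] \<or> w \<in> words2" "2 \<le> m"
  shows "w @ Y # xpow (m - 1) \<in> words2"
    "Zd_word (w @ Y # xpow (m - 1)) (Suc N) - Zd_word (w @ Y # xpow (m - 1)) N = (1 / of_nat N) ^ m * Zd_word w N"
proof -
  obtain ks where ks: "\<forall>k\<in>set ks. 2 \<le> k" "w = ewords ks"
  proof (cases "w = []")
    case True
    thus thesis using that[of "[]"] by simp
  next
    case False
    thus thesis using assms that by (auto simp: words2_def)
  qed
  have w: "w @ Y # xpow (m - 1) = ewords (ks @ [m])"
    by (simp add: ks ewords_snoc xpow_def)
  show "w @ Y # xpow (m - 1) \<in> words2" unfolding w words2_def using ks assms
    by (intro CollectI exI[of _ "ks @ [m]"]) auto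
  have "Zd_word (w @ Y # xpow (m - 1)) M = tz (m # rev ks) M" for M
    unfolding w using ks assms Zd_word_ewords_tz[of "ks @ [m]" M] by simp
  moreover have "Zd_word w M = tz (rev ks) M" for M
    using ks Zd_word_ewords_tz by simp
  ultimately show "Zd_word (w @ Y # xpow (m - 1)) (Suc N) - Zd_word (w @ Y # xpow (m - 1)) N = (1 / of_nat N) ^ m * Zd_word w N"
    by (simp add: power_one_over)
qed

lemma words2_Zd_word_1: "w \<in> words2 \<Longrightarrow> Zd_word w 1 = 0"
proof -
  assume "w \<in> words2"
  then obtain ks where ks: "ks \<noteq> []" "\<forall>k\<in>set ks. 2 \<le> k" "w = ewords ks" by (auto simp: words2_def)
  then obtain k ks' where k: "rev ks = k # ks'" by (cases "rev ks") auto
  have "k \<in> set ks" using k by (metis list.set_intros(1) set_rev)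
  hence "2 \<le> k" using ks by auto
  thus ?thesis using Zd_word_ewords_tz[OF ks(2), of 1] ks(3) k by simp
qed

lemma Zd_hrmul_x:
  assumes "Poly_Mapping.keys p \<subseteq> words2"
  shows "Zd (hrmul p (xpow m)) (Suc N) - Zd (hrmul p (xpow m)) N = (1 / of_nat N) ^ m * (Zd p (Suc N) - Zd p N)"
proof -
  have "Zd (hrmul p (xpow m)) (Suc N) - Zd (hrmul p (xpow m)) N = (\<Sum>w\<in>Poly_Mapping.keys p.
      Poly_Mapping.lookup p w * (Zd_word (w @ xpow m) (Suc N) - Zd_word (w @ xpow m) N))"
    by (simp add: Zd_hrmul sum_subtractf right_diff_distrib)
  also have "\<dots> = (\<Sum>w\<in>Poly_Mapping.keys p. Poly_Mapping.lookup p w * ((1 / of_nat N) ^ m * (Zd_word w (Suc N) - Zd_word w N)))"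
    using assms by (intro sum.cong refl) (simp add: words2_append_x(2) subset_iff)
  finally show ?thesis by (simp add: Zd_def sum_subtractf sum_distrib_left algebra_simps)
qed

lemma Zd_hrmul_y:
  assumes "Poly_Mapping.keys p \<subseteq> insert [] words2" "2 \<le> m"
  shows "Zd (hrmul p (Y # xpow (m - 1))) (Suc N) - Zd (hrmul p (Y # xpow (m - 1))) N = (1 / of_nat N) ^ m * Zd p N"
proof -
  have "Zd (hrmul p (Y # xpow (m - 1))) (Suc N) - Zd (hrmul p (Y # xpow (m - 1))) N = (\<Sum>w\<in>Poly_Mapping.keys p.
      Poly_Mapping.lookup p w * (Zd_word (w @ Y # xpow (m - 1)) (Suc N) - Zd_word (w @ Y # xpow (m - 1)) N))"
    by (simp add: Zd_hrmul sum_subtractf right_diff_distrib)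
  also have "\<dots> = (\<Sum>w\<in>Poly_Mapping.keys p. Poly_Mapping.lookup p w * ((1 / of_nat N) ^ m * Zd_word w N))"
    using assms words2_append_y(2)[OF _ assms(2), of _ N] by (intro sum.cong refl) (auto simp: subset_iff)
  finally show ?thesis by (simp add: Zd_def sum_distrib_left algebra_simps)
qed

subsection \<open>The recursion for \<open>Dfrak\<close> preserves the diamond values\<close>

lemma rsum_0: "rsum ok c (\<lambda>_ _ _. 0) = 0"
  by (simp add: rsum_def)

text \<open>Failures are counted as in \<open>oe_ok_remdec\<close>. The result is nonempty because
  the end blocks are never removed; this lets \<open>Zd_hrmul_x\<close> apply to the terms with
  \<open>x\<close>.\<close>

lemma eo_ok_remdec:
  assumes c: "blocks c" "c \<noteq> []" and ok: "eo_ok c A B"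
  shows "blocks (remdec c A B)" "even (card A)" "remdec c A B \<noteq> []"
proof -
  obtain a d where ad: "c = a # d" using c by (cases c) auto
  hence "d \<noteq> []" using c by auto
  then obtain d' z where d: "d = d' @ [z]" by (metis rev_exhaust)
  have b: "blocks d'" "1 \<le> a" "1 \<le> z" using c unfolding ad d by (auto simp: blocks_def)
  have ev: "even (length d')" using b by (simp add: blocks_def)
  have "rsum oe_ok d' (\<lambda>i (j::nat) l. if even i \<and> blocks (x # l @ [y]) then 0 else (1::nat)) = 0" if "1 \<le> x" "1 \<le> y" for x y
  proof -
    have "rsum oe_ok d' (\<lambda>i (j::nat) l. if even i \<and> blocks (x # l @ [y]) then 0 else (1::nat)) =
       rsum oe_ok d' (\<lambda>i (j::nat) l. 0)"
      using oe_ok_remdec[OF b(1)] that by (intro rsum_cong) (auto simp: blocks_def)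
    thus ?thesis by (simp add: rsum_0)
  qed
  hence "rsum eo_ok c (\<lambda>i j l. if even i \<and> blocks l \<and> l \<noteq> [] then 0 else (1::nat)) = 0"
    unfolding ad d rsum_eo[OF ev] using b by (auto simp del: One_nat_def)
  moreover have "A \<in> Pow {1..length c}" "B \<in> Pow {1..length c}"
    using ok by (auto simp: eo_ok_def ones_def gtones_def)
  ultimately show "blocks (remdec c A B)" "even (card A)" "remdec c A B \<noteq> []"
    unfolding rsum_def using ok by (auto split: if_splits)
qed

text \<open>The lower bound on the size moves into the summand, so that all three sums of the
  recursion run over the full sets of admissible pairs.\<close>

lemma sum_filter_rsum:
  "(\<Sum>A\<in>{A. A \<subseteq> ones c \<and> E A}. \<Sum>B\<in>{B. B \<subseteq> gtones c \<and> k \<le> card A + card B \<and> P B}. F (card A) (card B) (remdec c A B))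
    = rsum (\<lambda>c A B. A \<subseteq> ones c \<and> E A \<and> B \<subseteq> gtones c \<and> P B) c (\<lambda>i j l. if k \<le> i + j then F i j l else 0)"
proof -
  have sub: "ones c \<subseteq> {1..length c}" "gtones c \<subseteq> {1..length c}" by (auto simp: ones_def gtones_def)
  let ?G = "\<lambda>A. \<Sum>B\<in>Pow {1..length c}. if A \<subseteq> ones c \<and> E A \<and> B \<subseteq> gtones c \<and> P B then
        if k \<le> card A + card B then F (card A) (card B) (remdec c A B) else 0 else 0"
  have 1: "(\<Sum>B\<in>{B. B \<subseteq> gtones c \<and> k \<le> card A + card B \<and> P B}. F (card A) (card B) (remdec c A B)) = ?G A"
    if "A \<in> {A. A \<subseteq> ones c \<and> E A}" for A
    using sub that by (intro sum.mono_neutral_cong_left) auto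
  have 2: "\<forall>A\<in>Pow {1..length c} - {A. A \<subseteq> ones c \<and> E A}. ?G A = 0"
  proof
    fix A assume "A \<in> Pow {1..length c} - {A. A \<subseteq> ones c \<and> E A}"
    hence n: "\<not> (A \<subseteq> ones c \<and> E A)" by blast
    show "?G A = 0" by (rule sum.neutral) (use n in auto)
  qed
  have 3: "{A. A \<subseteq> ones c \<and> E A} \<subseteq> Pow {1..length c}" using sub(1) by blast
  show ?thesis unfolding rsum_def by (rule sum.mono_neutral_cong_left[OF _ 3 2 1]) simp_all
qed

lemma rsum_cong_ok:
  "(\<And>A B. ok c A B \<longleftrightarrow> ok' c A B) \<Longrightarrow> rsum ok c F = rsum ok' c F"
  unfolding rsum_def by simp

definition dterm_x :: "nat \<Rightarrow> nat \<Rightarrow> nat list \<Rightarrow> hpoly" where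
  "dterm_x i j l = (if 1 \<le> i + j then hscale ((-1) ^ (j + 1)) (hrmul (Dfrak l) (xpow (i + j))) else 0)"

definition dterm_y :: "nat \<Rightarrow> nat \<Rightarrow> nat \<Rightarrow> nat list \<Rightarrow> hpoly" where
  "dterm_y e i j l = (if 2 \<le> i + j then hscale ((-1) ^ (j + e)) (hrmul (Dfrak l) (Y # xpow (i + j - 1))) else 0)"

lemma Dfrak_rsum:
  assumes "c \<noteq> []"
  shows "Dfrak c = rsum eo_ok c dterm_x + rsum eo_ok c (dterm_y 1) + rsum oe_ok c (dterm_y 0)"
proof -
  have "Dfrak c = rsum (\<lambda>c' A B. A \<subseteq> ones c' \<and> even_odd A \<and> B \<subseteq> gtones c' \<and> (\<forall>r\<in>{1..length c div 2 - 1}. \<not> {2*r, 2*r+1} \<subseteq> B)) c dterm_x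
     + rsum (\<lambda>c' A B. A \<subseteq> ones c' \<and> even_odd A \<and> B \<subseteq> gtones c' \<and> (\<forall>r\<in>{1..length c div 2 - 1}. \<not> {2*r, 2*r+1} \<subseteq> B)) c (dterm_y 1)
     + rsum (\<lambda>c' A B. A \<subseteq> ones c' \<and> odd_even A \<and> B \<subseteq> gtones c' \<and> (\<forall>r\<in>{1..length c div 2}. \<not> {2*r-1, 2*r} \<subseteq> B)) c (dterm_y 0)"
    unfolding dterm_x_def[abs_def] dterm_y_def[abs_def] sum_filter_rsum[symmetric]
    by (subst Dfrak.simps) (simp add: assms Let_def)
  also have "\<dots> = rsum eo_ok c dterm_x + rsum eo_ok c (dterm_y 1) + rsum oe_ok c (dterm_y 0)"
    by (intro arg_cong2[of _ _ _ _ "(+)"] rsum_cong_ok) (simp_all add: eo_ok_def oe_ok_def)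
  finally show ?thesis .
qed

lemma Dfrak_Nil [simp]: "Dfrak [] = hword []"
  by (simp add: Dfrak.simps)

lemma keys_rsum:
  assumes "\<And>A B. ok c A B \<Longrightarrow> Poly_Mapping.keys (F (card A) (card B) (remdec c A B)) \<subseteq> S"
  shows "Poly_Mapping.keys (rsum ok c F) \<subseteq> S"
  unfolding rsum_def using assms
  by (intro order.trans[OF keys_sum] UN_least) auto

lemma Zd_rsum: "Zd (rsum ok c F) N = rsum ok c (\<lambda>i j l. Zd (F i j l) N)"
  unfolding rsum_def Zd_sum by (intro sum.cong refl) auto

lemma ok_remdec_less:
  "eo_ok c A B \<Longrightarrow> 1 \<le> card A + card B \<Longrightarrow> sum_list (remdec c A B) < sum_list c"
  "oe_ok c A B \<Longrightarrow> 1 \<le> card A + card B \<Longrightarrow> sum_list (remdec c A B) < sum_list c"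
  by (auto simp: eo_ok_def oe_ok_def intro: remdec_sum_less)

lemma keys_Dfrak:
  assumes "blocks c"
  shows "Poly_Mapping.keys (Dfrak c) \<subseteq> insert [] words2" "c \<noteq> [] \<Longrightarrow> Poly_Mapping.keys (Dfrak c) \<subseteq> words2"
proof -
  \<comment> \<open>The induction must separate the empty list, since terms with \<open>x\<close>
    stay in \<open>words2\<close> only if the recursive value has no constant term.\<close>
  have "if c = [] then Poly_Mapping.keys (Dfrak c) \<subseteq> {[]} else Poly_Mapping.keys (Dfrak c) \<subseteq> words2"
    using assms
  proof (induction c rule: measure_induct_rule[of sum_list])
    case (less c)
    show ?case
    proof (cases "c = []")
      case False
      have eo: "Poly_Mapping.keys (Dfrak (remdec c A B)) \<subseteq> words2" if "eo_ok c A B" "1 \<le> card A + card B" for A B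
        using less.IH[OF ok_remdec_less(1)[OF that]] eo_ok_remdec[OF less.prems False that(1)] by simp
      have oe: "Poly_Mapping.keys (Dfrak (remdec c A B)) \<subseteq> insert [] words2" if "oe_ok c A B" "1 \<le> card A + card B" for A B
        using less.IH[OF ok_remdec_less(2)[OF that]] oe_ok_remdec[OF less.prems that(1)]
        by (auto split: if_splits)
      have x: "Poly_Mapping.keys (hscale a (hrmul p (xpow m))) \<subseteq> words2" if "Poly_Mapping.keys p \<subseteq> words2" for a p m
        using keys_hscale[of a "hrmul p (xpow m)"] keys_hrmul[of p "xpow m"] that words2_append_x(1) by blast
      have y: "Poly_Mapping.keys (hscale a (hrmul p (Y # xpow (m - 1)))) \<subseteq> words2"
        if "Poly_Mapping.keys p \<subseteq> insert [] words2" "2 \<le> m" for a p m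
        using keys_hscale[of a "hrmul p (Y # xpow (m - 1))"] keys_hrmul[of p "Y # xpow (m - 1)"] that words2_append_y(1) by blast
      have "Poly_Mapping.keys (rsum eo_ok c dterm_x) \<subseteq> words2"
      proof (rule keys_rsum)
        fix A B assume ok: "eo_ok c A B"
        show "Poly_Mapping.keys (dterm_x (card A) (card B) (remdec c A B)) \<subseteq> words2"
          using x[OF eo[OF ok]] by (cases "1 \<le> card A + card B") (simp_all add: dterm_x_def)
      qed
      moreover have "Poly_Mapping.keys (rsum eo_ok c (dterm_y 1)) \<subseteq> words2"
      proof (rule keys_rsum)
        fix A B assume ok: "eo_ok c A B"
        show "Poly_Mapping.keys (dterm_y 1 (card A) (card B) (remdec c A B)) \<subseteq> words2"
          using y[OF subset_insertI2[OF eo[OF ok]]]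
          by (cases "2 \<le> card A + card B") (simp_all add: dterm_y_def)
      qed
      moreover have "Poly_Mapping.keys (rsum oe_ok c (dterm_y 0)) \<subseteq> words2"
      proof (rule keys_rsum)
        fix A B assume ok: "oe_ok c A B"
        show "Poly_Mapping.keys (dterm_y 0 (card A) (card B) (remdec c A B)) \<subseteq> words2"
          using y[OF oe[OF ok]]
          by (cases "2 \<le> card A + card B") (simp_all add: dterm_y_def)
      qed
      ultimately show ?thesis
        unfolding Dfrak_rsum[OF False] if_not_P[OF False]
        by (intro order.trans[OF keys_add] Un_least)
    qed (simp add: hword_def)
  qed
  thus "Poly_Mapping.keys (Dfrak c) \<subseteq> insert [] words2" "c \<noteq> [] \<Longrightarrow> Poly_Mapping.keys (Dfrak c) \<subseteq> words2"
    by (auto split: if_splits)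
qed

lemma remdec_empty [simp]: "remdec c {} {} = c"
  unfolding remdec_def by (rule nth_equalityI) (auto simp del: upt_Suc)

lemma rsum_zero_term:
  assumes "ok c {} {}"
  shows "rsum ok c (\<lambda>i j l. if i + j = 0 then F l else 0) = F c"
proof -
  have "rsum ok c (\<lambda>i j l. if i + j = 0 then F l else 0) =
     (\<Sum>A\<in>Pow {1..length c}. \<Sum>B\<in>Pow {1..length c}. if B = {} then if A = {} then F c else 0 else 0)"
    unfolding rsum_def using assms by (intro sum.cong refl) (auto dest: finite_subset simp: card_eq_0_iff)
  thus ?thesis by (simp add: sum.delta)
qed

text \<open>Positions are removed in pairs, so size one means that \<open>A\<close> is empty and
  \<open>B\<close> a singleton, for which both conditions hold alike.\<close>

lemma rsum_one_term:
  assumes "blocks c" "c \<noteq> []"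
  shows "rsum eo_ok c (\<lambda>i j l. if i + j = 1 then F i j l else 0) = rsum oe_ok c (\<lambda>i j l. if i + j = 1 then F i j l else 0)"
proof -
  have "eo_ok c A B \<longleftrightarrow> oe_ok c A B" if AB: "A \<in> Pow {1..length c}" "B \<in> Pow {1..length c}" "card A + card B = 1" for A B
  proof (cases "card A = 0")
    case True
    hence A: "A = {}" using AB finite_subset by (auto simp: card_eq_0_iff)
    have "card B = 1" using AB True by simp
    then obtain b where "B = {b}" by (auto simp: card_1_singleton_iff)
    thus ?thesis using A by (auto simp: eo_ok_def oe_ok_def even_odd_def odd_even_def)
  next
    case False
    hence "card A = 1" using AB by linarith
    hence "odd (card A)" by simp
    thus ?thesis using eo_ok_remdec(2)[OF assms] oe_ok_remdec(2)[OF assms(1)] by blast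
  qed
  thus ?thesis unfolding rsum_def by (intro sum.cong refl) auto
qed

lemma rsum_diff:
  "rsum ok c (\<lambda>i j l. F i j l - G i j l) = rsum ok c F - (rsum ok c G :: rat)"
  unfolding rsum_def sum_subtractf[symmetric] by (intro sum.cong refl) auto

lemma rsum_add:
  "rsum ok c (\<lambda>i j l. F i j l + G i j l) = rsum ok c F + (rsum ok c G :: rat)"
  unfolding rsum_def sum.distrib[symmetric] by (intro sum.cong refl) auto

lemma rsum_split:
  assumes "ok c {} {}"
  shows "rsum ok c F = F 0 0 c + rsum ok c (\<lambda>i j l. if i + j = 1 then F i j l else 0)
     + (rsum ok c (\<lambda>i j l. if 2 \<le> i + j then F i j l else 0) :: rat)"
proof -
  have "rsum ok c F = rsum ok c (\<lambda>i j l. (if i + j = 0 then F 0 0 l else 0) + (if i + j = 1 then F i j l else 0)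
     + (if 2 \<le> i + j then F i j l else 0))"
    by (rule arg_cong[of _ _ "rsum ok c"]) (auto simp: fun_eq_iff)
  thus ?thesis unfolding rsum_add rsum_zero_term[of ok c "F 0 0", OF assms] .
qed

lemma Zblock_1: "blocks c \<Longrightarrow> c \<noteq> [] \<Longrightarrow> Zblock 1 c = 0"
proof -
  have "bval N c f 0 = 0" if "blocks c" "c \<noteq> []" for N f
    using that
  proof (induction c arbitrary: f rule: blocks_induct)
    case (Cons2 a b c)
    then obtain b' where "b = Suc b'" by (cases b) auto
    thus ?case using Cons2 by (cases "c = []") simp_all
  qed simp
  thus "blocks c \<Longrightarrow> c \<noteq> [] \<Longrightarrow> Zblock 1 c = 0" by (simp add: Zblock_def)
qed

text \<open>Both sides vanish at \<open>N = 1\<close> for nonempty \<open>c\<close>, so it is enough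
  to compare increments in \<open>N\<close>.\<close>

lemma Zd_Dfrak:
  assumes "blocks c" "1 \<le> N"
  shows "Zd (Dfrak c) N = Zblock N c"
  using assms
proof (induction c arbitrary: N rule: measure_induct_rule[of sum_list])
  case (less c)
  show ?case
  proof (cases "c = []")
    case True
    thus ?thesis by (simp add: hword_def Zblock_def)
  next
    case False
    note b = less.prems(1)
    have stp: "Zd (Dfrak c) (Suc N) - Zd (Dfrak c) N = Zblock (Suc N) c - Zblock N c" if N: "1 \<le> N" for N
    proof -
      let ?t = "1 / of_nat N :: rat"
      let ?Z = "\<lambda>M i j l. (-1) ^ j * ?t ^ (i + j) * Zblock M l"
      let ?E1 = "\<lambda>M. rsum eo_ok c (\<lambda>i j l. if i + j = 1 then ?Z M i j l else 0)"
      let ?E2 = "\<lambda>M. rsum eo_ok c (\<lambda>i j l. if 2 \<le> i + j then ?Z M i j l else 0)"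
      let ?O2 = "rsum oe_ok c (\<lambda>i j l. if 2 \<le> i + j then ?Z N i j l else 0)"
      have IHe: "Zd (Dfrak (remdec c A B)) M = Zblock M (remdec c A B)"
        if "eo_ok c A B" "1 \<le> card A + card B" "1 \<le> M" for A B M
        using less.IH[OF ok_remdec_less(1)[OF that(1,2)] eo_ok_remdec(1)[OF b False that(1)] that(3)] .
      have IHo: "Zd (Dfrak (remdec c A B)) M = Zblock M (remdec c A B)"
        if "oe_ok c A B" "1 \<le> card A + card B" "1 \<le> M" for A B M
        using less.IH[OF ok_remdec_less(2)[OF that(1,2)] oe_ok_remdec(1)[OF b that(1)] that(3)] .
      have "rsum eo_ok c (\<lambda>i j l. Zd (dterm_x i j l) (Suc N) - Zd (dterm_x i j l) N) =
         rsum eo_ok c (\<lambda>i j l. (if i + j = 1 then ?Z N i j l else 0) - (if i + j = 1 then ?Z (Suc N) i j l else 0)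
           + ((if 2 \<le> i + j then ?Z N i j l else 0) - (if 2 \<le> i + j then ?Z (Suc N) i j l else 0)))"
      proof (rule rsum_cong)
        fix A B assume ok: "eo_ok c A B"
        let ?m = "card A + card B" and ?l = "remdec c A B"
        show "Zd (dterm_x (card A) (card B) ?l) (Suc N) - Zd (dterm_x (card A) (card B) ?l) N =
          (if ?m = 1 then ?Z N (card A) (card B) ?l else 0) - (if ?m = 1 then ?Z (Suc N) (card A) (card B) ?l else 0)
           + ((if 2 \<le> ?m then ?Z N (card A) (card B) ?l else 0) - (if 2 \<le> ?m then ?Z (Suc N) (card A) (card B) ?l else 0))"
        proof (cases "1 \<le> ?m")
          case True
          have "Zd (dterm_x (card A) (card B) ?l) (Suc N) - Zd (dterm_x (card A) (card B) ?l) N =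
             (-1) ^ (card B + 1) * (Zd (hrmul (Dfrak ?l) (xpow ?m)) (Suc N) - Zd (hrmul (Dfrak ?l) (xpow ?m)) N)"
            using True by (simp add: dterm_x_def algebra_simps)
          also have "\<dots> = (-1) ^ (card B + 1) * (?t ^ ?m * (Zblock (Suc N) ?l - Zblock N ?l))"
            unfolding Zd_hrmul_x[OF keys_Dfrak(2)[OF eo_ok_remdec(1,3)[OF b False ok]]]
            using IHe[OF ok True] N by simp
          finally show ?thesis using True by (auto simp: algebra_simps)
        qed (auto simp: dterm_x_def)
      qed
      hence x: "Zd (rsum eo_ok c dterm_x) (Suc N) - Zd (rsum eo_ok c dterm_x) N = ?E1 N - ?E1 (Suc N) + (?E2 N - ?E2 (Suc N))"
        unfolding Zd_rsum rsum_diff rsum_add .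
      have y: "Zd (dterm_y e (card A) (card B) l) (Suc N) - Zd (dterm_y e (card A) (card B) l) N =
          (-1) ^ e * (if 2 \<le> card A + card B then ?Z N (card A) (card B) l else 0)"
        if "blocks l" "1 \<le> card A + card B \<Longrightarrow> Zd (Dfrak l) N = Zblock N l" for l e and A B :: "nat set"
      proof (cases "2 \<le> card A + card B")
        case True
        have "Zd (dterm_y e (card A) (card B) l) (Suc N) - Zd (dterm_y e (card A) (card B) l) N =
           (-1) ^ (card B + e) * (Zd (hrmul (Dfrak l) (Y # xpow (card A + card B - 1))) (Suc N)
             - Zd (hrmul (Dfrak l) (Y # xpow (card A + card B - 1))) N)"
          using True by (simp add: dterm_y_def algebra_simps)
        also have "\<dots> = (-1) ^ (card B + e) * (?t ^ (card A + card B) * Zblock N l)"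
          unfolding Zd_hrmul_y[OF keys_Dfrak(1)[OF that(1)] True] using that(2) True by simp
        finally show ?thesis using True by (simp add: power_add algebra_simps)
      qed (auto simp: dterm_y_def)
      have "rsum eo_ok c (\<lambda>i j l. Zd (dterm_y 1 i j l) (Suc N) - Zd (dterm_y 1 i j l) N) =
         rsum eo_ok c (\<lambda>i j l. (-1) ^ 1 * (if 2 \<le> i + j then ?Z N i j l else 0))"
        by (rule rsum_cong, rule y) (use eo_ok_remdec(1)[OF b False] IHe N in auto)
      hence y1: "Zd (rsum eo_ok c (dterm_y 1)) (Suc N) - Zd (rsum eo_ok c (dterm_y 1)) N = - ?E2 N"
        unfolding Zd_rsum rsum_diff rsum_scale by simp
      have "rsum oe_ok c (\<lambda>i j l. Zd (dterm_y 0 i j l) (Suc N) - Zd (dterm_y 0 i j l) N) =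
         rsum oe_ok c (\<lambda>i j l. (-1) ^ 0 * (if 2 \<le> i + j then ?Z N i j l else 0))"
        by (rule rsum_cong, rule y) (use oe_ok_remdec(1)[OF b] IHo N in auto)
      hence y2: "Zd (rsum oe_ok c (dterm_y 0)) (Suc N) - Zd (rsum oe_ok c (dterm_y 0)) N = ?O2"
        unfolding Zd_rsum rsum_diff rsum_scale by simp
      have ok: "eo_ok c {} {}" "oe_ok c {} {}" by (auto simp: eo_ok_def oe_ok_def even_odd_def odd_even_def)
      \<comment> \<open>The two-level identity sorted by size: size zero is \<open>c\<close> itself,
        and the size-one terms are the same for both index sets. Solved for the increment of
        \<open>Zblock\<close>, it is the sum of \<open>x\<close>, \<open>y1\<close> and
        \<open>y2\<close>, where \<open>?E2 N\<close> has cancelled.\<close>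
      have "Zblock (Suc N) c + ?E1 (Suc N) + ?E2 (Suc N) = Zblock N c + ?E1 N + ?O2"
        using rsum_eo_eq_oe[OF b False N]
        unfolding rsum_split[of eo_ok c "?Z (Suc N)", OF ok(1)] rsum_split[of oe_ok c "?Z N", OF ok(2)]
          rsum_one_term[OF b False, of "?Z N"] by simp
      thus ?thesis
        unfolding Dfrak_rsum[OF False] using x y1 y2 by simp
    qed
    have bas: "Zd (Dfrak c) 1 = 0"
      unfolding Zd_def using keys_Dfrak(2)[OF b False] words2_Zd_word_1 by (intro sum.neutral) auto
    show ?thesis using less.prems(2)
    proof (induction N rule: dec_induct)
      case base
      show ?case using bas Zblock_1[OF b False] by simp
    next
      case (step n)
      thus ?case using stp[of n] by simp
    qed
  qed
qed

subsection \<open>Linear independence of the truncated multiple zeta values\<close>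

abbreviation shift :: "rat poly \<Rightarrow> rat poly" where
  "shift p \<equiv> pcompose p [:1, 1:]"

lemma poly_shift [simp]: "poly (shift p) x = poly p (x + 1)"
  by (simp add: poly_pcompose add.commute)

lemma poly_eq_0_if_eventually_0:
  fixes p :: "rat poly"
  assumes "\<And>n. N \<le> n \<Longrightarrow> poly p (of_nat n) = 0"
  shows "p = 0"
proof (rule ccontr)
  assume "p \<noteq> 0"
  hence "finite {x. poly p x = 0}" by (rule poly_roots_finite)
  moreover have "of_nat ` {N..} \<subseteq> {x. poly p x = 0}" using assms by auto
  ultimately have "finite ((of_nat :: nat \<Rightarrow> rat) ` {N..})" by (rule finite_subset[rotated])
  hence "finite {N..}" by (rule finite_imageD) (simp add: inj_on_def)
  thus False by (simp add: infinite_Ici)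
qed

text \<open>If \<open>A/B\<close> is in lowest terms, then every integer pole \<open>j \<noteq> 0\<close> of the difference equation
  \<open>Q(x+1) - Q(x) = -s(x)/x\<^sup>K\<close> propagates, so \<open>Q\<close> has no pole at \<open>0\<close> or \<open>1\<close>, while the right-hand
  side has a pole at \<open>0\<close>.\<close>

lemma no_rational_telescoping_coprime:
  fixes A B s :: "rat poly"
  assumes "coprime A B" "B \<noteq> 0" "1 \<le> K" "poly s 0 \<noteq> 0"
    and eq: "\<And>x. (poly A (x + 1) * poly B x - poly A x * poly B (x + 1)) * x ^ K = - poly s x * poly B x * poly B (x + 1)"
  shows False
proof -
  have cop: "poly A j \<noteq> 0" if "poly B j = 0" for j
  proof
    assume "poly A j = 0"
    hence "[:-j, 1:] dvd A" "[:-j, 1:] dvd B" using that by (simp_all add: poly_eq_0_iff_dvd)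
    hence "is_unit [:-j, 1:]" using assms(1) by (rule_tac coprime_common_divisor)
    thus False by (auto simp: is_unit_poly_iff)
  qed
  have fwd: "poly B (j + 1) = 0" if "j \<noteq> 0" "poly B j = 0" for j
    using eq[of j] cop[of j] that by simp
  have bwd: "poly B j = 0" if "j \<noteq> 0" "poly B (j + 1) = 0" for j
    using eq[of j] cop[of "j + 1"] that by simp
  have "poly B 1 \<noteq> 0"
  proof
    assume 1: "poly B 1 = 0"
    have "poly B (of_nat n) = 0" if "1 \<le> n" for n
      using that
    proof (induction n rule: dec_induct)
      case (step n)
      thus ?case using fwd[of "of_nat n"] by (simp add: add.commute)
    qed (simp add: 1)
    hence "B = 0" by (rule poly_eq_0_if_eventually_0)
    thus False using assms by simp
  qed
  moreover have "poly B 0 \<noteq> 0"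
  proof
    assume 0: "poly B 0 = 0"
    \<comment> \<open>Reflection turns the zeros at 0, -1, -2, ... into zeros at the natural
      numbers.\<close>
    have "poly (pcompose B [:0, -1:]) (of_nat n) = 0" for n
    proof (induction n)
      case (Suc n)
      have "- of_nat (Suc n) + 1 = (- of_nat n :: rat)" by simp
      moreover have "- of_nat (Suc n) \<noteq> (0::rat)" by (simp del: of_nat_Suc)
      ultimately show ?case using Suc bwd[of "- of_nat (Suc n)"] by (simp add: poly_pcompose)
    qed (simp add: poly_pcompose 0)
    hence "pcompose B [:0, -1:] = 0" by (rule poly_eq_0_if_eventually_0)
    hence "B = 0" by (simp add: pcompose_eq_0_iff)
    thus False using assms by simp
  qed
  moreover have zero: "(0::rat) ^ K = 0" using assms(3) by (cases K) auto
  have "- poly s 0 * poly B 0 * poly B (0 + 1) = 0"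
    using eq[of 0] unfolding zero by (simp only: mult_zero_right)
  ultimately show False using assms(4) by simp
qed

text \<open>This is the difference equation for \<open>A/B\<close> with denominators cleared. A
  common divisor \<open>g\<close> enters only as the factor \<open>g * shift g\<close>, so lowest
  terms may be assumed.\<close>

lemma no_rational_telescoping:
  fixes A B s :: "rat poly"
  assumes "B \<noteq> 0" "1 \<le> K" "poly s 0 \<noteq> 0"
  shows "[:0, 1:] ^ K * (B * shift A - shift B * A) + B * shift B * s \<noteq> 0"
proof
  assume eq: "[:0, 1:] ^ K * (B * shift A - shift B * A) + B * shift B * s = 0"
  define g where "g = gcd A B"
  obtain a b where ab: "A = g * a" "B = g * b" "coprime a b"
    using gcd_coprime_exists[of A B] assms(1) unfolding g_def by (auto simp: mult.commute)
  have g0: "g \<noteq> 0" "b \<noteq> 0" using assms(1) ab by auto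
  have "shift g \<noteq> 0" using g0(1) by (simp add: pcompose_eq_0_iff)
  moreover have "g * shift g * ([:0, 1:] ^ K * (b * shift a - shift b * a) + b * shift b * s) = 0"
    using eq unfolding ab(1,2) pcompose_mult by (simp add: algebra_simps)
  ultimately have "[:0, 1:] ^ K * (b * shift a - shift b * a) + b * shift b * s = 0"
    using g0(1) by simp
  hence *: "poly ([:0, 1:] ^ K * (b * shift a - shift b * a) + b * shift b * s) x = 0" for x by simp
  have "(poly a (x + 1) * poly b x - poly a x * poly b (x + 1)) * x ^ K = - poly s x * poly b x * poly b (x + 1)" for x
    using *[of x] by (simp add: algebra_simps)
  thus False using no_rational_telescoping_coprime[OF ab(3) g0(2) assms(2,3)] by blast
qed

text \<open>Beyond the natural roots of \<open>p\<close> the quotient \<open>q/p\<close> takes equal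
  values at consecutive integers, hence one value infinitely often.\<close>

lemma periodic_ratio_const:
  fixes p q :: "rat poly"
  assumes "p \<noteq> 0" "p * shift q = shift p * q"
  shows "\<exists>c. q = smult c p"
proof -
  have "finite {x. poly p x = 0}" using assms(1) by (rule poly_roots_finite)
  hence "finite {n. poly p (of_nat n) = 0}"
    using finite_vimageI[of "{x. poly p x = 0}" "of_nat :: nat \<Rightarrow> rat"] by (simp add: vimage_def inj_on_def)
  then obtain M where M: "\<forall>n\<in>{n. poly p (of_nat n) = 0}. n < M" using finite_nat_set_iff_bounded by blast
  have nz: "poly p (of_nat n) \<noteq> 0" if "M \<le> n" for n using M that by (auto simp: not_less[symmetric])
  define c where "c = poly q (of_nat M) / poly p (of_nat M)"
  have "poly q (of_nat n) = c * poly p (of_nat n)" if "M \<le> n" for n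
    using that
  proof (induction n rule: dec_induct)
    case base
    thus ?case using nz[of M] by (simp add: c_def)
  next
    case (step n)
    have "poly (p * shift q) (of_nat n) = poly (shift p * q) (of_nat n)" unfolding assms(2) ..
    hence "poly p (of_nat n) * poly q (of_nat (Suc n)) = poly p (of_nat (Suc n)) * (c * poly p (of_nat n))"
      using step.IH by (simp add: add.commute)
    thus ?case using nz[OF step.hyps(1)] by simp
  qed
  hence "q - smult c p = 0" by (intro poly_eq_0_if_eventually_0[of M]) simp
  thus ?thesis by auto
qed

section \<open>Elimination in linear relations with polynomial coefficients\<close>

lemma tz_Suc:
  "tz ks (Suc N) = tz ks N + (case ks of [] \<Rightarrow> 0 | k # l \<Rightarrow> tz l N / of_nat N ^ k)"
  by (cases ks) simp_all

text \<open>Closure under tails keeps increments inside \<open>T\<close>. For a longest index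
  \<open>m\<close>, the relations at \<open>N\<close> and \<open>N + 1\<close> are combined so that
  \<open>m\<close> drops out, and induction makes all new coefficients zero. Hence indices sharing
  the tail of \<open>m\<close> have constant multiples of \<open>P m\<close> as coefficients, and
  the coefficient at that tail yields a forbidden telescoping equation.\<close>

lemma tz_independent:
  assumes "finite T" "\<And>k ks. k # ks \<in> T \<Longrightarrow> ks \<in> T \<and> 1 \<le> k"
    and "\<And>N. 1 \<le> N \<Longrightarrow> (\<Sum>ks\<in>T. poly (P ks) (of_nat N) * tz ks N) = 0"
  shows "\<forall>ks\<in>T. P ks = 0"
  using assms
proof (induction "card T" arbitrary: T P)
  case 0
  thus ?case by simp
next
  case (Suc n)
  note fin = Suc.prems(1) and closed = Suc.prems(2) and rel = Suc.prems(3)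
  have "T \<noteq> {}" using Suc.hyps(2) by auto
  hence "Max (length ` T) \<in> length ` T" using fin by (intro Max_in) auto
  then obtain m where m: "m \<in> T" "length m = Max (length ` T)" by force
  hence m: "m \<in> T" "\<And>ks. ks \<in> T \<Longrightarrow> length ks \<le> length m" using fin by auto
  let ?T = "T - {m}"
  have card: "n = card ?T" using Suc.hyps(2) m(1) fin by simp
  have closed': "ks \<in> ?T \<and> 1 \<le> k" if "k # ks \<in> ?T" for k ks
    using closed[of k ks] m(2)[of "k # ks"] that by auto
  have reduce: "\<forall>ks\<in>?T. Q ks = 0"
    if "\<And>N. 1 \<le> N \<Longrightarrow> (\<Sum>ks\<in>T. poly (Q ks) (of_nat N) * tz ks N) = 0" "Q m = 0" for Q
  proof (rule Suc.hyps(1)[OF card])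
    show "finite ?T" using fin by simp
    show "ks \<in> ?T \<and> 1 \<le> k" if "k # ks \<in> ?T" for k ks using closed'[OF that] .
    show "(\<Sum>ks\<in>?T. poly (Q ks) (of_nat N) * tz ks N) = 0" if "1 \<le> N" for N
      using \<open>\<And>N. 1 \<le> N \<Longrightarrow> (\<Sum>ks\<in>T. poly (Q ks) (of_nat N) * tz ks N) = 0\<close>[OF that] \<open>Q m = 0\<close> m(1) fin
      by (simp add: sum.remove)
  qed
  have "P m = 0"
  proof (rule ccontr)
    assume p0: "P m \<noteq> 0"
    define p where "p = P m"
    show False
    proof (cases m)
      case Nil
      hence "ks = []" if "ks \<in> T" for ks using m(2)[OF that] by simp
      hence "T = {[]}" using m(1) Nil by blast
      hence "poly p (of_nat N) = 0" if "1 \<le> N" for N using rel[OF that] Nil by (simp add: p_def)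
      thus False using poly_eq_0_if_eventually_0[of 1 p] p0 by (simp add: p_def)
    next
      case (Cons k0 l)
      have lT: "l \<in> ?T" using closed[of k0 l] m(1) Cons by auto
      obtain K where K: "\<And>k ks. k # ks \<in> T \<Longrightarrow> k \<le> K"
      proof -
        have "k \<le> Max (hd ` T)" if "k # ks \<in> T" for k ks
          using fin that by (intro Max_ge) (auto intro: image_eqI[of _ _ "k # ks"])
        thus thesis using that by blast
      qed
      define Ks where "Ks = (\<lambda>ks. {k. k # ks \<in> T})"
      have finK: "finite (Ks ks)" for ks
      proof -
        have "Ks ks \<subseteq> {..K}" unfolding Ks_def using K by blast
        thus ?thesis by (rule finite_subset) simp
      qed
      \<comment> \<open>Coefficients of \<open>p(N)\<close> times the relation at
        \<open>N + 1\<close> minus \<open>p(N+1)\<close> times the relation at \<open>N\<close>. The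
        last sum collects increments of the extensions \<open>k # ks\<close>; the factor
        \<open>N^K\<close> clears their denominators.\<close>
      define Q where "Q = (\<lambda>ks. [:0, 1:] ^ K * (p * shift (P ks) - shift p * P ks) +
         (\<Sum>k\<in>Ks ks. p * shift (P (k # ks)) * [:0, 1:] ^ (K - k)))"
      have swap: "(\<Sum>ks\<in>T. \<Sum>k\<in>Ks ks. f k ks) = (\<Sum>ks\<in>T. case ks of [] \<Rightarrow> 0 | k # l \<Rightarrow> f k l)" for f :: "nat \<Rightarrow> nat list \<Rightarrow> rat"
      proof -
        have "(\<Sum>ks\<in>T. \<Sum>k\<in>Ks ks. f k ks) = (\<Sum>(ks,k)\<in>Sigma T Ks. f k ks)"
          by (rule sum.Sigma) (use fin finK in blast)+
        also have "\<dots> = (\<Sum>ks\<in>T - {[]}. case ks of [] \<Rightarrow> 0 | k # l \<Rightarrow> f k l)"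
        proof (rule sum.reindex_bij_witness[of _ "\<lambda>ks. (tl ks, hd ks)" "\<lambda>(l,k). k # l"], goal_cases)
          case (4 b)
          then obtain k l where "b = k # l" "k # l \<in> T" by (cases b) auto
          thus ?case using closed[of k l] by (simp add: Ks_def)
        qed (auto simp: Ks_def)
        also have "\<dots> = (\<Sum>ks\<in>T. case ks of [] \<Rightarrow> 0 | k # l \<Rightarrow> f k l)"
          using fin by (intro sum.mono_neutral_left) auto
        finally show ?thesis .
      qed
      have "(\<Sum>ks\<in>T. poly (Q ks) (of_nat N) * tz ks N) = 0" if N: "1 \<le> N" for N
      proof -
        let ?N = "of_nat N :: rat"
        have N0: "?N \<noteq> 0" using N by simp
        have "(\<Sum>ks\<in>T. poly (Q ks) ?N * tz ks N) =
          (\<Sum>ks\<in>T. ?N ^ K * (poly p ?N * poly (P ks) (?N + 1) - poly p (?N + 1) * poly (P ks) ?N) * tz ks N) +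
          (\<Sum>ks\<in>T. \<Sum>k\<in>Ks ks. poly p ?N * poly (P (k # ks)) (?N + 1) * ?N ^ (K - k) * tz ks N)"
          by (simp add: Q_def poly_sum distrib_right sum.distrib sum_distrib_right)
        also have "(\<Sum>ks\<in>T. \<Sum>k\<in>Ks ks. poly p ?N * poly (P (k # ks)) (?N + 1) * ?N ^ (K - k) * tz ks N) =
          (\<Sum>ks\<in>T. \<Sum>k\<in>Ks ks. poly p ?N * ?N ^ K * (poly (P (k # ks)) (?N + 1) * (tz ks N / ?N ^ k)))"
          using K N0 by (intro sum.cong refl) (simp add: Ks_def power_diff)
        also have "\<dots> = (\<Sum>ks\<in>T. poly p ?N * ?N ^ K * (poly (P ks) (?N + 1) * (case ks of [] \<Rightarrow> 0 | k # l \<Rightarrow> tz l N / ?N ^ k)))"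
          unfolding swap by (intro sum.cong refl) (simp split: list.splits)
        also have "(\<Sum>ks\<in>T. ?N ^ K * (poly p ?N * poly (P ks) (?N + 1) - poly p (?N + 1) * poly (P ks) ?N) * tz ks N) + \<dots> =
          ?N ^ K * poly p ?N * (\<Sum>ks\<in>T. poly (P ks) (?N + 1) * tz ks (Suc N)) -
          ?N ^ K * poly p (?N + 1) * (\<Sum>ks\<in>T. poly (P ks) ?N * tz ks N)"
          unfolding tz_Suc sum_distrib_left sum.distrib[symmetric] sum_subtractf[symmetric]
          by (intro sum.cong refl) (simp add: algebra_simps)
        also have "\<dots> = 0"
          using rel[OF N] rel[of "Suc N"] by (simp add: add.commute)
        finally show ?thesis .
      qed
      moreover have "Ks m = {}" unfolding Ks_def using m(2) by fastforce
      hence "Q m = 0" by (simp add: Q_def p_def)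
      ultimately have Q0: "\<forall>ks\<in>?T. Q ks = 0" by (rule reduce)
      have "\<exists>c. P (k # l) = smult c p" if "k \<in> Ks l" for k
      proof (cases "k # l = m")
        case True
        thus ?thesis by (intro exI[of _ 1]) (simp add: p_def)
      next
        case False
        have "Ks (k # l) = {}" unfolding Ks_def using m(2) Cons by fastforce
        moreover have "Q (k # l) = 0" using Q0 False that by (auto simp: Ks_def)
        ultimately have "p * shift (P (k # l)) = shift p * P (k # l)" by (simp add: Q_def)
        thus ?thesis using periodic_ratio_const p0 by (simp add: p_def)
      qed
      then obtain c where c: "\<And>k. k \<in> Ks l \<Longrightarrow> P (k # l) = smult (c k) p" by metis
      define J where "J = {k \<in> Ks l. c k \<noteq> 0}"
      have finJ: "finite J" using finK by (simp add: J_def)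
      have "k0 \<in> Ks l" using m(1) Cons by (simp add: Ks_def)
      hence "k0 \<in> J" using c[of k0] p0 Cons by (auto simp: J_def p_def)
      define M where "M = Max J"
      have MJ: "M \<in> J" unfolding M_def using finJ \<open>k0 \<in> J\<close> by (intro Max_in) auto
      have le: "k \<le> M" if "k \<in> J" for k unfolding M_def using finJ that by simp
      have MK: "M \<le> K" "1 \<le> M" using MJ K closed by (auto simp: J_def Ks_def)
      \<comment> \<open>This is \<open>x^M\<close> times the sum of \<open>c k / x^k\<close>. As
        \<open>M\<close> is the largest exponent with nonzero \<open>c\<close>, the value at 0 is
        \<open>c M\<close>.\<close>
      define s where "s = (\<Sum>k\<in>J. smult (c k) ([:0, 1:] ^ (M - k)) :: rat poly)"
      have "poly s 0 = (\<Sum>k\<in>J. if k = M then c k else 0)"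
        unfolding s_def poly_sum using le by (intro sum.cong refl) (force simp: power_0_left dest: le_antisym)
      hence s0: "poly s 0 \<noteq> 0" using MJ finJ by (simp add: J_def)
      have "(\<Sum>k\<in>Ks l. p * shift (P (k # l)) * [:0, 1:] ^ (K - k)) =
         (\<Sum>k\<in>J. p * shift p * [:0, 1:] ^ (K - M) * smult (c k) ([:0, 1:] ^ (M - k)))"
      proof (rule sum.mono_neutral_cong_right)
        show "\<forall>k\<in>Ks l - J. p * shift (P (k # l)) * [:0, 1:] ^ (K - k) = 0"
          using c by (auto simp: J_def)
        fix k assume k: "k \<in> J"
        hence "K - k = (K - M) + (M - k)" using le[OF k] MK by simp
        moreover have "P (k # l) = smult (c k) p" using c k by (simp add: J_def)
        ultimately show "p * shift (P (k # l)) * [:0, 1:] ^ (K - k) =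
          p * shift p * [:0, 1:] ^ (K - M) * smult (c k) ([:0, 1:] ^ (M - k))"
          by (simp add: power_add pcompose_smult algebra_simps)
      qed (use finK in \<open>auto simp: J_def\<close>)
      also have "\<dots> = [:0, 1:] ^ (K - M) * (p * shift p * s)"
        unfolding s_def sum_distrib_left by (intro sum.cong refl) (simp only: ac_simps)
      moreover have "[:0, 1:] ^ K = ([:0, 1:] ^ (K - M) * [:0, 1:] ^ M :: rat poly)"
        using MK by (simp flip: power_add)
      ultimately have "Q l = [:0, 1:] ^ (K - M) * ([:0, 1:] ^ M * (p * shift (P l) - shift p * P l) + p * shift p * s)"
        unfolding Q_def by (simp only: distrib_left mult.assoc)
      hence "[:0, 1:] ^ M * (p * shift (P l) - shift p * P l) + p * shift p * s = 0"
        using Q0 lT by simp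
      thus False using no_rational_telescoping[of p M s "P l"] p0 MK(2) s0 by (simp add: p_def)
    qed
  qed
  moreover have "\<forall>ks\<in>?T. P ks = 0" using reduce[of P] rel \<open>P m = 0\<close> by blast
  ultimately show ?case by blast
qed

lemma Zd_injective_words2:
  assumes keys: "Poly_Mapping.keys p \<subseteq> insert [] words2" and Z: "\<And>N. 1 \<le> N \<Longrightarrow> Zd p N = 0"
  shows "p = 0"
proof -
  define I where "I = {l. (\<forall>k\<in>set l. 2 \<le> k) \<and> ewords (rev l) \<in> Poly_Mapping.keys p}"
  \<comment> \<open>All tails are added to obtain the closure needed for
    \<open>tz_independent\<close>; those that do not occur in \<open>p\<close> get coefficient
    0.\<close>
  define T where "T = (\<Union>l\<in>I. (\<lambda>n. drop n l) ` {..length l})"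
  let ?e = "\<lambda>l. ewords (rev l)"
  have inj: "inj_on ?e {l. \<forall>k\<in>set l. 2 \<le> k}"
  proof (rule inj_onI)
    fix x y assume "x \<in> {l. \<forall>k\<in>set l. (2::nat) \<le> k}" "y \<in> {l. \<forall>k\<in>set l. 2 \<le> k}" "?e x = ?e y"
    thus "x = y" using ewords_inject[of "rev x" "rev y"] by force
  qed
  have "finite I"
  proof (rule finite_imageD)
    show "finite (?e ` I)" by (rule finite_subset[OF _ finite_keys[of p]]) (auto simp: I_def)
    show "inj_on ?e I" using inj by (rule inj_on_subset) (auto simp: I_def)
  qed
  hence finT: "finite T" by (simp add: T_def)
  have T2: "T \<subseteq> {l. \<forall>k\<in>set l. 2 \<le> k}" unfolding T_def I_def by (auto dest: in_set_dropD)
  have cover: "Poly_Mapping.keys p \<subseteq> ?e ` T"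
  proof
    fix w assume w: "w \<in> Poly_Mapping.keys p"
    hence "\<exists>ks. (\<forall>k\<in>set ks. 2 \<le> k) \<and> w = ewords ks"
      using keys by (force simp: words2_def intro: exI[of _ "[]"])
    then obtain ks where ks: "\<forall>k\<in>set ks. 2 \<le> k" "w = ewords ks" by blast
    hence "rev ks \<in> I" using w by (simp add: I_def)
    hence "rev ks \<in> T" unfolding T_def by (intro UN_I[of "rev ks"] image_eqI[of _ _ 0]) auto
    thus "w \<in> ?e ` T" using ks by (intro image_eqI[of _ _ "rev ks"]) simp_all
  qed
  have rel: "(\<Sum>l\<in>T. poly [:Poly_Mapping.lookup p (?e l):] (of_nat N) * tz l N) = 0" if "1 \<le> N" for N
  proof -
    have "Zd p N = (\<Sum>w\<in>?e ` T. Poly_Mapping.lookup p w * Zd_word w N)"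
      using finT cover by (intro Zd_superset) auto
    also have "\<dots> = (\<Sum>l\<in>T. Poly_Mapping.lookup p (?e l) * Zd_word (?e l) N)"
      using sum.reindex[OF inj_on_subset[OF inj T2]] by simp
    also have "\<dots> = (\<Sum>l\<in>T. poly [:Poly_Mapping.lookup p (?e l):] (of_nat N) * tz l N)"
      using T2 Zd_word_ewords_tz[of "rev _" N] by (intro sum.cong refl) (auto simp: subset_iff)
    finally show ?thesis using Z[OF that] by simp
  qed
  have "\<forall>l\<in>T. [:Poly_Mapping.lookup p (?e l):] = 0"
  proof (rule tz_independent[OF finT _ rel])
    fix k ks assume kT: "k # ks \<in> T"
    then obtain l n where l: "l \<in> I" "n \<le> length l" "k # ks = drop n l" by (auto simp: T_def)
    have "n < length l" using l(2,3) by (cases "n = length l") auto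
    moreover have "ks = drop (Suc n) l" using l(3) by (metis drop_Suc list.sel(3) tl_drop)
    ultimately have "ks \<in> T" unfolding T_def using l(1) by (intro UN_I[of l] image_eqI[of _ _ "Suc n"]) auto
    moreover have "1 \<le> k" using T2 kT by fastforce
    ultimately show "ks \<in> T \<and> 1 \<le> k" ..
  qed
  hence zero: "Poly_Mapping.lookup p w = 0" if "w \<in> ?e ` T" for w using that by auto
  have "w \<notin> Poly_Mapping.keys p" for w
    using zero[of w] cover by (auto simp: in_keys_iff subset_iff)
  hence "Poly_Mapping.keys p = {}" by blast
  thus ?thesis by simp
qed

subsection \<open>The kernel\<close>

lemma D_word_props:
  assumes "w = [] \<or> (hd w = Y \<and> last w = X)"
  shows "1 \<le> N \<Longrightarrow> Zd (D_word w) N = Zd_word w N" "Poly_Mapping.keys (D_word w) \<subseteq> insert [] words2"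
proof -
  obtain c where c: "blocks c" "cword c = w" using cword_exists[OF assms] by blast
  have e: "D_word w = Dfrak c"
    using D_word_cword[OF c(1)] c(2) by (cases "c = []") (auto simp: D_word_def)
  show "1 \<le> N \<Longrightarrow> Zd (D_word w) N = Zd_word w N"
    using Zd_Dfrak[OF c(1)] Zd_word_cword[OF c(1)] c(2) by (simp add: e)
  show "Poly_Mapping.keys (D_word w) \<subseteq> insert [] words2"
    unfolding e by (rule keys_Dfrak(1)[OF c(1)])
qed

lemma D_superset:
  assumes "finite S" "Poly_Mapping.keys p \<subseteq> S"
  shows "D p = (\<Sum>w\<in>S. hscale (Poly_Mapping.lookup p w) (D_word w))"
  unfolding D_def using assms
  by (intro sum.mono_neutral_left) (auto simp: in_keys_iff intro!: poly_mapping_eqI)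

lemma Zd_D: "in_H0 p \<Longrightarrow> 1 \<le> N \<Longrightarrow> Zd (D p) N = Zd p N"
  unfolding D_def Zd_sum by (simp add: Zd_def[of p] D_word_props(1) in_H0_def cong: sum.cong)

lemma keys_D: "in_H0 p \<Longrightarrow> Poly_Mapping.keys (D p) \<subseteq> insert [] words2"
  unfolding D_def
proof (rule order.trans[OF keys_sum], rule UN_least)
  fix w assume "in_H0 p" "w \<in> Poly_Mapping.keys p"
  thus "Poly_Mapping.keys (hscale (Poly_Mapping.lookup p w) (D_word w)) \<subseteq> insert [] words2"
    using order.trans[OF keys_hscale D_word_props(2)[of w]] by (simp add: in_H0_def)
qed

lemma words2_in_H0: "w \<in> words2 \<Longrightarrow> hd w = Y \<and> last w = X"
proof -
  assume "w \<in> words2"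
  then obtain ks where ks: "ks \<noteq> []" "\<forall>k\<in>set ks. 2 \<le> k" "w = ewords ks" by (auto simp: words2_def)
  then obtain k ks' where k: "ks = ks' @ [k]" by (metis rev_exhaust)
  have "w \<noteq> []" unfolding ks(3) k by (simp add: ewords_snoc)
  hence "hd w = Y" using ewords_hd[of ks] ks(3) by simp
  moreover have "2 \<le> k" using ks k by simp
  hence "last w = X" unfolding ks(3) k ewords_snoc by (simp add: last_replicate)
  ultimately show ?thesis ..
qed

theorem mainTheorem7:
  shows "{p. in_H0 p \<and> (\<forall>N\<ge>1. Zd p N = 0)} = Drop1"
proof (rule equalityI)
  interpret module hscale by (rule hscale_module)
  show "{p. in_H0 p \<and> (\<forall>N\<ge>1. Zd p N = 0)} \<subseteq> Drop1"
  proof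
    fix p assume "p \<in> {p. in_H0 p \<and> (\<forall>N\<ge>1. Zd p N = 0)}"
    hence p: "in_H0 p" "\<And>N. 1 \<le> N \<Longrightarrow> Zd p N = 0" by auto
    \<comment> \<open>\<open>D p\<close> has the values of \<open>p\<close>, which are all 0, and
      lies in the span on which the values determine the element.\<close>
    have "D p = 0"
      by (rule Zd_injective_words2[OF keys_D[OF p(1)]]) (simp add: Zd_D p)
    \<comment> \<open>\<open>Drop1\<close> is generated from elements without constant term.
      \<open>D\<close> fixes constants, so \<open>q - D q = p - D p = p\<close>.\<close>
    define q where "q = p - Poly_Mapping.single [] (Poly_Mapping.lookup p [])"
    have q: "Poly_Mapping.lookup q w = (if w = [] then 0 else Poly_Mapping.lookup p w)" for w
      by (simp add: q_def lookup_minus lookup_single)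
    have kq: "Poly_Mapping.keys q = Poly_Mapping.keys p - {[]}" by (auto simp: in_keys_iff q split: if_splits)
    have "in_yHx q" using p(1) unfolding in_yHx_def in_H0_def kq by blast
    let ?S = "insert [] (Poly_Mapping.keys p)"
    have "D p = (\<Sum>w\<in>?S. hscale (Poly_Mapping.lookup p w) (D_word w))"
      by (rule D_superset) auto
    also have "\<dots> = hscale (Poly_Mapping.lookup p []) (D_word []) +
        (\<Sum>w\<in>?S - {[]}. hscale (Poly_Mapping.lookup p w) (D_word w))"
      by (subst sum.remove[of _ "[]"]) auto
    also have "(\<Sum>w\<in>?S - {[]}. hscale (Poly_Mapping.lookup p w) (D_word w)) = D q"
    proof -
      have "Poly_Mapping.keys q \<subseteq> ?S - {[]}" using kq by blast
      thus ?thesis by (subst D_superset[of "?S - {[]}" q]) (auto simp: q intro!: sum.cong)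
    qed
    also have "hscale (Poly_Mapping.lookup p []) (D_word []) = Poly_Mapping.single [] (Poly_Mapping.lookup p [])"
      by (intro poly_mapping_eqI) (simp add: D_word_def hword_def lookup_single when_def)
    finally have "p = q - D q" using \<open>D p = 0\<close> by (simp add: q_def algebra_simps)
    thus "p \<in> Drop1" unfolding Drop1_def using \<open>in_yHx q\<close> by (intro span_base) blast
  qed
  show "Drop1 \<subseteq> {p. in_H0 p \<and> (\<forall>N\<ge>1. Zd p N = 0)}"
    unfolding Drop1_def
  proof (rule span_minimal)
    show "{w - D w |w. in_yHx w} \<subseteq> {p. in_H0 p \<and> (\<forall>N\<ge>1. Zd p N = 0)}"
    proof clarify
      fix w assume "in_yHx w"
      hence w: "in_H0 w" by (auto simp: in_yHx_def in_H0_def)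
      have "in_H0 (w - D w)"
        unfolding in_H0_def
      proof
        fix v assume "v \<in> Poly_Mapping.keys (w - D w)"
        hence "v \<in> Poly_Mapping.keys w \<or> v \<in> Poly_Mapping.keys (D w)"
          by (auto simp: in_keys_iff lookup_minus)
        thus "v = [] \<or> hd v = Y \<and> last v = X"
          using w keys_D[OF w] words2_in_H0 by (auto simp: in_H0_def)
      qed
      thus "in_H0 (w - D w) \<and> (\<forall>N\<ge>1. Zd (w - D w) N = 0)" using Zd_D[OF w] by simp
    qed
    show "subspace {p. in_H0 p \<and> (\<forall>N\<ge>1. Zd p N = 0)}"
    proof (rule subspaceI)
      fix p q assume "p \<in> {p. in_H0 p \<and> (\<forall>N\<ge>1. Zd p N = 0)}" "q \<in> {p. in_H0 p \<and> (\<forall>N\<ge>1. Zd p N = 0)}"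
      thus "p + q \<in> {p. in_H0 p \<and> (\<forall>N\<ge>1. Zd p N = 0)}"
        using keys_add[of p q] by (auto simp: in_H0_def)
    next
      fix a p assume "p \<in> {p. in_H0 p \<and> (\<forall>N\<ge>1. Zd p N = 0)}"
      thus "hscale a p \<in> {p. in_H0 p \<and> (\<forall>N\<ge>1. Zd p N = 0)}"
        using keys_hscale[of a p] by (auto simp: in_H0_def)
    qed (simp add: in_H0_def)
  qed
qed

end
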